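(* Let $(\lambda_0,\mu_0)$ be a partition pair with $p(\lambda_0)=p(\mu_0)$, and let $c^0_{\lambda,\mu}$ be the constants defined in the context. Then the element \[ a_{-\lambda_0}b_{-\mu_0}\cdot 1+\sum_{(\lambda,\mu):\,p(\mu)>p(\lambda)}\frac{(-1)^{-l(\lambda,\mu)-1}}{(-l(\lambda,\mu)-1)!}\,c^0_{\lambda,\mu}\;a_{-\lambda}b_{-\mu}\,E^{(-l(\lambda,\mu)-1)}(b) \] of $\mathscr D^{ch}(\mathbb H)$ is invariant under $\pi(g)$ for all $g\in SL(2,\mathbb Z)$, and hence under every congruence subgroup $\Gamma\subset SL(2,\mathbb Z)$.
   Context: Let $\mathbb H$ be the upper half plane and $\mathcal O(\mathbb H)$ its ring of holomorphic functions. Let $V=\mathbb C[a_{-1},a_{-2},\dots,b_0,b_{-1},\dots]$ be the vacuum module of the Heisenberg Lie algebra $[a_m,b_n]=\delta_{m,-n}C$ (with $a_m1=0$ for $m\ge0$, $b_n1=0$ for $n>0$, $C=1$), a vertex algebra with fields $a(z)=\sum a_nz^{-n-1}$, $b(z)=\sum b_nz^{-n}$. Let $\mathscr D^{ch}(\mathbb H)=V\otimes_{\mathbb C[b_0]}\mathcal O(\mathbb H)$ ($b_0\mapsto\tau$, $b=b_0$), the vertex algebra of chiral differential operators on $\mathbb H$, with $Y(f,z)=\sum_{i\ge0}\frac{f^{(i)}(b)}{i!}(\sum_{n\ne0}b_nz^{-n})^i$ for $f\in\mathcal O(\mathbb H)$. For a partition $\lambda=(\lambda_{(1)}\ge\dots\ge\lambda_{(d)}\ge1)$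 set $p(\lambda)=d$, $|\lambda|=\sum\lambda_{(i)}$, $a_{-\lambda}=a_{-\lambda_{(1)}}\cdots a_{-\lambda_{(d)}}$, similarly $b_{-\mu}$ (empty partition allowed), and $l(\lambda,\mu)=p(\lambda)-p(\mu)$. $SL(2,\mathbb R)$ acts on the right by vertex algebra automorphisms $\pi(g)$, integrating the zero modes of $E=-a_{-1}$, $F=a_{-1}b_0^2+2b_{-1}$, $H=-2a_{-1}b_0$ via $\pi(e^x)=\exp(-x_{(0)})$; for $g=\begin{pmatrix}\alpha&\beta\\\gamma&\delta\end{pmatrix}$, $\pi(g)a_{-1}=a_{-1}(\gamma b+\delta)^2+2\gamma^2b_{-1}$ and $\pi(g)f(b)=f(\frac{\alpha b+\beta}{\gamma b+\delta})$. For $(\lambda_0,\mu_0)$ with $p(\lambda_0)=p(\mu_0)$ there are unique complex constants $c^0_{\lambda,\mu}$, indexed by partition pairs with $p(\mu)>p(\lambda)$ (nonzero only if $|\lambda|+|\mu|=|\lambda_0|+|\mu_0|$) and independent of $g$, such that for all $g\in SL(2,\mathbb R)$ \[ \pi(g)(a_{-\lambda_0}b_{-\mu_0}\cdot1)=a_{-\lambda_0}b_{-\mu_0}\cdot 1+\sum_{p(\mu)>p(\lambda)}c^0_{\lambda,\mu}\,\gamma^{-l(\lambda,\mu)}\,a_{-\lambda}b_{-\mu}(\gamma b+\delta)^{l(\lambda,\mu)}. \] Let $E_2(\tau)=1-24\sum_{n\ge1}\sigma(n)e^{2\pi in\tau}$ with $\sigma(n)=\sum_{d\mid n}d$, and $E(\tau)=\frac{\pi}{6i}E_2(\tau)$;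 $E^{(s)}$ denotes its $s$-th derivative. *)

theory Defs
  imports "HOL-Analysis.Analysis" "HOL-Library.Multiset"
begin

text \<open>
Concrete model of the vertex algebra of chiral differential operators on the upper
half plane.  A monomial a_{-lambda} b_{-mu} (lambda, mu partitions) is encoded by the
pair of multisets (lambda, mu) of positive naturals.  An element of
D^ch(H) = V tensor_{C[b_0]} O(H) is a function assigning to every monomial its
coefficient, a holomorphic function of tau = b_0 (only its values on Im tau > 0 matter).
\<close>

type_synonym mono = "nat multiset \<times> nat multiset"
type_synonym state = "mono \<Rightarrow> complex \<Rightarrow> complex"

definition is_pp :: "mono \<Rightarrow> bool" where
  "is_pp m \<longleftrightarrow> (\<forall>k\<in>#fst m. k > 0) \<and> (\<forall>k\<in>#snd m. k > 0)"

text \<open>Heisenberg modes acting on D^ch(H) (Weyl algebra realisation):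
 a_{-k} (k>0) multiplication by a_{-k}; a_0 = d/d tau; a_k (k>0) = d/d b_{-k};
 b_{-k} (k>0) multiplication by b_{-k}; b_0 = multiplication by tau; b_k (k>0) = - d/d a_{-k}.
 These satisfy [a_m,b_n] = delta_{m,-n}, a_m 1 = 0 (m>=0), b_n 1 = 0 (n>0).\<close>

definition amul :: "nat \<Rightarrow> state \<Rightarrow> state" where
  "amul k s = (\<lambda>(l,u). if k \<in># l then s (l - {#k#}, u) else (\<lambda>_. 0))"

definition bmul :: "nat \<Rightarrow> state \<Rightarrow> state" where
  "bmul k s = (\<lambda>(l,u). if k \<in># u then s (l, u - {#k#}) else (\<lambda>_. 0))"

definition a0op :: "state \<Rightarrow> state" where
  "a0op s = (\<lambda>m. deriv (s m))"

definition b0op :: "state \<Rightarrow> state" where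
  "b0op s = (\<lambda>m \<tau>. \<tau> * s m \<tau>)"

definition apos :: "nat \<Rightarrow> state \<Rightarrow> state" where
  "apos k s = (\<lambda>(l,u) \<tau>. of_nat (count u k + 1) * s (l, u + {#k#}) \<tau>)"

definition bpos :: "nat \<Rightarrow> state \<Rightarrow> state" where
  "bpos k s = (\<lambda>(l,u) \<tau>. - of_nat (count l k + 1) * s (l + {#k#}, u) \<tau>)"

definition amode :: "int \<Rightarrow> state \<Rightarrow> state" where
  "amode j = (if j < 0 then amul (nat (- j)) else if j = 0 then a0op else apos (nat j))"

definition bmode :: "int \<Rightarrow> state \<Rightarrow> state" where
  "bmode j = (if j < 0 then bmul (nat (- j)) else if j = 0 then b0op else bpos (nat j))"

text \<open>Coefficient of z^{-n} in Y(f,z) = sum_i f^{(i)}(b)/i! (sum_{n<>0} b_n z^{-n})^i.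
 (The b-modes commute; the sum is over ordered tuples of nonzero indices summing to n.
 On any element with finitely many monomials only finitely many terms are nonzero.)\<close>

definition Yf :: "(complex \<Rightarrow> complex) \<Rightarrow> int \<Rightarrow> state \<Rightarrow> state" where
  "Yf f n s = (\<lambda>m \<tau>. \<Sum>\<^sub>\<infinity> ms \<in> {ms :: int list. 0 \<notin> set ms \<and> sum_list ms = n}.
        ((deriv ^^ length ms) f \<tau> / fact (length ms)) * fold bmode ms s m \<tau>)"

type_synonym mat2 = "real \<times> real \<times> real \<times> real"

definition sl2R :: "mat2 \<Rightarrow> bool" where
  "sl2R g = (case g of (\<alpha>,\<beta>,\<gamma>,\<delta>) \<Rightarrow> \<alpha> * \<delta> - \<beta> * \<gamma> = 1)"

definition gam :: "mat2 \<Rightarrow> real" where "gam g = fst (snd (snd g))"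
definition del :: "mat2 \<Rightarrow> real" where "del g = snd (snd (snd g))"

definition mob :: "mat2 \<Rightarrow> complex \<Rightarrow> complex" where
  "mob g \<tau> = (case g of (\<alpha>,\<beta>,\<gamma>,\<delta>) \<Rightarrow>
      (of_real \<alpha> * \<tau> + of_real \<beta>) / (of_real \<gamma> * \<tau> + of_real \<delta>))"

text \<open>Modes of the field Y(pi(g) b, z) = Y((alpha b+beta)/(gamma b+delta), z).\<close>
definition Bmode :: "mat2 \<Rightarrow> int \<Rightarrow> state \<Rightarrow> state" where
  "Bmode g n = Yf (mob g) n"

text \<open>Modes (coefficient of z^{-j-1}) of the field of
 pi(g) a_{-1} = a_{-1}(gamma b+delta)^2 + 2 gamma^2 b_{-1}, i.e. of
 :a(z) Y((gamma b+delta)^2,z): + 2 gamma^2 d/dz b(z).\<close>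
definition Pfun :: "mat2 \<Rightarrow> complex \<Rightarrow> complex" where
  "Pfun g = (\<lambda>\<tau>. (of_real (gam g) * \<tau> + of_real (del g))^2)"

definition Amode :: "mat2 \<Rightarrow> int \<Rightarrow> state \<Rightarrow> state" where
  "Amode g j s = (\<lambda>m \<tau>.
      (\<Sum>\<^sub>\<infinity> i \<in> {..-1::int}. amode i (Yf (Pfun g) (j - i) s) m \<tau>)
    + (\<Sum>\<^sub>\<infinity> i \<in> {0::int..}. Yf (Pfun g) (j - i) (amode i s) m \<tau>)
    - 2 * (of_real (gam g))^2 * of_int j * bmode j s m \<tau>)"

definition vac_state :: "(complex \<Rightarrow> complex) \<Rightarrow> state" where
  "vac_state h = (\<lambda>m. if m = ({#},{#}) then h else (\<lambda>_. 0))"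

text \<open>pi(g)(a_{-lambda} b_{-mu} f(b)) = pi(g)(a)_{-lambda} pi(g)(b)_{-mu} f(pi(g) b),
 the vertex algebra automorphism pi(g) being determined by pi(g) a_{-1} and pi(g) f(b).\<close>
definition apply_mono :: "mat2 \<Rightarrow> mono \<Rightarrow> (complex \<Rightarrow> complex) \<Rightarrow> state" where
  "apply_mono g m h =
     fold (\<lambda>k. Amode g (- int k)) (sorted_list_of_multiset (fst m))
       (fold (\<lambda>k. Bmode g (- int k)) (sorted_list_of_multiset (snd m)) (vac_state h))"

definition pi_act :: "mat2 \<Rightarrow> state \<Rightarrow> state" where
  "pi_act g s = (\<lambda>m' \<tau>. \<Sum>m \<in> {m. s m \<noteq> (\<lambda>_. 0)}. apply_mono g m (s m \<circ> mob g) m' \<tau>)"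

definition mono_state :: "nat multiset \<Rightarrow> nat multiset \<Rightarrow> state" where
  "mono_state l u = (\<lambda>m \<tau>. if m = (l, u) then 1 else 0)"

definition c0 :: "nat multiset \<Rightarrow> nat multiset \<Rightarrow> mono \<Rightarrow> complex" where
  "c0 l0 u0 = (THE c.
     (\<forall>m. \<not> (is_pp m \<and> size (fst m) < size (snd m)) \<longrightarrow> c m = 0) \<and>
     (\<forall>g. sl2R g \<longrightarrow> (\<forall>m \<tau>. Im \<tau> > 0 \<longrightarrow>
        pi_act g (mono_state l0 u0) m \<tau> =
          mono_state l0 u0 m \<tau> +
          (if is_pp m \<and> size (fst m) < size (snd m)
           then c m * (of_real (gam g)) ^ (size (snd m) - size (fst m))
                / (of_real (gam g) * \<tau> + of_real (del g)) ^ (size (snd m) - size (fst m))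
           else 0))))"

definition sigma1 :: "nat \<Rightarrow> nat" where
  "sigma1 n = (\<Sum>d \<in> {d. d dvd n}. d)"

definition E2 :: "complex \<Rightarrow> complex" where
  "E2 \<tau> = 1 - 24 * (\<Sum>n. of_nat (sigma1 (Suc n)) * exp (2 * of_real pi * \<i> * of_nat (Suc n) * \<tau>))"

definition Eis :: "complex \<Rightarrow> complex" where
  "Eis \<tau> = of_real pi / (6 * \<i>) * E2 \<tau>"

definition inv_elem :: "nat multiset \<Rightarrow> nat multiset \<Rightarrow> state" where
  "inv_elem l0 u0 = (\<lambda>m \<tau>. mono_state l0 u0 m \<tau> +
     (if is_pp m \<and> size (fst m) < size (snd m)
      then (let k = size (snd m) - size (fst m) - 1 in
            (-1) ^ k / fact k * c0 l0 u0 m * (deriv ^^ k) Eis \<tau>)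
      else 0))"

end

theory Submission
  imports Defs "HOL-Library.Poly_Mapping" "HOL-Complex_Analysis.Complex_Analysis"
begin

text \<open>
  Fix $g$ with $\gamma \ne 0$ and let $F$ be $\gamma^{-1}$ times the zero mode of $\pi(g) a_{-1}$. It commutes
  with the modes of $\pi(g) a_{-1}$ and with the creation modes of $\pi(g) b$, and on functions of $\pi(g) b$ it is
  $\gamma^{-1}$ times differentiation; hence $F \pi(g) = \gamma^{-1} \pi(g) \partial_\tau$, where $\partial_\tau$
  differentiates coefficients. In particular $F$ kills $\pi(g)(a_{-\lambda_0} b_{-\mu_0})$, which is a recurrence
  for the constants $c^0$. Put
  $\Xi(\varphi) = \sum \frac{(-1)^k}{k!} c^0_{\lambda,\mu} a_{-\lambda} b_{-\mu} \varphi^{(k)}$ with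
  $k = p(\mu) - p(\lambda) - 1$. By the recurrence, $F\, \Xi(\varphi) = \gamma^{-1} \Xi(\partial_\tau ((\gamma\tau+\delta)^2 \varphi))$,
  so $T(\varphi) = \pi(g) \Xi(\varphi)$ and $T(\varphi) = \Xi((\gamma\tau+\delta)^{-2} \varphi \circ g)$ both satisfy
  $F\, T(\varphi) = \gamma^{-1} T(\varphi')$. They have the same leading part with respect to $p(\mu) - p(\lambda)$
  minus the order of the derivative of $\varphi$, and a solution without leading part vanishes, as one sees on its
  components of lowest $p(\mu) - p(\lambda)$. So the two agree. The claim follows from
  $E(g\tau) = (\gamma\tau+\delta)^2 E(\tau) - \gamma(\gamma\tau+\delta)$, because
  $\Xi(\gamma(\gamma\tau+\delta)^{-1})$ is $\pi(g)(a_{-\lambda_0} b_{-\mu_0}) - a_{-\lambda_0} b_{-\mu_0}$.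
\<close>

section \<open>Quasi-modularity of the Eisenstein series of weight two\<close>

text \<open>The factor (-1)^k/k! turns the k-th derivative of \<gamma>/(\<gamma>\<tau>+\<delta>)
  into (\<gamma>/(\<gamma>\<tau>+\<delta>))^(k+1), so for a given g all correction terms come from
  one function. The obstacle: \<open>Xi\<close> must be understood on every \<phi>, whereas the
  relation defining c^0 supplies only that one function per g. The zero mode bridges the gap,
  because the recurrence it yields relates the constants level by level and does not involve \<phi>.
  Comparing the two solutions requires expansions with constants independent of \<phi>, and for c^0
  independent of g as well. Hence the modes are rescaled by \<gamma> and states are filtered by
  level n minus jet order k. On the lowest level the equation produces the factor n - 1 - k, which
  vanishes only on the leading part n - k = 1. The rescaling requires \<gamma> \<noteq> 0; for
  \<gamma> = 0 the action is diagonal on monomials and is computed directly. The constants first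
  appear as coefficients of the expansion at \<phi> = 1 and are matched with the definite
  description \<open>c0\<close> near the end.\<close>

lemma double_sums:
  fixes f :: "nat \<Rightarrow> nat \<Rightarrow> complex"
  assumes A: "summable A" "\<And>m. A m \<ge> (0::real)" and B: "summable B" "\<And>m. B m \<ge> (0::real)"
    and bd: "\<And>m n. norm (f m n) \<le> A m * B n"
    and row: "\<And>m. f m sums R m"
  shows "((\<lambda>(m, n). f m n) has_sum suminf R) UNIV" "R sums suminf R"
proof -
  have "(\<lambda>(m, n). A m * B n) summable_on (UNIV \<times> UNIV)"
  proof (rule summable_on_SigmaI[where g = "\<lambda>m. A m * suminf B"])
    fix m
    have "(\<lambda>n. A m * B n) sums (A m * suminf B)" using B by (intro sums_mult summable_sums)
    then show "((\<lambda>n. case (m, n) of (m, n) \<Rightarrow> A m * B n) has_sum A m * suminf B) UNIV"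
      using A B by (auto intro!: sums_nonneg_imp_has_sum)
  next
    have "summable (\<lambda>m. A m * suminf B)" using A by (intro summable_mult2)
    then show "(\<lambda>m. A m * suminf B) summable_on UNIV"
      using A B by (subst summable_on_UNIV_nonneg_real_iff) (auto simp: suminf_nonneg)
  qed (use A B in auto)
  then have "(\<lambda>x. norm (case x of (m, n) \<Rightarrow> f m n)) summable_on (UNIV \<times> UNIV)"
    by (rule Infinite_Sum.abs_summable_on_comparison_test') (use bd in auto)
  then have "(\<lambda>(m, n). f m n) summable_on (UNIV \<times> UNIV)"
    by (simp add: summable_on_iff_abs_summable_on_complex case_prod_unfold)
  then obtain S where S: "((\<lambda>(m, n). f m n) has_sum S) (UNIV \<times> UNIV)"
    unfolding summable_on_def by blast
  have "(R has_sum S) UNIV"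
  proof (rule has_sum_Sigma'[OF S])
    fix m
    have "summable (\<lambda>n. norm (f m n))"
      by (rule summable_comparison_test[OF _ summable_mult[OF B(1), of "A m"]]) (use bd in auto)
    then have "(f m has_sum R m) UNIV" by (rule norm_summable_imp_has_sum) (rule row)
    then show "((\<lambda>y. case (m, y) of (m, n) \<Rightarrow> f m n) has_sum R m) UNIV" by simp
  qed
  then have "R sums S" by (rule has_sum_imp_sums)
  then show "R sums suminf R" by (simp add: sums_iff)
  from \<open>R sums S\<close> S show "((\<lambda>(m, n). f m n) has_sum suminf R) UNIV"
    by (simp add: sums_iff)
qed

text \<open>A bound by a product of two summable sequences makes the family summable over pairs, so
  both iterated sums equal the sum over pairs; \<open>prod.swap\<close> relates the two index
  orders.\<close>

lemma double_sums_swap: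
  fixes f :: "nat \<Rightarrow> nat \<Rightarrow> complex"
  assumes A: "summable A" "\<And>m. A m \<ge> (0::real)" and B: "summable B" "\<And>m. B m \<ge> (0::real)"
    and bd: "\<And>m n. norm (f m n) \<le> A m * B n"
    and row: "\<And>m. f m sums R m" and col: "\<And>n. (\<lambda>m. f m n) sums C n"
  shows "R sums suminf R" "C sums suminf R"
proof -
  have 1: "((\<lambda>(m, n). f m n) has_sum suminf R) UNIV" "R sums suminf R"
    using double_sums[OF A B bd row] by auto
  have 2: "((\<lambda>(n, m). f m n) has_sum suminf C) UNIV" "C sums suminf C"
    using double_sums[OF B A, of "\<lambda>n m. f m n" C] bd col by (auto simp: mult.commute)
  have "((\<lambda>(m, n). f m n) has_sum suminf C) (prod.swap ` UNIV)"
    using 2(1) by (subst has_sum_reindex) (auto simp: o_def case_prod_unfold)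
  then have "suminf C = suminf R" using 1(1) by (auto dest: has_sum_unique simp: bij_swap bij_is_surj)
  then show "R sums suminf R" "C sums suminf R" using 1 2 by auto
qed

section \<open>Partial fractions of the cotangent and of its derivative\<close>

lemma not_nonpos_Ints_Im: "Im z \<noteq> 0 \<Longrightarrow> z \<notin> \<int>\<^sub>\<le>\<^sub>0"
  by (auto elim!: nonpos_Ints_cases)

lemma sin_pi_nonzero: "Im z \<noteq> 0 \<Longrightarrow> sin (of_real pi * z) \<noteq> 0"
proof
  assume z: "Im z \<noteq> 0" "sin (of_real pi * z) = 0"
  then obtain n :: int where "of_real pi * z = of_real (n * pi)"
    unfolding Complex_Transcendental.sin_eq_0 by auto
  then have "Im (of_real pi * z) = Im (of_real (n * pi))" by simp
  then show False using z by simp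
qed

text \<open>The logarithmic derivative of the reflection formula for
  \<open>Gamma z * Gamma (1 - z)\<close>.\<close>

lemma Digamma_reflection_complex:
  assumes "Im z \<noteq> 0"
  shows "Digamma (1 - z) - Digamma z = of_real pi * cos (of_real pi * z) / sin (of_real pi * z)"
proof -
  have nz: "z \<notin> \<int>\<^sub>\<le>\<^sub>0" "1 - z \<notin> \<int>\<^sub>\<le>\<^sub>0" using assms by (auto intro!: not_nonpos_Ints_Im)
  have s: "sin (of_real pi * z) \<noteq> 0" using assms by (rule sin_pi_nonzero)
  have 1: "((\<lambda>z. Gamma z * Gamma (1 - z)) has_field_derivative
      (Gamma z * Digamma z * Gamma (1 - z) - Gamma z * (Gamma (1 - z) * Digamma (1 - z)))) (at z)"
    using nz by (auto intro!: derivative_eq_intros)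
  have 2: "((\<lambda>z. of_real pi / sin (of_real pi * z)) has_field_derivative
      (- (of_real pi * (of_real pi * cos (of_real pi * z))) / (sin (of_real pi * z))\<^sup>2)) (at z)"
    using s by (auto intro!: derivative_eq_intros simp: power2_eq_square)
  have "Gamma z * Gamma (1 - z) * (Digamma z - Digamma (1 - z)) =
      - (of_real pi * (of_real pi * cos (of_real pi * z))) / (sin (of_real pi * z))\<^sup>2"
    using DERIV_unique[OF 1 2[folded Gamma_reflection_complex]] by (simp add: algebra_simps)
  then have "of_real pi / sin (of_real pi * z) * (Digamma z - Digamma (1 - z)) =
      of_real pi / sin (of_real pi * z) * (- (of_real pi * cos (of_real pi * z) / sin (of_real pi * z)))"
    unfolding Gamma_reflection_complex by (simp add: power2_eq_square)
  then have "Digamma z - Digamma (1 - z) = - (of_real pi * cos (of_real pi * z) / sin (of_real pi * z))"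
    by (rule mult_left_cancel[THEN iffD1, rotated]) (use s in simp)
  then show ?thesis by (simp add: algebra_simps)
qed

lemma cot_partial_fractions:
  assumes "Im z \<noteq> 0"
  shows "(\<lambda>n. 1 / (z + of_nat (Suc n)) + 1 / (z - of_nat (Suc n))) sums
     (of_real pi * cos (of_real pi * z) / sin (of_real pi * z) - 1 / z)"
proof -
  have z0: "z \<noteq> 0" "1 - z \<noteq> 0" using assms by auto
  have "(\<lambda>m. (of_real (ln (real m)) - (\<Sum>n<m. inverse (1 - z + of_nat n))) -
     (of_real (ln (real m)) - (\<Sum>n<m. inverse (z + of_nat n)))) \<longlonglongrightarrow> Digamma (1 - z) - Digamma z"
    by (intro tendsto_diff Digamma_LIMSEQ z0)
  then have 1: "(\<lambda>m. (\<Sum>n<m. inverse (z + of_nat n) - inverse (1 - z + of_nat n))) \<longlonglongrightarrow>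
     of_real pi * cos (of_real pi * z) / sin (of_real pi * z)"
    using Digamma_reflection_complex[OF assms] by (simp add: sum_subtractf)
  have 2: "(\<lambda>m. inverse (z + of_nat m)) \<longlonglongrightarrow> 0"
    by (intro filterlim_compose[OF tendsto_inverse_0]
              tendsto_add_filterlim_at_infinity[OF tendsto_const] tendsto_of_nat)
  \<comment> \<open>The Digamma limit pairs z+n with 1-z+n; pairing z+n with z-n instead shifts one
    index, which isolates 1/z and adds a boundary term tending to 0.\<close>
  have eq: "(\<Sum>n<m. 1 / (z + of_nat (Suc n)) + 1 / (z - of_nat (Suc n))) =
     (\<Sum>n<m. inverse (z + of_nat n) - inverse (1 - z + of_nat n)) + inverse (z + of_nat m) - 1 / z" for m
  proof (induction m)
    case 0 then show ?case by (simp add: field_simps)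
  next
    case (Suc m)
    have "1 / (z - of_nat (Suc m)) = - inverse (1 - z + of_nat m)"
      by (simp add: divide_inverse inverse_minus_eq[symmetric] algebra_simps del: inverse_minus_eq)
    then show ?case using Suc by (simp add: divide_inverse algebra_simps)
  qed
  have "(\<lambda>m. (\<Sum>n<m. 1 / (z + of_nat (Suc n)) + 1 / (z - of_nat (Suc n)))) \<longlonglongrightarrow>
    of_real pi * cos (of_real pi * z) / sin (of_real pi * z) + 0 - 1 / z"
    unfolding eq by (intro tendsto_intros 1 2)
  then show ?thesis unfolding sums_def by simp
qed

text \<open>The sum of (z+n)^(-2) over all integers n, hence one row of the Eisenstein series when z
  = m\<tau>.\<close>

definition csc2 :: "complex \<Rightarrow> complex" where
  "csc2 z = (of_real pi / sin (of_real pi * z))\<^sup>2"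

text \<open>The closed reflection formula is differentiated, not the cotangent series:
  \<open>Polygamma 1\<close> at z and at 1-z already is the sum of inverse squares, one half of the
  integers each.\<close>

lemma csc2_partial_fractions:
  assumes "Im z \<noteq> 0"
  shows "(\<lambda>n. 1 / (z + of_nat (Suc n))\<^sup>2 + 1 / (z - of_nat (Suc n))\<^sup>2) sums (csc2 z - 1 / z\<^sup>2)"
proof -
  have nz: "z \<notin> \<int>\<^sub>\<le>\<^sub>0" "1 - z \<notin> \<int>\<^sub>\<le>\<^sub>0" using assms by (auto intro!: not_nonpos_Ints_Im)
  have z0: "z \<noteq> 0" "1 - z \<noteq> 0" using assms by auto
  have s: "sin (of_real pi * z) \<noteq> 0" using assms by (rule sin_pi_nonzero)
  have opn: "open {z. Im z \<noteq> 0}"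
    by (intro open_Collect_neq continuous_intros)
  have 1: "((\<lambda>z. Digamma (1 - z) - Digamma z) has_field_derivative
      (- Polygamma 1 (1 - z) - Polygamma 1 z)) (at z)"
    using nz by (auto intro!: derivative_eq_intros)
  have 2: "((\<lambda>z. of_real pi * cos (of_real pi * z) / sin (of_real pi * z)) has_field_derivative
      (- csc2 z)) (at z)"
  proof -
    have e: "- (of_real pi * (of_real pi * sin (of_real pi * z))) * sin (of_real pi * z) -
       of_real pi * cos (of_real pi * z) * (of_real pi * cos (of_real pi * z)) = - (of_real pi ^ 2)"
      using sin_cos_squared_add[of "of_real pi * z"] by algebra
    show ?thesis unfolding csc2_def
      by (rule derivative_eq_intros refl s)+
        (use s e in \<open>simp add: field_simps power2_eq_square\<close>)
  qed
  have 3: "((\<lambda>z. Digamma (1 - z) - Digamma z) has_field_derivative (- csc2 z)) (at z)"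
    by (rule has_field_derivative_transform_within_open[OF 2 opn])
       (use assms Digamma_reflection_complex in auto)
  have 4: "Polygamma 1 (1 - z) + Polygamma 1 z = csc2 z"
    using DERIV_unique[OF 1 3] by (simp add: algebra_simps)
  have P: "(\<lambda>k. inverse ((w + of_nat k)\<^sup>2)) sums Polygamma 1 w" if "w \<noteq> 0" for w :: complex
    using Polygamma_converges'[OF that, of 2] by (simp add: Polygamma_def summable_sums numeral_2_eq_2)
  have "(\<lambda>k. inverse ((z + of_nat (Suc k))\<^sup>2)) sums (Polygamma 1 z - inverse (z\<^sup>2))"
    using sums_split_initial_segment[OF P[OF z0(1)], of 1] by simp
  moreover have "(\<lambda>k. inverse ((z - of_nat (Suc k))\<^sup>2)) sums Polygamma 1 (1 - z)"
  proof -
    have "(z - of_nat (Suc k))\<^sup>2 = (1 - z + of_nat k)\<^sup>2" for k by (simp add: power2_eq_square algebra_simps)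
    then show ?thesis using P[OF z0(2)] by simp
  qed
  ultimately have "(\<lambda>k. inverse ((z + of_nat (Suc k))\<^sup>2) + inverse ((z - of_nat (Suc k))\<^sup>2)) sums
     (Polygamma 1 z - inverse (z\<^sup>2) + Polygamma 1 (1 - z))" by (rule sums_add)
  then show ?thesis using 4[symmetric] by (simp add: divide_inverse algebra_simps)
qed

lemma csc2_minus: "csc2 (- z) = csc2 z" by (simp add: csc2_def)

section \<open>q-expansions and Lambert series\<close>

lemma csc2_q:
  assumes "Im z > 0"
  defines "q \<equiv> exp (2 * of_real pi * \<i> * z)"
  shows "csc2 z = - 4 * of_real pi ^ 2 * (q / (1 - q)\<^sup>2)" "norm q < 1"
proof -
  have s: "sin (of_real pi * z) \<noteq> 0" using assms by (intro sin_pi_nonzero) auto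
  define E where "E = exp (\<i> * (of_real pi * z))"
  have E0: "E \<noteq> 0" by (simp add: E_def)
  have qE: "q = E\<^sup>2" by (simp add: q_def E_def exp_double[symmetric] algebra_simps)
  have sE: "sin (of_real pi * z) = (E - inverse E) / (2 * \<i>)"
    by (simp add: sin_exp_eq E_def exp_minus)
  have "(sin (of_real pi * z))\<^sup>2 = - ((1 - q)\<^sup>2 / (4 * q))"
    unfolding sE qE using E0 by (simp add: field_simps power2_eq_square)
  then show "csc2 z = - 4 * of_real pi ^ 2 * (q / (1 - q)\<^sup>2)"
    unfolding csc2_def power_divide by simp
  show "norm q < 1" using assms by (simp add: q_def norm_exp_eq_Re)
qed

text \<open>Expand q^m/(1-q^m)^2 as the sum of d q^(md) over d and collect the terms with md = n:
  the coefficient of q^n is the sum of the divisors d of n.\<close>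

lemma Lambert_sigma:
  fixes q :: complex
  assumes "norm q < 1"
  shows "(\<lambda>m. q ^ Suc m / (1 - q ^ Suc m)\<^sup>2) sums suminf (\<lambda>m. q ^ Suc m / (1 - q ^ Suc m)\<^sup>2)"
    "(\<lambda>n. of_nat (sigma1 (Suc n)) * q ^ Suc n) sums suminf (\<lambda>m. q ^ Suc m / (1 - q ^ Suc m)\<^sup>2)"
proof -
  define f where "f m d = of_nat (Suc d) * q ^ (Suc m * Suc d)" for m d
  define R where "R m = q ^ Suc m / (1 - q ^ Suc m)\<^sup>2" for m
  have n1: "norm (q ^ Suc m) < 1" for m using assms
    by (simp add: norm_power power_less_one_iff del: power_Suc)
  have row: "f m sums R m" for m
  proof -
    have "(\<lambda>d. q ^ Suc m * (of_nat (Suc d) * (q ^ Suc m) ^ d)) sums (q ^ Suc m * (1 / (1 - q ^ Suc m)\<^sup>2))"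
      by (intro sums_mult geometric_deriv_sums n1)
    moreover have "q ^ Suc m * (of_nat (Suc d) * (q ^ Suc m) ^ d) = f m d" for d
      by (simp add: f_def power_add power_mult mult.left_commute power_mult_distrib)
    ultimately show ?thesis by (simp add: R_def)
  qed
  have bd: "norm (f m d) \<le> norm q ^ m * (of_nat (Suc d) * norm q ^ d)" for m d
  proof -
    have "norm q ^ (Suc m * Suc d) \<le> norm q ^ (m + d)"
      using assms by (intro power_decreasing) auto
    then have "real (Suc d) * norm q ^ (Suc m * Suc d) \<le> real (Suc d) * norm q ^ (m + d)"
      by (intro mult_left_mono) auto
    then show ?thesis by (simp add: f_def norm_mult norm_power power_add algebra_simps del: of_nat_Suc)
  qed
  have S: "((\<lambda>(m, n). f m n) has_sum suminf R) UNIV" "R sums suminf R"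
    using double_sums[of "\<lambda>m. norm q ^ m" "\<lambda>d. of_nat (Suc d) * norm q ^ d" f R]
      geometric_deriv_sums[of "norm q"] bd row assms by (auto simp: sums_iff)
  show "(\<lambda>m. q ^ Suc m / (1 - q ^ Suc m)\<^sup>2) sums suminf (\<lambda>m. q ^ Suc m / (1 - q ^ Suc m)\<^sup>2)"
    using S(2) unfolding R_def .
  \<comment> \<open>With both indices shifted by one, \<open>?h\<close> identifies pairs of factors
    with pairs (n, divisor of n), n > 0.\<close>
  let ?h = "\<lambda>(m, d). (Suc m * Suc d, Suc d)"
  have inj: "inj ?h" by (auto simp: inj_def simp del: mult_Suc mult_Suc_right)
  have img: "range ?h = Sigma {0<..} (\<lambda>n. {d. d dvd n})"
  proof (intro equalityI subsetI)
    fix x assume "x \<in> range ?h"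
    then show "x \<in> Sigma {0<..} (\<lambda>n. {d. d dvd n})" by (auto simp del: mult_Suc mult_Suc_right)
  next
    fix x assume "x \<in> Sigma {0<..} (\<lambda>n::nat. {d. d dvd n})"
    then obtain n d k where x: "x = (n, d)" "n > 0" "n = d * k" by (auto simp: dvd_def)
    then have "d > 0" "k > 0" by auto
    then have "x = ?h (k - 1, d - 1)" using x by (simp del: mult_Suc mult_Suc_right)
    then show "x \<in> range ?h" by blast
  qed
  have "((\<lambda>(n, d). of_nat d * q ^ n) \<circ> ?h) = (\<lambda>(m, n). f m n)"
    by (auto simp: f_def fun_eq_iff simp del: mult_Suc mult_Suc_right)
  then have S2: "((\<lambda>(n, d). of_nat d * q ^ n) has_sum suminf R) (Sigma {0<..} (\<lambda>n. {d. d dvd n}))"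
    using S(1) has_sum_reindex[OF inj, of "\<lambda>(n, d). of_nat d * q ^ n" "suminf R"] unfolding img by simp
  have "((\<lambda>n. of_nat (sigma1 n) * q ^ n) has_sum suminf R) {0<..}"
  proof (rule has_sum_Sigma'[OF S2])
    fix n :: nat assume "n \<in> {0<..}"
    then have "finite {d. d dvd n}" by simp
    then show "((\<lambda>d. case (n, d) of (n, d) \<Rightarrow> of_nat d * q ^ n) has_sum of_nat (sigma1 n) * q ^ n) {d. d dvd n}"
      by (auto simp: sigma1_def sum_distrib_right intro!: has_sum_finiteI)
  qed
  moreover have "{0<..} = range Suc" using greaterThan_0 by simp
  ultimately have "((\<lambda>n. of_nat (sigma1 (Suc n)) * q ^ Suc n) has_sum suminf R) UNIV"
    by (simp add: has_sum_reindex o_def)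
  then show "(\<lambda>n. of_nat (sigma1 (Suc n)) * q ^ Suc n) sums suminf (\<lambda>m. q ^ Suc m / (1 - q ^ Suc m)\<^sup>2)"
    unfolding R_def by (rule has_sum_imp_sums)
qed

text \<open>Identifies \<open>E2\<close> with the Eisenstein series summed row by row. The constant
  is -4 pi^2 from \<open>csc2_q\<close> divided by the -24 in \<open>E2\<close>.\<close>

lemma E2_csc2:
  assumes "Im \<tau> > 0"
  shows "(\<lambda>m. csc2 (of_nat (Suc m) * \<tau>)) sums (of_real pi ^ 2 / 6 * (E2 \<tau> - 1))"
proof -
  define q where "q = exp (2 * of_real pi * \<i> * \<tau>)"
  have qn: "norm q < 1" using csc2_q(2)[OF assms] by (simp add: q_def)
  have e: "exp (2 * of_real pi * \<i> * of_nat n * \<tau>) = q ^ n" for n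
    by (simp add: q_def exp_of_nat_mult[symmetric] algebra_simps)
  have e': "exp (2 * of_real pi * \<i> * (of_nat n * \<tau>)) = q ^ n" for n
    using e[of n] by (simp add: mult.assoc)
  have E: "E2 \<tau> = 1 - 24 * suminf (\<lambda>m. q ^ Suc m / (1 - q ^ Suc m)\<^sup>2)"
    using Lambert_sigma(2)[OF qn] unfolding E2_def e by (simp add: sums_iff)
  have "csc2 (of_nat (Suc m) * \<tau>) = (- 4 * of_real pi ^ 2) * (q ^ Suc m / (1 - q ^ Suc m)\<^sup>2)" for m
    using csc2_q(1)[of "of_nat (Suc m) * \<tau>"] assms unfolding e' by simp
  then show ?thesis
    using sums_mult[OF Lambert_sigma(1)[OF qn], of "- 4 * of_real pi ^ 2"] by (simp add: E mult.assoc)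
qed

lemma sums_inverse_squares_complex: "(\<lambda>n. 1 / (of_nat (Suc n))\<^sup>2 :: complex) sums (of_real pi ^ 2 / 6)"
proof -
  have "(\<lambda>n. of_real (1 / (real n + 1)\<^sup>2) :: complex) sums of_real (pi\<^sup>2 / 6)"
    using inverse_squares_sums by (intro sums_of_real) (simp add: add.commute)
  then show ?thesis by (simp add: add.commute)
qed

text \<open>The double series of (m\<tau>+n)^(-2) converges only conditionally: summing over n first
  gives \<open>E2 \<tau>\<close>, summing over m first gives \<open>E2 (- 1 / \<tau>)\<close>, and
  the orders differ. Subtracting a telescoping term makes the exchange legitimate, and the
  discrepancy is then read off from the two telescoping sums.\<close>

theorem E2_inversion:
  assumes "Im \<tau> > 0"
  shows "E2 (- 1 / \<tau>) = \<tau>\<^sup>2 * E2 \<tau> - 6 * \<i> * \<tau> / of_real pi"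
proof -
  define y where "y = Im \<tau>"
  define c where "c = y / norm \<tau>"
  have t0: "\<tau> \<noteq> 0" and y0: "y > 0" and c0: "c > 0" using assms by (auto simp: y_def c_def intro!: divide_pos_pos)
  define M where "M m = complex_of_nat (Suc m)" for m
  have M0: "M m \<noteq> 0" for m unfolding M_def by (simp del: of_nat_Suc)
  have ImM: "Im (M m * \<tau> + of_real x) = real (Suc m) * y" for m x by (simp add: M_def y_def)
  have lb1: "y * real (Suc m) \<le> norm (M m * \<tau> + of_real x)" for m x
    using abs_Im_le_cmod[of "M m * \<tau> + of_real x"] ImM[of m x] by (simp add: mult.commute)
  have lb2: "c * \<bar>x\<bar> \<le> norm (M m * \<tau> + of_real x)" for m x
  proof -
    have "Im (cnj \<tau> * (M m * \<tau> + of_real x)) = - (x * y)"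
      by (simp add: M_def y_def algebra_simps)
    then have "\<bar>x\<bar> * y \<le> norm (cnj \<tau> * (M m * \<tau> + of_real x))"
      using abs_Im_le_cmod[of "cnj \<tau> * (M m * \<tau> + of_real x)"] y0 by (simp add: abs_mult)
    also have "\<dots> = norm \<tau> * norm (M m * \<tau> + of_real x)" by (simp add: norm_mult)
    finally show ?thesis using t0 by (simp add: c_def pos_divide_le_eq mult.commute)
  qed
  have nz: "M m * \<tau> + of_real x \<noteq> 0" for m x
  proof
    assume "M m * \<tau> + of_real x = 0"
    then show False using ImM[of m x] y0 by simp
  qed
  \<comment> \<open>The subtracted difference equals 1/(w^2 - 1/4), so \<open>key\<close> decays
    like w^(-4); it telescopes under w -> w + 1.\<close>
  define key where "key w = 1 / w\<^sup>2 - (1 / (w - 1/2) - 1 / (w + 1/2))" for w :: complex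
  have key_eq: "key w = - (1 / 4) / (w * w * (w - 1/2) * (w + 1/2))"
    if "w \<noteq> 0" "w - 1/2 \<noteq> 0" "w + 1/2 \<noteq> 0" for w
  proof -
    have "1 / (w - 1/2) - 1 / (w + 1/2) = 1 / ((w - 1/2) * (w + 1/2))"
      using that by (simp add: diff_frac_eq)
    then have "key w = 1 / (w * w) - 1 / ((w - 1/2) * (w + 1/2))"
      unfolding key_def power2_eq_square by simp
    also have "\<dots> = ((w - 1/2) * (w + 1/2) - w * w) / (w * w * ((w - 1/2) * (w + 1/2)))"
      using that by (subst diff_frac_eq) auto
    also have "(w - 1/2) * (w + 1/2) - w * w = - (1 / 4)" by (simp add: algebra_simps)
    finally show ?thesis by (simp add: mult.assoc)
  qed
  have key_bound: "norm (key (M m * \<tau> + of_real x)) \<le> (1 / (2 * (y * c)\<^sup>2)) / ((real (Suc m))\<^sup>2 * (real (Suc n))\<^sup>2)"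
    if x: "\<bar>x\<bar> = real (Suc n)" for m n x
  proof -
    let ?w = "M m * \<tau> + of_real x"
    have sh: "?w - 1/2 = M m * \<tau> + of_real (x - 1/2)" "?w + 1/2 = M m * \<tau> + of_real (x + 1/2)"
      by simp_all
    have nzs: "?w \<noteq> 0" "?w - 1/2 \<noteq> 0" "?w + 1/2 \<noteq> 0" unfolding sh by (rule nz)+
    have l1: "y * real (Suc m) \<le> norm ?w" "c * real (Suc n) \<le> norm ?w"
      using lb1[of m x] lb2[of x m] x by auto
    have "real (Suc n) / 2 \<le> \<bar>x - 1/2\<bar>" using x by (auto simp: abs_if split: if_splits)
    then have "c * (real (Suc n) / 2) \<le> c * \<bar>x - 1/2\<bar>" using c0 by (intro mult_left_mono) auto
    then have l2: "c * (real (Suc n) / 2) \<le> norm (?w - 1/2)" using lb2[of "x - 1/2" m] unfolding sh by linarith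
    have l3: "y * real (Suc m) \<le> norm (?w + 1/2)" using lb1[of m "x + 1/2"] unfolding sh .
    \<comment> \<open>Of the four factors in the denominator two are bounded below through m and two
      through n, which gives the product bound (mn)^(-2); the shift by 1/2 costs the factor
      2.\<close>
    have "(y * real (Suc m)) * (c * real (Suc n)) * (c * (real (Suc n) / 2)) * (y * real (Suc m))
        \<le> norm ?w * norm ?w * norm (?w - 1/2) * norm (?w + 1/2)"
      using y0 c0 by (intro mult_mono l1 l2 l3 mult_nonneg_nonneg) auto
    also have "(y * real (Suc m)) * (c * real (Suc n)) * (c * (real (Suc n) / 2)) * (y * real (Suc m)) =
       (y * c)\<^sup>2 * ((real (Suc m))\<^sup>2 * (real (Suc n))\<^sup>2) / 2" by (simp add: power2_eq_square)
    finally have le: "(y * c)\<^sup>2 * ((real (Suc m))\<^sup>2 * (real (Suc n))\<^sup>2) / 2 \<le>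
       norm ?w * norm ?w * norm (?w - 1/2) * norm (?w + 1/2)" .
    have pos: "(y * c)\<^sup>2 * ((real (Suc m))\<^sup>2 * (real (Suc n))\<^sup>2) / 2 > 0"
      using y0 c0 by simp
    have "norm (key ?w) = (1 / 4) / (norm ?w * norm ?w * norm (?w - 1/2) * norm (?w + 1/2))"
      by (subst key_eq[OF nzs]) (simp add: norm_divide norm_mult)
    also have "\<dots> \<le> (1 / 4) / ((y * c)\<^sup>2 * ((real (Suc m))\<^sup>2 * (real (Suc n))\<^sup>2) / 2)"
      by (rule frac_le[OF _ _ pos le]) auto
    finally show ?thesis by (simp add: field_simps)
  qed
  define d where "d m n = key (M m * \<tau> + M n) + key (M m * \<tau> - M n)" for m n
  have d_bound: "norm (d m n) \<le> (1 / (y * c)\<^sup>2 * (1 / (real (Suc m))\<^sup>2)) * (1 / (real (Suc n))\<^sup>2)" for m n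
  proof -
    have "norm (key (M m * \<tau> + of_real (real (Suc n)))) \<le> (1 / (2 * (y * c)\<^sup>2)) / ((real (Suc m))\<^sup>2 * (real (Suc n))\<^sup>2)"
      by (rule key_bound) simp
    moreover have "norm (key (M m * \<tau> + of_real (- real (Suc n)))) \<le> (1 / (2 * (y * c)\<^sup>2)) / ((real (Suc m))\<^sup>2 * (real (Suc n))\<^sup>2)"
      by (rule key_bound) simp
    moreover have "M m * \<tau> + of_real (real (Suc n)) = M m * \<tau> + M n"
      "M m * \<tau> + of_real (- real (Suc n)) = M m * \<tau> - M n" by (simp_all add: M_def)
    ultimately have "norm (d m n) \<le> (1 / (2 * (y * c)\<^sup>2)) / ((real (Suc m))\<^sup>2 * (real (Suc n))\<^sup>2)
        + (1 / (2 * (y * c)\<^sup>2)) / ((real (Suc m))\<^sup>2 * (real (Suc n))\<^sup>2)"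
      unfolding d_def by (intro norm_triangle_mono) simp_all
    then show ?thesis by (simp add: field_simps)
  qed
  \<comment> \<open>The column sum over m of the telescoping term, obtained from the cotangent
    series at x/\<tau>.\<close>
  define C where "C x = 1 / \<tau> * (of_real pi * cos (of_real pi * (of_real x / \<tau>)) / sin (of_real pi * (of_real x / \<tau>))
     - 1 / (of_real x / \<tau>))" for x :: real
  have Im_x: "Im (of_real x / \<tau>) \<noteq> 0" if "x \<noteq> 0" for x
    using that y0 t0 by (simp add: Im_divide y_def complex_neq_0 power2_eq_square)
  have C_sums: "(\<lambda>m. 1 / (M m * \<tau> + of_real x) - 1 / (M m * \<tau> - of_real x)) sums C x" if "x \<noteq> 0" for x
  proof -
    have "(\<lambda>m. 1 / \<tau> * (1 / (of_real x / \<tau> + of_nat (Suc m)) + 1 / (of_real x / \<tau> - of_nat (Suc m)))) sums C x"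
      unfolding C_def by (intro sums_mult cot_partial_fractions Im_x that)
    moreover have "1 / \<tau> * (1 / (of_real x / \<tau> + of_nat (Suc m)) + 1 / (of_real x / \<tau> - of_nat (Suc m)))
       = 1 / (M m * \<tau> + of_real x) - 1 / (M m * \<tau> - of_real x)" for m
    proof -
      have "1 / \<tau> * (1 / (of_real x / \<tau> + M m)) = 1 / (M m * \<tau> + of_real x)"
        using t0 by (simp add: divide_simps algebra_simps)
      moreover have "1 / \<tau> * (1 / (of_real x / \<tau> - M m)) = 1 / (- (M m * \<tau> - of_real x))"
        using t0 by (simp add: divide_simps algebra_simps)
      ultimately show ?thesis unfolding M_def[symmetric] distrib_left
        by (simp add: minus_divide_right[symmetric] del: minus_diff_eq)
    qed
    ultimately show ?thesis by simp
  qed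
  have lim0: "(\<lambda>n. 1 / (w + of_nat n)) \<longlonglongrightarrow> 0" "(\<lambda>n. 1 / (w - of_nat n)) \<longlonglongrightarrow> 0" for w :: complex
  proof -
    show 1: "(\<lambda>n. 1 / (w + of_nat n)) \<longlonglongrightarrow> 0" for w :: complex
      unfolding divide_inverse mult_1
      by (intro filterlim_compose[OF tendsto_inverse_0]
              tendsto_add_filterlim_at_infinity[OF tendsto_const] tendsto_of_nat)
    have "(\<lambda>n. - (1 / (- w + of_nat n))) \<longlonglongrightarrow> - 0" by (intro tendsto_minus 1)
    moreover have "- (1 / (- w + of_nat n)) = 1 / (w - of_nat n)" for n
      by (metis add.commute diff_conv_add_uminus minus_diff_eq minus_divide_right)
    ultimately show "(\<lambda>n. 1 / (w - of_nat n)) \<longlonglongrightarrow> 0" by simp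
  qed
  have d_eq: "d m n = (1 / (M m * \<tau> + M n)\<^sup>2 + 1 / (M m * \<tau> - M n)\<^sup>2) -
     ((1 / (M m * \<tau> + 1/2 + of_nat n) - 1 / (M m * \<tau> + 1/2 + of_nat (Suc n))) +
      (1 / (M m * \<tau> - 1/2 - of_nat (Suc n)) - 1 / (M m * \<tau> - 1/2 - of_nat n)))" for m n
    unfolding d_def key_def by (simp add: M_def algebra_simps)
  define R where "R m = (csc2 (M m * \<tau>) - 1 / (M m * \<tau>)\<^sup>2) - (1 / (M m * \<tau> + 1/2) - 1 / (M m * \<tau> - 1/2))" for m
  have row: "d m sums R m" for m
  proof -
    have 1: "(\<lambda>n. 1 / (M m * \<tau> + M n)\<^sup>2 + 1 / (M m * \<tau> - M n)\<^sup>2) sums (csc2 (M m * \<tau>) - 1 / (M m * \<tau>)\<^sup>2)"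
    proof -
      have "Im (M m * \<tau>) = real (Suc m) * y" using ImM[of m 0] by (simp only: of_real_0 add_0_right)
      then have "Im (M m * \<tau>) \<noteq> 0" using y0 by simp
      from csc2_partial_fractions[OF this] show ?thesis unfolding M_def[symmetric] .
    qed
    have 2: "(\<lambda>n. 1 / (M m * \<tau> + 1/2 + of_nat n) - 1 / (M m * \<tau> + 1/2 + of_nat (Suc n))) sums
        (1 / (M m * \<tau> + 1/2 + of_nat 0) - 0)"
      by (rule telescope_sums') (rule lim0)
    have 3: "(\<lambda>n. 1 / (M m * \<tau> - 1/2 - of_nat (Suc n)) - 1 / (M m * \<tau> - 1/2 - of_nat n)) sums
        (0 - 1 / (M m * \<tau> - 1/2 - of_nat 0))"
      by (rule telescope_sums) (rule lim0)
    show ?thesis unfolding d_eq[abs_def] R_def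
      using sums_diff[OF 1 sums_add[OF 2 3]] by simp
  qed
  define Q where "Q n = (csc2 (M n * (- 1 / \<tau>)) / \<tau>\<^sup>2 - 1 / (M n)\<^sup>2) - (C (real n + 1/2) - C (real (Suc n) + 1/2))" for n
  have col: "(\<lambda>m. d m n) sums Q n" for n
  proof -
    have "(\<lambda>m. (1 / (M n / \<tau> + M m)\<^sup>2 + 1 / (M n / \<tau> - M m)\<^sup>2) / \<tau>\<^sup>2) sums
        ((csc2 (M n / \<tau>) - 1 / (M n / \<tau>)\<^sup>2) / \<tau>\<^sup>2)"
    proof -
      have "Im (M n / \<tau>) \<noteq> 0" using Im_x[of "real (Suc n)"] by (simp add: M_def)
      from sums_divide[OF csc2_partial_fractions[OF this], of "\<tau>\<^sup>2"] show ?thesis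
        unfolding M_def[symmetric] .
    qed
    moreover have "(1 / (M n / \<tau> + M m)\<^sup>2 + 1 / (M n / \<tau> - M m)\<^sup>2) / \<tau>\<^sup>2 =
        1 / (M m * \<tau> + M n)\<^sup>2 + 1 / (M m * \<tau> - M n)\<^sup>2" for m
    proof -
      have "1 / (M n / \<tau> + M m)\<^sup>2 / \<tau>\<^sup>2 = 1 / (M m * \<tau> + M n)\<^sup>2"
        using t0 by (simp add: power_mult_distrib[symmetric] distrib_right distrib_left add.commute mult.commute)
      moreover have "1 / (M n / \<tau> - M m)\<^sup>2 / \<tau>\<^sup>2 = 1 / (M m * \<tau> - M n)\<^sup>2"
        using t0 by (simp add: power_mult_distrib[symmetric] left_diff_distrib right_diff_distrib power2_commute mult.commute)
      ultimately show ?thesis by (simp add: add_divide_distrib)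
    qed
    moreover have "(csc2 (M n / \<tau>) - 1 / (M n / \<tau>)\<^sup>2) / \<tau>\<^sup>2 = csc2 (M n * (- 1 / \<tau>)) / \<tau>\<^sup>2 - 1 / (M n)\<^sup>2"
      using t0 csc2_minus[of "M n / \<tau>"] M0[of n] by (simp add: diff_divide_distrib power_divide)
    ultimately have 1: "(\<lambda>m. 1 / (M m * \<tau> + M n)\<^sup>2 + 1 / (M m * \<tau> - M n)\<^sup>2) sums
        (csc2 (M n * (- 1 / \<tau>)) / \<tau>\<^sup>2 - 1 / (M n)\<^sup>2)" by simp
    have 2: "(\<lambda>m. (1 / (M m * \<tau> + of_real (real n + 1/2)) - 1 / (M m * \<tau> - of_real (real n + 1/2))) -
       (1 / (M m * \<tau> + of_real (real (Suc n) + 1/2)) - 1 / (M m * \<tau> - of_real (real (Suc n) + 1/2)))) sums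
       (C (real n + 1/2) - C (real (Suc n) + 1/2))"
      by (intro sums_diff C_sums) auto
    show ?thesis unfolding d_eq Q_def
      using sums_diff[OF 1 2] by (simp add: algebra_simps)
  qed
  have inv2: "summable (\<lambda>n. 1 / (real (Suc n))\<^sup>2)"
    using inverse_squares_sums by (simp add: sums_iff add.commute)
  have S: "R sums suminf R" "Q sums suminf R"
    using double_sums_swap[OF summable_mult[OF inv2, of "1 / (y * c)\<^sup>2"] _ inv2 _ d_bound row col] by auto
  have Rs: "R sums ((of_real pi ^ 2 / 6 * (E2 \<tau> - 1) - (of_real pi ^ 2 / 6) / \<tau>\<^sup>2) - C (1/2))"
  proof -
    have "(\<lambda>m. 1 / (M m * \<tau>)\<^sup>2) sums ((of_real pi ^ 2 / 6) / \<tau>\<^sup>2)"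
      using sums_divide[OF sums_inverse_squares_complex, of "\<tau>\<^sup>2"]
      by (simp add: M_def power_mult_distrib)
    then show ?thesis unfolding R_def
      using E2_csc2[OF assms] C_sums[of "1/2"] by (intro sums_diff) (simp_all add: M_def)
  qed
  have Im': "Im (- 1 / \<tau>) > 0" using y0 t0 by (simp add: Im_divide y_def complex_neq_0 power2_eq_square)
  \<comment> \<open>The source of the anomaly: x/\<tau> runs off into the lower half plane, where
    the cotangent tends to i rather than to 0.\<close>
  have Clim: "(\<lambda>n. C (real n + 1/2)) \<longlonglongrightarrow> 1 / \<tau> * (of_real pi * \<i> - 0)"
  proof -
    define \<rho> where "\<rho> = exp (2 * of_real pi * \<i> * (- 1 / \<tau>))"
    define \<epsilon> where "\<epsilon> n = exp (of_real pi * \<i> * (- 1 / \<tau>)) * \<rho> ^ n" for n :: nat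
    have "norm \<rho> < 1" unfolding \<rho>_def by (rule csc2_q(2)[OF Im'])
    then have "(\<lambda>n. \<rho> ^ n) \<longlonglongrightarrow> 0" by (rule LIMSEQ_power_zero)
    then have e0: "\<epsilon> \<longlonglongrightarrow> 0" unfolding \<epsilon>_def by (rule tendsto_mult_right_zero)
    have cs: "cos w / sin w = \<i> * (1 + exp (- 2 * \<i> * w)) / (1 - exp (- 2 * \<i> * w))" for w :: complex
    proof -
      have "exp (\<i> * w) * exp (- 2 * \<i> * w) = exp (- (\<i> * w))" by (simp add: exp_add[symmetric])
      then have c: "cos w = exp (\<i> * w) * (1 + exp (- 2 * \<i> * w)) / 2"
        and s: "sin w = exp (\<i> * w) * (1 - exp (- 2 * \<i> * w)) / (2 * \<i>)"
        by (simp_all add: cos_exp_eq sin_exp_eq algebra_simps)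
      have "(X * Y / 2) / (X * Z / (2 * \<i>)) = \<i> * Y / Z" if "X \<noteq> 0" for X Y Z :: complex
        using that by (cases "Z = 0") (auto simp: field_simps)
      from this[OF exp_not_eq_zero] show ?thesis unfolding c s .
    qed
    have ep: "exp (- 2 * \<i> * (of_real pi * (of_real (real n + 1/2) / \<tau>))) = \<epsilon> n" for n
    proof -
      have "\<epsilon> n = exp (of_real pi * \<i> * (- 1 / \<tau>) + of_nat n * (2 * of_real pi * \<i> * (- 1 / \<tau>)))"
        unfolding \<epsilon>_def \<rho>_def exp_of_nat_mult[symmetric] by (simp only: exp_add)
      also have "of_real pi * \<i> * (- 1 / \<tau>) + of_nat n * (2 * of_real pi * \<i> * (- 1 / \<tau>)) =
         - 2 * \<i> * (of_real pi * (of_real (real n + 1/2) / \<tau>))" using t0 by (simp add: field_simps)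
      finally show ?thesis by simp
    qed
    have "(\<lambda>n. 1 / \<tau> * (of_real pi * (\<i> * (1 + \<epsilon> n) / (1 - \<epsilon> n)) - \<tau> * (1 / (1/2 + of_nat n)))) \<longlonglongrightarrow>
        1 / \<tau> * (of_real pi * (\<i> * (1 + 0) / (1 - 0)) - \<tau> * 0)"
      by (intro tendsto_intros e0 lim0) auto
    moreover have "C (real n + 1/2) = 1 / \<tau> * (of_real pi * (\<i> * (1 + \<epsilon> n) / (1 - \<epsilon> n)) - \<tau> * (1 / (1/2 + of_nat n)))" for n
      unfolding C_def ep[symmetric] cs[symmetric] by (simp add: add.commute)
    ultimately show ?thesis by simp
  qed
  have Qs: "Q sums (((of_real pi ^ 2 / 6 * (E2 (- 1 / \<tau>) - 1)) / \<tau>\<^sup>2 - of_real pi ^ 2 / 6) -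
     (C (real 0 + 1/2) - 1 / \<tau> * (of_real pi * \<i> - 0)))"
    unfolding Q_def
    by (intro sums_diff sums_divide telescope_sums'[OF Clim])
       (use E2_csc2[OF Im'] sums_inverse_squares_complex in \<open>simp_all add: M_def\<close>)
  \<comment> \<open>The boundary value \<open>C (1/2)\<close> occurs in both orders of summation and
    cancels; only the limit of \<open>C\<close> survives.\<close>
  have "(of_real pi ^ 2 / 6 * (E2 \<tau> - 1) - (of_real pi ^ 2 / 6) / \<tau>\<^sup>2) - C (1/2) =
     ((of_real pi ^ 2 / 6 * (E2 (- 1 / \<tau>) - 1)) / \<tau>\<^sup>2 - of_real pi ^ 2 / 6) -
     (C (1/2) - 1 / \<tau> * (of_real pi * \<i>))"
    using sums_unique2[OF S(1) Rs] sums_unique2[OF S(2) Qs] by simp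
  then have "of_real pi ^ 2 / 6 * (E2 \<tau> - 1) - (of_real pi ^ 2 / 6) / \<tau>\<^sup>2 =
     (of_real pi ^ 2 / 6 * (E2 (- 1 / \<tau>) - 1)) / \<tau>\<^sup>2 - of_real pi ^ 2 / 6 + 1 / \<tau> * (of_real pi * \<i>)"
    by (simp add: algebra_simps)
  then have "6 * \<tau>\<^sup>2 / of_real pi ^ 2 * (of_real pi ^ 2 / 6 * (E2 \<tau> - 1) - (of_real pi ^ 2 / 6) / \<tau>\<^sup>2) =
     6 * \<tau>\<^sup>2 / of_real pi ^ 2 * ((of_real pi ^ 2 / 6 * (E2 (- 1 / \<tau>) - 1)) / \<tau>\<^sup>2 - of_real pi ^ 2 / 6 + 1 / \<tau> * (of_real pi * \<i>))"
    by simp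
  then have "(36 * of_real pi * \<tau>\<^sup>2) * (6 * \<i> * \<tau> + of_real pi * E2 (- 1 / \<tau>)) =
      (36 * of_real pi * \<tau>\<^sup>2) * (of_real pi * (\<tau>\<^sup>2 * E2 \<tau>))"
    using t0 by (simp add: field_simps power2_eq_square)
  then have "6 * \<i> * \<tau> + of_real pi * E2 (- 1 / \<tau>) = of_real pi * (\<tau>\<^sup>2 * E2 \<tau>)"
    using t0 by (subst (asm) mult_left_cancel) auto
  then show ?thesis by (simp add: field_simps)
qed

lemma E2_holomorphic: "E2 holomorphic_on {\<tau>. Im \<tau> > 0}"
proof -
  define P where "P q = suminf (\<lambda>n. of_nat (sigma1 (Suc n)) * q ^ Suc n)" for q :: complex
  have "P holomorphic_on ball 0 1"
  proof (rule power_series_holomorphic[where a = "\<lambda>n. if n = 0 then 0 else of_nat (sigma1 n)"])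
    fix w :: complex assume "w \<in> ball 0 1"
    then have "(\<lambda>n. of_nat (sigma1 (Suc n)) * w ^ Suc n) sums P w"
      using Lambert_sigma(2)[of w] unfolding P_def by (auto simp: sums_iff)
    then show "(\<lambda>n. (if n = 0 then 0 else of_nat (sigma1 n)) * (w - 0) ^ n) sums P w"
      using sums_Suc_iff[of "\<lambda>n. (if n = 0 then 0 else of_nat (sigma1 n)) * w ^ n" "P w"] by simp
  qed
  moreover have "(\<lambda>\<tau>. exp (2 * of_real pi * \<i> * \<tau>)) holomorphic_on {\<tau>. Im \<tau> > 0}"
    by (intro holomorphic_intros)
  moreover have "exp (2 * of_real pi * \<i> * \<tau>) \<in> ball 0 1" if "Im \<tau> > 0" for \<tau>
    using csc2_q(2)[OF that] by simp
  ultimately have "(P \<circ> (\<lambda>\<tau>. exp (2 * of_real pi * \<i> * \<tau>))) holomorphic_on {\<tau>. Im \<tau> > 0}"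
    by (intro holomorphic_on_compose_gen) auto
  then have "(\<lambda>\<tau>. 1 - 24 * (P \<circ> (\<lambda>\<tau>. exp (2 * of_real pi * \<i> * \<tau>))) \<tau>) holomorphic_on {\<tau>. Im \<tau> > 0}"
    by (intro holomorphic_intros)
  moreover have e: "exp (2 * of_real pi * \<i> * of_nat n * \<tau>) = exp (2 * of_real pi * \<i> * \<tau>) ^ n" for n \<tau>
    by (simp add: exp_of_nat_mult[symmetric] algebra_simps)
  have "(\<lambda>\<tau>. 1 - 24 * (P \<circ> (\<lambda>\<tau>. exp (2 * of_real pi * \<i> * \<tau>))) \<tau>) = E2"
    unfolding E2_def P_def e o_def ..
  ultimately show ?thesis by simp
qed

lemma Eis_holomorphic: "Eis holomorphic_on {\<tau>. Im \<tau> > 0}"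
  unfolding Eis_def by (intro holomorphic_intros E2_holomorphic)

lemma E2_periodic: "E2 (\<tau> + of_int k) = E2 \<tau>"
proof -
  have "exp (2 * of_real pi * \<i> * of_nat (Suc n) * (\<tau> + of_int k)) =
        exp (2 * of_real pi * \<i> * of_nat (Suc n) * \<tau>)" for n
  proof -
    have "2 * of_real pi * \<i> * of_nat (Suc n) * (\<tau> + of_int k) =
       2 * of_real pi * \<i> * of_nat (Suc n) * \<tau> + 2 * of_real pi * \<i> * of_int (int (Suc n) * k)"
      by (simp add: algebra_simps)
    moreover have "exp (2 * of_real pi * \<i> * of_int (int (Suc n) * k)) = 1"
      using exp_integer_2pi[of "of_int (int (Suc n) * k)"] by (simp add: algebra_simps)
    ultimately show ?thesis by (simp only: exp_add) simp
  qed
  then show ?thesis unfolding E2_def by presburger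
qed

section \<open>Transformation of E under SL(2,Z)\<close>

lemma Im_moebius_pos:
  assumes "a * d - b * c = (1::real)" "Im \<tau> > 0"
  shows "Im ((of_real a * \<tau> + of_real b) / (of_real c * \<tau> + of_real d)) > 0"
    "of_real c * \<tau> + of_real d \<noteq> 0"
proof -
  show nz: "of_real c * \<tau> + of_real d \<noteq> 0"
  proof
    assume *: "of_real c * \<tau> + of_real d = 0"
    then have "c * Im \<tau> = 0" by (auto simp: complex_eq_iff)
    then have "c = 0" using assms by auto
    then show False using * assms by auto
  qed
  let ?u = "of_real c * \<tau> + of_real d"
  have "(of_real a * \<tau> + of_real b) / ?u = (of_real a * \<tau> + of_real b) * cnj ?u / of_real ((norm ?u)\<^sup>2)"
    by (subst complex_div_cnj) simp
  then have "Im ((of_real a * \<tau> + of_real b) / ?u) = Im ((of_real a * \<tau> + of_real b) * cnj ?u) / (norm ?u)\<^sup>2"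
    by (simp only: Im_divide_of_real)
  also have "Im ((of_real a * \<tau> + of_real b) * cnj ?u) = (a * d - b * c) * Im \<tau>"
    by (simp add: algebra_simps)
  finally show "Im ((of_real a * \<tau> + of_real b) / ?u) > 0" using assms nz by simp
qed

text \<open>Euclid's algorithm on the lower row: a translation and the inversion replace \<gamma> by
  \<delta> mod \<gamma>, and translations alone remain when \<gamma> = 0.\<close>

theorem Eis_transform:
  fixes \<alpha> \<beta> \<gamma> \<delta> :: int
  assumes "\<alpha> * \<delta> - \<beta> * \<gamma> = 1" "Im \<tau> > 0"
  shows "Eis ((of_int \<alpha> * \<tau> + of_int \<beta>) / (of_int \<gamma> * \<tau> + of_int \<delta>)) =
    (of_int \<gamma> * \<tau> + of_int \<delta>)\<^sup>2 * Eis \<tau> - of_int \<gamma> * (of_int \<gamma> * \<tau> + of_int \<delta>)"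
  using assms
proof (induction "nat \<bar>\<gamma>\<bar>" arbitrary: \<alpha> \<beta> \<gamma> \<delta> \<tau> rule: less_induct)
  case less
  have per: "Eis (\<tau> + of_int k) = Eis \<tau>" for \<tau> k by (simp add: Eis_def E2_periodic)
  show ?case
  proof (cases "\<gamma> = 0")
    case True
    then have "\<alpha> * \<delta> = 1" using less.prems by simp
    then consider "\<alpha> = 1" "\<delta> = 1" | "\<alpha> = - 1" "\<delta> = - 1" by (auto simp: zmult_eq_1_iff)
    then show ?thesis
    proof cases
      case 1
      then show ?thesis using True per[of \<tau> \<beta>] by simp
    next
      case 2
      have "(of_int \<alpha> * \<tau> + of_int \<beta>) / (of_int \<gamma> * \<tau> + of_int \<delta>) = \<tau> + of_int (- \<beta>)"
        using True 2 by simp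
      then show ?thesis using True 2 per[of \<tau> "- \<beta>"] by (simp del: of_int_minus) simp
    qed
  next
    case False
    \<comment> \<open>With w = \<tau> - k, the same point is the image of -1/w under a matrix whose
      lower row is (\<gamma>', -\<gamma>), and this k makes \<gamma>' the remainder of \<delta>
      modulo \<gamma>.\<close>
    define k where "k = - (\<delta> div \<gamma>)"
    define \<gamma>' where "\<gamma>' = \<gamma> * k + \<delta>"
    define w where "w = \<tau> - of_int k"
    have g': "\<gamma>' = \<delta> mod \<gamma>" unfolding \<gamma>'_def k_def by (simp add: minus_mult_div_eq_mod[symmetric])
    have lt: "nat \<bar>\<gamma>'\<bar> < nat \<bar>\<gamma>\<bar>" unfolding g' using False
      by (metis abs_mod_less nat_less_eq_zless abs_ge_zero)
    have det: "(\<alpha> * k + \<beta>) * (- \<gamma>) - (- \<alpha>) * \<gamma>' = 1"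
      using less.prems(1) by (simp add: \<gamma>'_def algebra_simps)
    have Imw: "Im w > 0" using less.prems by (simp add: w_def)
    then have w0: "w \<noteq> 0" by auto
    have Ims: "Im (- 1 / w) > 0" using Im_moebius_pos(1)[of 0 0 "-1" 1 w] Imw by simp
    define u where "u = of_int \<gamma> * \<tau> + of_int \<delta>"
    define u' where "u' = of_int \<gamma>' * (- 1 / w) + of_int (- \<gamma>)"
    have u0: "u \<noteq> 0" using Im_moebius_pos(2)[of \<alpha> \<delta> \<beta> \<gamma> \<tau>] less.prems
      by (simp add: u_def) (metis of_int_1 of_int_diff of_int_mult)
    have "u' * w = - of_int \<gamma>' - of_int \<gamma> * w" unfolding u'_def using w0
      by (simp add: distrib_right left_diff_distrib)
    \<comment> \<open>The cocycle relation of the automorphy factors; the sign disappears in the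
      square and turns the linear term into the expected one.\<close>
    then have uu: "u' * w = - u" by (simp add: u_def \<gamma>'_def w_def algebra_simps)
    have u'0: "u' \<noteq> 0" using uu u0 by auto
    have arg: "(of_int (\<alpha> * k + \<beta>) * (- 1 / w) + of_int (- \<alpha>)) / u' = (of_int \<alpha> * \<tau> + of_int \<beta>) / u"
    proof -
      have "(of_int (\<alpha> * k + \<beta>) * (- 1 / w) + of_int (- \<alpha>)) * w = - of_int (\<alpha> * k + \<beta>) - of_int \<alpha> * w"
        using w0 by (simp add: distrib_right left_diff_distrib add_divide_distrib)
      also have "\<dots> = - (of_int \<alpha> * \<tau> + of_int \<beta>)" by (simp add: w_def algebra_simps)
      finally have "(of_int (\<alpha> * k + \<beta>) * (- 1 / w) + of_int (- \<alpha>)) * w = - (of_int \<alpha> * \<tau> + of_int \<beta>)" .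
      then have "(of_int (\<alpha> * k + \<beta>) * (- 1 / w) + of_int (- \<alpha>)) / u' = (- (of_int \<alpha> * \<tau> + of_int \<beta>)) / (u' * w)"
        using w0 by (metis mult_divide_mult_cancel_right)
      then show ?thesis unfolding uu minus_divide_divide .
    qed
    have E1: "Eis ((of_int \<alpha> * \<tau> + of_int \<beta>) / u) = u'\<^sup>2 * Eis (- 1 / w) - of_int \<gamma>' * u'"
      using less.hyps[OF lt det Ims] arg unfolding u'_def by simp
    have E2: "Eis (- 1 / w) = w\<^sup>2 * Eis w - w"
      unfolding Eis_def E2_inversion[OF Imw] by (simp add: field_simps)
    have E3: "Eis w = Eis \<tau>" using per[of w k] by (simp add: w_def)
    have "u'\<^sup>2 * (w\<^sup>2 * Eis \<tau> - w) - of_int \<gamma>' * u' = (u' * w)\<^sup>2 * Eis \<tau> - u' * (u' * w + of_int \<gamma>')"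
      by (simp add: power2_eq_square algebra_simps)
    also have "u' * w + of_int \<gamma>' = - (of_int \<gamma> * w)" unfolding uu
      by (simp add: u_def \<gamma>'_def w_def algebra_simps)
    also have "(u' * w)\<^sup>2 * Eis \<tau> - u' * - (of_int \<gamma> * w) = (u' * w)\<^sup>2 * Eis \<tau> + of_int \<gamma> * (u' * w)"
      by simp
    finally show ?thesis unfolding uu u_def[symmetric] E1 E2 E3 by simp
  qed
qed

section \<open>The transformed fields over a Heisenberg algebra\<close>

lemma linear_Sum_any:
  assumes "linear f" and "finite {i. g i \<noteq> 0}"
  shows "f (Sum_any g) = Sum_any (\<lambda>i. f (g i))"
proof -
  have "{i. f (g i) \<noteq> 0} \<subseteq> {i. g i \<noteq> 0}"
    using linear_0[OF assms(1)] by auto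
  then show ?thesis
    using assms by (simp add: Sum_any.expand_superset[of "{i. g i \<noteq> 0}"] linear_sum)
qed

lemma Sum_any_shift: "Sum_any (\<lambda>i::int. f (i + k)) = Sum_any f"
  by (rule Sum_any.reindex_cong[symmetric, where l = "\<lambda>i. i + k"]) (auto intro!: o_bij[where g = "\<lambda>i. i - k"] simp: fun_eq_iff)

lemma bij_int_diff: "bij (\<lambda>i::int. k - i)"
  by (rule o_bij[where g = "\<lambda>i. k - i"]) auto

lemma Sum_any_reflect: "Sum_any (\<lambda>i::int. f (k - i)) = Sum_any f"
  by (rule Sum_any.reindex_cong[symmetric, OF bij_int_diff[of k]]) (auto simp: fun_eq_iff)

lemma finite_int_support:
  assumes "\<And>i::int. P i \<Longrightarrow> L \<le> i \<and> i \<le> U"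
  shows "finite {i. P i}"
  by (rule finite_subset[of _ "{L..U}"]) (use assms in auto)

text \<open>\<open>Sum_any\<close> returns 0 on infinite supports, so iterated sums may be split or
  exchanged only under joint finiteness; a common bound for both indices provides it.\<close>

definition boxed :: "(int \<Rightarrow> int \<Rightarrow> 'w::zero) \<Rightarrow> bool" where
  "boxed f \<longleftrightarrow> (\<exists>M. \<forall>i q. f i q \<noteq> 0 \<longrightarrow> \<bar>i\<bar> \<le> M \<and> \<bar>q\<bar> \<le> M)"

lemma boxedI: "(\<And>i q. f i q \<noteq> 0 \<Longrightarrow> \<bar>i\<bar> \<le> M \<and> \<bar>q\<bar> \<le> M) \<Longrightarrow> boxed f"
  unfolding boxed_def by blast

lemma boxed_finite:
  assumes "boxed f"
  shows "finite {q. f i q \<noteq> 0}" "finite {i. f i q \<noteq> 0}" "finite {i. Sum_any (f i) \<noteq> 0}"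
    "finite {q. Sum_any (\<lambda>i. f i q) \<noteq> 0}"
proof -
  obtain M where M: "\<And>i q. f i q \<noteq> 0 \<Longrightarrow> \<bar>i\<bar> \<le> M \<and> \<bar>q\<bar> \<le> M"
    using assms unfolding boxed_def by blast
  show "finite {q. f i q \<noteq> 0}" for i
    by (rule finite_int_support[of _ "- M" M]) (use M in fastforce)
  show "finite {i. f i q \<noteq> 0}" for q
    by (rule finite_int_support[of _ "- M" M]) (use M in fastforce)
  show "finite {i. Sum_any (f i) \<noteq> 0}"
    by (rule finite_int_support[of _ "- M" M])
       (use M in \<open>fastforce elim: Sum_any.not_neutral_obtains_not_neutral\<close>)
  show "finite {q. Sum_any (\<lambda>i. f i q) \<noteq> 0}"
    by (rule finite_int_support[of _ "- M" M])
       (use M in \<open>fastforce elim: Sum_any.not_neutral_obtains_not_neutral\<close>)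
qed

lemma boxed_swap:
  assumes "boxed f"
  shows "Sum_any (\<lambda>i. Sum_any (\<lambda>q. f i q)) = Sum_any (\<lambda>q. Sum_any (\<lambda>i. f i q))"
proof -
  obtain M where M: "\<And>i q. f i q \<noteq> 0 \<Longrightarrow> \<bar>i\<bar> \<le> M \<and> \<bar>q\<bar> \<le> M"
    using assms unfolding boxed_def by blast
  show ?thesis
    by (rule Sum_any.swap[of "{-M..M} \<times> {-M..M}"]) (use M in \<open>force+\<close>)
qed

lemma boxed_Sum_add:
  fixes f g :: "int \<Rightarrow> int \<Rightarrow> 'w::comm_monoid_add"
  assumes "boxed f" "boxed g"
  shows "Sum_any (\<lambda>i. Sum_any (\<lambda>q. f i q + g i q)) =
         Sum_any (\<lambda>i. Sum_any (f i)) + Sum_any (\<lambda>i. Sum_any (g i))"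
  using boxed_finite[OF assms(1)] boxed_finite[OF assms(2)]
  by (simp add: Sum_any.distrib)

text \<open>\<open>loc_fin\<close> is smoothness of the module: on each vector the modes of normally
  ordered products are finite sums.\<close>

locale heis =
  fixes a b :: "int \<Rightarrow> 'w::real_vector \<Rightarrow> 'w"
  assumes lin_a: "linear (a i)" and lin_b: "linear (b i)"
    and a_comm: "a i (a j x) = a j (a i x)"
    and b_comm: "b i (b j x) = b j (b i x)"
    and a_b: "a i (b j x) = b j (a i x) + (if i + j = 0 then x else 0)"
    and loc_fin: "\<exists>N. \<forall>i>N. a i x = 0 \<and> b i x = 0"
begin

lemmas a_lin [simp] = linear_0[OF lin_a] linear_add[OF lin_a] linear_diff[OF lin_a] linear_neg[OF lin_a]
   linear_scale[OF lin_a]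
lemmas b_lin [simp] = linear_0[OF lin_b] linear_add[OF lin_b] linear_diff[OF lin_b] linear_neg[OF lin_b]
   linear_scale[OF lin_b]

lemma loc_finE:
  obtains N where "N \<ge> 0" "\<forall>i>N. a i x = 0" "\<forall>i>N. b i x = 0"
proof -
  obtain N where "\<forall>i>N. a i x = 0 \<and> b i x = 0" using loc_fin by blast
  then show ?thesis by (intro that[of "max N 0"]) auto
qed

text \<open>
  \<open>bb\<close>, \<open>bbb\<close> and \<open>ab\<close> are the modes of $b(z)^2$, $b(z)^3$ and $:a(z) b(z):$, and \<open>A\<close> those of
  $:a(z) b(z)^2: + 2 \partial b(z)$, the field of $\pi(g) a_{-1}$ once $b$ is replaced by $\gamma b + \delta$.\<close>

definition bb :: "int \<Rightarrow> 'w \<Rightarrow> 'w" where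
  "bb n x = Sum_any (\<lambda>p. b p (b (n - p) x))"

definition bbb :: "int \<Rightarrow> 'w \<Rightarrow> 'w" where
  "bbb n x = Sum_any (\<lambda>p. b p (bb (n - p) x))"

definition ab :: "int \<Rightarrow> 'w \<Rightarrow> 'w" where
  "ab n x = Sum_any (\<lambda>i. if i < 0 then a i (b (n - i) x) else b (n - i) (a i x))"

definition Aterm :: "int \<Rightarrow> int \<Rightarrow> 'w \<Rightarrow> 'w" where
  "Aterm j i x = (if i < 0 then a i (bb (j - i) x) else bb (j - i) (a i x))"

definition A :: "int \<Rightarrow> 'w \<Rightarrow> 'w" where
  "A j x = Sum_any (\<lambda>i. Aterm j i x) - (2 * of_int j) *\<^sub>R b j x"

lemma bb_support:
  assumes "\<forall>i>N. b i x = 0" and "b p (b (n - p) x) \<noteq> 0"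
  shows "n - N \<le> p \<and> p \<le> N"
proof -
  have "\<not> p > N" using assms b_comm[of p "n - p" x] by auto
  moreover have "\<not> n - p > N" using assms by auto
  ultimately show ?thesis by linarith
qed

lemma finite_bb: "finite {p. b p (b (n - p) x) \<noteq> 0}"
proof -
  obtain N where "\<forall>i>N. b i x = 0" using loc_finE[of x] by metis
  from bb_support[OF this] show ?thesis by (rule finite_int_support[of _ "n - N" N])
qed

lemma bb_eq_sum:
  assumes "\<forall>i>N. b i x = 0"
  shows "bb n x = (\<Sum>p\<in>{n - N..N}. b p (b (n - p) x))"
  unfolding bb_def by (rule Sum_any.expand_superset) (use bb_support[OF assms] in auto)

lemma bb_eq_0:
  assumes "\<forall>i>N. b i x = 0" "n > 2 * N"
  shows "bb n x = 0"
  unfolding bb_eq_sum[OF assms(1), of n] using assms(2) by (intro sum.neutral) auto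

lemma lin_bb: "linear (bb n)"
proof (rule linearI)
  show "bb n (x + y) = bb n x + bb n y" for x y
    unfolding bb_def by (simp add: Sum_any.distrib finite_bb)
  show "bb n (r *\<^sub>R x) = r *\<^sub>R bb n x" for r x
    unfolding bb_def using linear_Sum_any[OF linear_scale_self finite_bb, of r n x] by simp
qed

lemmas bb_lin [simp] = linear_0[OF lin_bb] linear_add[OF lin_bb] linear_diff[OF lin_bb]
  linear_neg[OF lin_bb] linear_scale[OF lin_bb]

lemma bb_b: "bb n (b m x) = b m (bb n x)"
  unfolding bb_def linear_Sum_any[OF lin_b finite_bb]
  by (metis b_comm)

text \<open>The mode \<open>a i\<close> contracts with either of the two factors of b(z)^2.\<close>

lemma a_bb: "a i (bb n x) = bb n (a i x) + 2 *\<^sub>R b (n + i) x"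
proof -
  have eq: "a i (b p (b (n - p) x)) = b p (b (n - p) (a i x)) +
      ((if p = n + i then b (n + i) x else 0) + (if p = - i then b (n + i) x else 0))" for p
  proof -
    have "(if i + (n - p) = 0 then b p x else 0) = (if p = n + i then b (n + i) x else 0)" by auto
    moreover have "(if i + p = 0 then b (n - p) x else 0) = (if p = - i then b (n + i) x else 0)"
      by (auto simp: algebra_simps)
    moreover have "b p (if i + (n - p) = 0 then x else 0) = (if i + (n - p) = 0 then b p x else 0)"
      by simp
    ultimately show ?thesis by (simp add: a_b add.assoc)
  qed
  have f1: "finite {p. (if p = c then y else 0) \<noteq> (0::'w)}" for c :: int and y
    by (rule finite_subset[of _ "{c}"]) auto
  have f2: "finite {p. (if p = c then y else 0) + (if p = d then z else 0) \<noteq> (0::'w)}" for c d :: int and y z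
    by (rule finite_subset[of _ "{c, d}"]) auto
  have "a i (bb n x) = Sum_any (\<lambda>p. a i (b p (b (n - p) x)))"
    unfolding bb_def by (rule linear_Sum_any[OF lin_a finite_bb])
  also have "\<dots> = bb n (a i x) + (b (n + i) x + b (n + i) x)"
    unfolding eq by (subst Sum_any.distrib[OF finite_bb f2], subst Sum_any.distrib[OF f1 f1])
       (simp add: bb_def)
  finally show ?thesis by (simp add: scaleR_2)
qed

lemma bbb_support:
  assumes "\<forall>i>N. b i x = 0" "b p (bb (n - p) x) \<noteq> 0"
  shows "n - 2 * N \<le> p \<and> p \<le> N"
proof -
  have "\<not> p > N" using assms by (metis bb_b bb_lin(1))
  moreover have "\<not> n - p > 2 * N" using assms bb_eq_0[OF assms(1)] by (metis b_lin(1))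
  ultimately show ?thesis by linarith
qed

lemma finite_bbb: "finite {p. b p (bb (n - p) x) \<noteq> 0}"
proof -
  obtain N where "\<forall>i>N. b i x = 0" using loc_finE[of x] by metis
  from bbb_support[OF this] show ?thesis by (rule finite_int_support[of _ "n - 2 * N" N])
qed

lemma finite_bbb': "finite {p. b (n - p) (bb p x) \<noteq> 0}"
proof -
  obtain N where N: "\<forall>i>N. b i x = 0" using loc_finE[of x] by metis
  show ?thesis
  proof (rule finite_int_support[of _ "n - N" "2 * N"])
    fix p assume "b (n - p) (bb p x) \<noteq> 0"
    then show "n - N \<le> p \<and> p \<le> 2 * N" using bbb_support[OF N, of "n - p" n] by auto
  qed
qed

lemma bbb_eq_0:
  assumes "\<forall>i>N. b i x = 0" "n > 3 * N"
  shows "bbb n x = 0"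
proof -
  have "b p (bb (n - p) x) = 0" for p
    using bbb_support[OF assms(1), of p n] assms(2) by linarith
  then show ?thesis unfolding bbb_def by simp
qed

lemma Aterm_support:
  assumes "N \<ge> 0" "\<forall>i>N. a i x = 0" "\<forall>i>N. b i x = 0" "Aterm j i x \<noteq> 0"
  shows "min (j - 2 * N) 0 \<le> i \<and> i \<le> N"
proof -
  have "\<not> i > N" using assms by (auto simp: Aterm_def)
  moreover have "\<not> (i < 0 \<and> j - i > 2 * N)"
    using assms bb_eq_0[OF assms(3), of "j - i"] by (auto simp: Aterm_def)
  ultimately show ?thesis by linarith
qed

lemma finite_Aterm: "finite {i. Aterm j i x \<noteq> 0}"
proof -
  obtain N where "N \<ge> 0" "\<forall>i>N. a i x = 0" "\<forall>i>N. b i x = 0"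
    using loc_finE[of x] by metis
  from Aterm_support[OF this] show ?thesis by (rule finite_int_support)
qed

lemma Aterm_lin: "linear (Aterm j i)"
  by (rule linearI) (auto simp: Aterm_def)

lemma lin_A: "linear (A j)"
proof (rule linearI)
  show "A j (x + y) = A j x + A j y" for x y
    unfolding A_def linear_add[OF Aterm_lin]
    by (simp add: Sum_any.distrib finite_Aterm algebra_simps)
  show "A j (r *\<^sub>R x) = r *\<^sub>R A j x" for r x
    unfolding A_def linear_scale[OF Aterm_lin]
    using linear_Sum_any[OF linear_scale_self finite_Aterm, of r j x] by (simp add: algebra_simps)
qed

lemmas A_lin [simp] = linear_0[OF lin_A] linear_add[OF lin_A] linear_diff[OF lin_A]
  linear_neg[OF lin_A] linear_scale[OF lin_A]

lemma ab_support:
  assumes "N \<ge> 0" "\<forall>i>N. a i x = 0" "\<forall>i>N. b i x = 0"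
    "(if i < 0 then a i (b (n - i) x) else b (n - i) (a i x)) \<noteq> 0"
  shows "min (n - N) 0 \<le> i \<and> i \<le> N"
proof -
  have "\<not> i > N" using assms by auto
  moreover have "\<not> (i < 0 \<and> n - i > N)"
    using assms by (auto)
  ultimately show ?thesis by linarith
qed

lemma finite_ab: "finite {i. (if i < 0 then a i (b (n - i) x) else b (n - i) (a i x)) \<noteq> 0}"
proof -
  obtain N where "N \<ge> 0" "\<forall>i>N. a i x = 0" "\<forall>i>N. b i x = 0"
    using loc_finE[of x] by metis
  from ab_support[OF this] show ?thesis by (rule finite_int_support)
qed

text \<open>Only the summand containing \<open>a (- n)\<close> contracts with \<open>b n\<close>,
  leaving the mode of b(z)^2; the part of \<open>A\<close> linear in \<open>b\<close> commutes with
  it.\<close>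

lemma A_b: "A j (b n x) = b n (A j x) + bb (n + j) x"
proof -
  have eq: "Aterm j i (b n x) = b n (Aterm j i x) + (if i = - n then bb (n + j) x else 0)" for i
    by (auto simp: Aterm_def bb_b a_b algebra_simps)
  have f1: "finite {p. (if p = c then y else 0) \<noteq> (0::'w)}" for c :: int and y
    by (rule finite_subset[of _ "{c}"]) auto
  have f2: "finite {i. b n (Aterm j i x) \<noteq> 0}"
    by (rule finite_subset[OF _ finite_Aterm[of j x]]) auto
  have "Sum_any (\<lambda>i. Aterm j i (b n x)) = b n (Sum_any (\<lambda>i. Aterm j i x)) + bb (n + j) x"
    unfolding eq by (subst Sum_any.distrib[OF f2 f1]) (simp add: linear_Sum_any[OF lin_b finite_Aterm])
  then show ?thesis unfolding A_def by (simp add: b_comm[of j n])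
qed

lemma A0_bb: "A 0 (bb n x) = bb n (A 0 x) + 2 *\<^sub>R bbb n x"
proof -
  have eq: "A 0 (b p (b (n - p) x)) = b p (b (n - p) (A 0 x)) + (b p (bb (n - p) x) + b (n - p) (bb p x))" for p
    by (simp add: A_b bb_b)
  have f2: "finite {p. b p (bb (n - p) x) + b (n - p) (bb p x) \<noteq> 0}"
    by (rule finite_subset[OF _ finite_UnI[OF finite_bbb[of n x] finite_bbb'[of n x]]]) auto
  have "A 0 (bb n x) = Sum_any (\<lambda>p. A 0 (b p (b (n - p) x)))"
    unfolding bb_def by (rule linear_Sum_any[OF lin_A finite_bb])
  also have "\<dots> = bb n (A 0 x) + (bbb n x + Sum_any (\<lambda>p. b (n - p) (bb p x)))"
    unfolding eq by (subst Sum_any.distrib[OF finite_bb f2], subst Sum_any.distrib[OF finite_bbb finite_bbb'])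
       (simp add: bb_def bbb_def)
  also have "Sum_any (\<lambda>p. b (n - p) (bb p x)) = bbb n x"
    unfolding bbb_def using Sum_any_reflect[of "\<lambda>p. b p (bb (n - p) x)" n] by simp
  finally show ?thesis by (simp add: scaleR_2)
qed

text \<open>The zero mode acts like the vector field b^2 d/db: it sends b to b^2 by
  \<open>A_b\<close>, and a, which plays the role of d/db, to -2ab.\<close>

lemma A0_a: "A 0 (a i x) = a i (A 0 x) - 2 *\<^sub>R ab i x"
proof -
  let ?t = "\<lambda>q. if q < 0 then a q (b (i - q) x) else b (i - q) (a q x)"
  have eq: "a i (Aterm 0 q x) = Aterm 0 q (a i x) + 2 *\<^sub>R ?t q" for q
  proof (cases "q < 0")
    case True
    then show ?thesis by (simp add: Aterm_def a_comm[of i q "bb (- q) x"]) (simp add: a_bb)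
  next
    case False
    then show ?thesis by (simp add: Aterm_def a_bb a_comm[of i q])
  qed
  have f: "finite {q. 2 *\<^sub>R ?t q \<noteq> 0}"
    by (rule finite_subset[OF _ finite_ab[of i x]]) auto
  have "a i (A 0 x) = Sum_any (\<lambda>q. a i (Aterm 0 q x))"
    unfolding A_def by (simp add: linear_Sum_any[OF lin_a finite_Aterm])
  also have "\<dots> = Sum_any (\<lambda>q. Aterm 0 q (a i x)) + Sum_any (\<lambda>q. 2 *\<^sub>R ?t q)"
    unfolding eq by (rule Sum_any.distrib[OF finite_Aterm f])
  also have "Sum_any (\<lambda>q. 2 *\<^sub>R ?t q) = 2 *\<^sub>R ab i x"
    unfolding ab_def by (rule linear_Sum_any[OF linear_scale_self finite_ab, symmetric])
  finally show ?thesis by (simp add: A_def)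
qed

text \<open>A signed count of the indices i for which i and i - r lie on different sides of the cut
  between -1 and 0.\<close>

lemma Sum_any_sign_shear:
  fixes y :: 'w
  shows "Sum_any (\<lambda>i::int. (if i < 0 \<and> i \<ge> r then 1 else if i \<ge> 0 \<and> i < r then - 1 else 0 :: real) *\<^sub>R y)
    = - of_int r *\<^sub>R y"
proof -
  let ?s = "\<lambda>i::int. (if i < 0 \<and> i \<ge> r then 1 else if i \<ge> 0 \<and> i < r then - 1 else 0 :: real)"
  have "Sum_any (\<lambda>i. ?s i *\<^sub>R y) = (\<Sum>i\<in>{min r 0..<max r 0}. ?s i *\<^sub>R y)"
    by (rule Sum_any.expand_superset) auto
  also have "\<dots> = (\<Sum>i\<in>{min r 0..<max r 0}. ?s i) *\<^sub>R y"
    by (simp add: scaleR_left.sum)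
  also have "(\<Sum>i\<in>{min r 0..<max r 0}. ?s i) = - of_int r"
  proof (cases "r < 0")
    case True
    then have "(\<Sum>i\<in>{min r 0..<max r 0}. ?s i) = (\<Sum>i\<in>{r..<0}. 1)"
      by (intro sum.cong) auto
    then show ?thesis using True by simp
  next
    case False
    then have "(\<Sum>i\<in>{min r 0..<max r 0}. ?s i) = (\<Sum>i\<in>{0..<r}. - 1)"
      by (intro sum.cong) auto
    then show ?thesis using False by simp
  qed
  finally show ?thesis .
qed

text \<open>The double contraction in \<open>[A\<^sub>0, A\<^sub>j]\<close>: reordering \<open>a\<close> past the \<open>b\<close> modes in the nested
  normal order leaves exactly the term that the summand \<open>- 2 j b\<^sub>j\<close> of \<open>A\<^sub>j\<close> compensates.\<close>

lemma nested_normal_order: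
  "Sum_any (\<lambda>i. if i < 0 then ab i (bb (j - i) x) else bb (j - i) (ab i x)) =
   Sum_any (\<lambda>q. if q < 0 then a q (bbb (j - q) x) else bbb (j - q) (a q x)) - of_int j *\<^sub>R bb j x"
proof -
  \<comment> \<open>\<open>G\<close> orders by the signs of both i and q, \<open>H\<close> by the
    sign of q alone. Where the two signs disagree they differ by one commutator, which is
    \<open>K\<close>.\<close>
  define G where "G i q =
     (if i < 0 then if q < 0 then a q (b (i - q) (bb (j - i) x)) else b (i - q) (a q (bb (j - i) x))
      else if q < 0 then bb (j - i) (a q (b (i - q) x)) else bb (j - i) (b (i - q) (a q x)))" for i q
  define H where "H i q =
     (if q < 0 then a q (b (i - q) (bb (j - i) x)) else b (i - q) (bb (j - i) (a q x)))" for i q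
  define Br where "Br r = b r (b (j - r) x)" for r
  define K where "K i q = 2 *\<^sub>R (if i < 0 \<and> q \<ge> 0 then 1 else if i \<ge> 0 \<and> q < 0 then - 1 else 0 :: real)
     *\<^sub>R Br (i - q)" for i q
  have GHK: "G i q = H i q + K i q" for i q
  proof -
    have 1: "b (i - q) (b (j - i + q) x) = Br (i - q)" by (simp add: Br_def algebra_simps)
    have 2: "a q (b (i - q) (bb (j - i) x)) = bb (j - i) (a q (b (i - q) x)) + 2 *\<^sub>R Br (i - q)"
      by (subst bb_b[symmetric], subst a_bb) (simp add: Br_def b_comm[of "i - q"] algebra_simps)
    show ?thesis by (auto simp: G_def H_def K_def 2 a_bb bb_b 1)
  qed
  obtain N where N: "N \<ge> 0" "\<forall>i>N. a i x = 0" "\<forall>i>N. b i x = 0"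
    using loc_finE[of x] by metis
  have Brs: "j - N \<le> r \<and> r \<le> N" if "Br r \<noteq> 0" for r
    by (rule bb_support[OF N(3) that[unfolded Br_def]])
  have boxK: "boxed K"
  proof (rule boxedI[where M = "N + \<bar>j\<bar>"])
    fix i q assume "K i q \<noteq> 0"
    then have "Br (i - q) \<noteq> 0" "i < 0 \<and> q \<ge> 0 \<or> i \<ge> 0 \<and> q < 0" by (auto simp: K_def split: if_splits)
    then show "\<bar>i\<bar> \<le> N + \<bar>j\<bar> \<and> \<bar>q\<bar> \<le> N + \<bar>j\<bar>" using Brs[of "i - q"] N(1) by linarith
  qed
  have "\<exists>N'. \<forall>q\<in>{0..N}. \<forall>i>N'. b i (a q x) = 0"
  proof -
    have "\<forall>q. \<exists>n. \<forall>i>n. b i (a q x) = 0" using loc_fin by blast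
    then obtain n where n: "\<And>q i. i > n q \<Longrightarrow> b i (a q x) = 0" by metis
    show ?thesis
    proof (intro exI[of _ "Max (n ` {0..N})"] ballI allI impI)
      fix q i assume "q \<in> {0..N}" "Max (n ` {0..N}) < i"
      moreover have "n q \<le> Max (n ` {0..N})" using \<open>q \<in> {0..N}\<close> by (intro Max_ge) auto
      ultimately show "b i (a q x) = 0" using n by auto
    qed
  qed
  then obtain N' where "\<forall>q\<in>{0..N}. \<forall>i>N'. b i (a q x) = 0" by blast
  then have N'': "b i (a q x) = 0" if "0 \<le> q" "q \<le> N" "i > max N' N" for i q using that by auto
  define N2 where "N2 = max N' N"
  have N2: "N2 \<ge> N" "\<And>q i. 0 \<le> q \<Longrightarrow> q \<le> N \<Longrightarrow> i > N2 \<Longrightarrow> b i (a q x) = 0"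
    using N'' by (auto simp: N2_def)
  have boxH: "boxed H"
  proof (rule boxedI[where M = "4 * N2 + \<bar>j\<bar>"])
    fix i q assume nz: "H i q \<noteq> 0"
    show "\<bar>i\<bar> \<le> 4 * N2 + \<bar>j\<bar> \<and> \<bar>q\<bar> \<le> 4 * N2 + \<bar>j\<bar>"
    proof (cases "q < 0")
      case True
      then have "b (i - q) (bb ((j - q) - (i - q)) x) \<noteq> 0" using nz by (auto simp: H_def)
      from bbb_support[OF N(3) this] have "j - q - 2 * N \<le> i - q \<and> i - q \<le> N" by simp
      then show ?thesis using True N(1) N2(1) by linarith
    next
      case False
      then have nz': "b (i - q) (bb ((j - q) - (i - q)) (a q x)) \<noteq> 0" using nz by (auto simp: H_def)
      then have "q \<le> N" by (metis N(2) b_lin(1) bb_lin(1) linorder_not_le)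
      have "\<forall>i>N2. b i (a q x) = 0" using N2(2) False \<open>q \<le> N\<close> by auto
      from bbb_support[OF this nz'] have "j - q - 2 * N2 \<le> i - q \<and> i - q \<le> N2" by simp
      then show ?thesis using False \<open>q \<le> N\<close> N(1) N2(1) by linarith
    qed
  qed
  have D: "(if i < 0 then ab i (bb (j - i) x) else bb (j - i) (ab i x)) = Sum_any (G i)" for i
  proof (cases "i < 0")
    case True
    then show ?thesis unfolding ab_def G_def by simp
  next
    case False
    then have "bb (j - i) (ab i x) = Sum_any (\<lambda>q. bb (j - i) (if q < 0 then a q (b (i - q) x) else b (i - q) (a q x)))"
      unfolding ab_def by (simp add: linear_Sum_any[OF lin_bb finite_ab])
    also have "\<dots> = Sum_any (G i)" using False
      by (intro Sum_any.cong) (simp add: G_def)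
    finally show ?thesis using False by simp
  qed
  have C: "(if q < 0 then a q (bbb (j - q) x) else bbb (j - q) (a q x)) = Sum_any (\<lambda>i. H i q)" for q
  proof (cases "q < 0")
    case True
    have "a q (bbb (j - q) x) = Sum_any (\<lambda>p. a q (b p (bb (j - q - p) x)))"
      unfolding bbb_def by (rule linear_Sum_any[OF lin_a finite_bbb])
    also have "\<dots> = Sum_any (\<lambda>p. H (p + q) q)" using True
      by (intro Sum_any.cong) (simp add: H_def algebra_simps)
    also have "\<dots> = Sum_any (\<lambda>i. H i q)" by (rule Sum_any_shift)
    finally show ?thesis using True by simp
  next
    case False
    have "bbb (j - q) (a q x) = Sum_any (\<lambda>p. H (p + q) q)" using False
      unfolding bbb_def by (intro Sum_any.cong) (simp add: H_def algebra_simps)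
    also have "\<dots> = Sum_any (\<lambda>i. H i q)" by (rule Sum_any_shift)
    finally show ?thesis using False by simp
  qed
  have finBr: "finite {r. Br r \<noteq> 0}" unfolding Br_def by (rule finite_bb)
  have finrBr: "finite {r. f r *\<^sub>R Br r \<noteq> 0}" for f
    by (rule finite_subset[OF _ finBr]) auto
  have SK: "Sum_any (\<lambda>i. Sum_any (K i)) = - (of_int j *\<^sub>R bb j x)"
  proof -
    define K' where "K' i r = K i (i - r)" for i r
    have boxK': "boxed K'"
    proof (rule boxedI[where M = "N + \<bar>j\<bar>"])
      fix i r assume "K' i r \<noteq> 0"
      then have "Br r \<noteq> 0" "i < 0 \<and> i - r \<ge> 0 \<or> i \<ge> 0 \<and> i - r < 0"
        by (auto simp: K'_def K_def split: if_splits)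
      then show "\<bar>i\<bar> \<le> N + \<bar>j\<bar> \<and> \<bar>r\<bar> \<le> N + \<bar>j\<bar>" using Brs[of r] N(1) by linarith
    qed
    have "Sum_any (\<lambda>i. Sum_any (K i)) = Sum_any (\<lambda>i. Sum_any (K' i))"
      unfolding K'_def Sum_any_reflect ..
    also have "\<dots> = Sum_any (\<lambda>r. Sum_any (\<lambda>i. K' i r))" by (rule boxed_swap[OF boxK'])
    also have "\<dots> = Sum_any (\<lambda>r. (- 2 * of_int r) *\<^sub>R Br r)"
    proof (rule Sum_any.cong)
      fix r
      have "K' i r = (if i < 0 \<and> i \<ge> r then 1 else if i \<ge> 0 \<and> i < r then - 1 else 0 :: real)
         *\<^sub>R (2 *\<^sub>R Br r)" for i
        by (auto simp: K'_def K_def)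
      then show "Sum_any (\<lambda>i. K' i r) = (- 2 * of_int r) *\<^sub>R Br r"
        by (simp only: Sum_any_sign_shear) simp
    qed
    \<comment> \<open>\<open>Br\<close> is symmetric under r -> j - r, so the weight 2r may be
      replaced by (j - r) + r = j.\<close>
    also have "\<dots> = Sum_any (\<lambda>r. (- of_int (j - r)) *\<^sub>R Br r) + Sum_any (\<lambda>r. (- of_int r) *\<^sub>R Br r)"
    proof -
      have "Sum_any (\<lambda>r. (- 2 * of_int r) *\<^sub>R Br r) =
          Sum_any (\<lambda>r. (- of_int r) *\<^sub>R Br r) + Sum_any (\<lambda>r. (- of_int r) *\<^sub>R Br r)"
        by (subst Sum_any.distrib[OF finrBr finrBr, symmetric], rule Sum_any.cong)
           (simp add: algebra_simps scaleR_2 flip: scaleR_scaleR)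
      moreover have "Sum_any (\<lambda>r. (- of_int r) *\<^sub>R Br r) = Sum_any (\<lambda>r. (- of_int (j - r)) *\<^sub>R Br r)"
        using Sum_any_reflect[of "\<lambda>r. (- of_int r) *\<^sub>R Br r" j] by (simp add: Br_def b_comm)
      ultimately show ?thesis by metis
    qed
    also have "\<dots> = Sum_any (\<lambda>r. (- of_int j) *\<^sub>R Br r)"
      by (subst Sum_any.distrib[OF finrBr finrBr, symmetric], rule Sum_any.cong)
         (simp add: algebra_simps)
    also have "\<dots> = - (of_int j *\<^sub>R bb j x)"
      unfolding bb_def Br_def[symmetric]
      by (subst linear_Sum_any[OF linear_scale_self finBr, symmetric]) simp
    finally show ?thesis .
  qed
  have "Sum_any (\<lambda>i. Sum_any (G i)) = Sum_any (\<lambda>i. Sum_any (H i)) + Sum_any (\<lambda>i. Sum_any (K i))"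
    unfolding GHK using boxed_Sum_add[OF boxH boxK] .
  also have "Sum_any (\<lambda>i. Sum_any (H i)) = Sum_any (\<lambda>q. Sum_any (\<lambda>i. H i q))"
    by (rule boxed_swap[OF boxH])
  finally show ?thesis unfolding D C SK by simp
qed

text \<open>Classically ab^2 is invariant under b^2 d/db, since -2ab * b^2 cancels a * 2b^3. Normal
  ordering leaves 2j times a mode of b(z)^2, and the commutator of the zero mode with the summand
  -2j b_j removes it.\<close>

lemma A0_A: "A 0 (A j x) = A j (A 0 x)"
proof -
  define C where "C i = (if i < 0 then a i (bbb (j - i) x) else bbb (j - i) (a i x))" for i
  define D where "D i = (if i < 0 then ab i (bb (j - i) x) else bb (j - i) (ab i x))" for i
  have eq: "A 0 (Aterm j i x) = Aterm j i (A 0 x) + 2 *\<^sub>R (C i - D i)" for i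
    by (simp add: Aterm_def A0_a A0_bb C_def D_def algebra_simps)
  obtain N where N: "N \<ge> 0" "\<forall>i>N. a i x = 0" "\<forall>i>N. b i x = 0"
    using loc_finE[of x] by metis
  have bbb0: "bbb n 0 = 0" for n by (simp add: bbb_def)
  have finC: "finite {i. C i \<noteq> 0}"
  proof (rule finite_int_support[of _ "min 0 (j - 3 * N)" "N"])
    fix i assume nz: "C i \<noteq> 0"
    have "\<not> (i \<ge> 0 \<and> i > N)" using nz N by (auto simp: C_def bbb0)
    moreover have "\<not> (i < 0 \<and> j - i > 3 * N)" using nz bbb_eq_0[OF N(3)] by (auto simp: C_def)
    ultimately show "min 0 (j - 3 * N) \<le> i \<and> i \<le> N" using N(1) by linarith
  qed
  have fin1: "finite {i. 2 *\<^sub>R (C i - D i) \<noteq> 0}"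
  proof -
    have f: "finite {i. A 0 (Aterm j i x) \<noteq> 0}"
      by (rule finite_subset[OF _ finite_Aterm[of j x]]) auto
    show ?thesis
      by (rule finite_subset[OF _ finite_UnI[OF f finite_Aterm[of j "A 0 x"]]]) (use eq in auto)
  qed
  \<comment> \<open>The support of \<open>D\<close> is controlled indirectly: \<open>C - D\<close>
    is a difference of terms with finite support, and \<open>C\<close> is finite.\<close>
  have finD: "finite {i. D i \<noteq> 0}"
    by (rule finite_subset[OF _ finite_UnI[OF fin1 finC]]) auto
  have fin2: "finite {i. C i - D i \<noteq> 0}" using fin1 by simp
  have "Sum_any (\<lambda>i. C i - D i) + Sum_any D = Sum_any C"
    by (subst Sum_any.distrib[OF fin2 finD, symmetric]) simp
  then have CD: "Sum_any (\<lambda>i. C i - D i) = of_int j *\<^sub>R bb j x"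
    using nested_normal_order[of j x] unfolding C_def D_def by (simp add: algebra_simps)
  have "A 0 (Sum_any (\<lambda>i. Aterm j i x)) = Sum_any (\<lambda>i. A 0 (Aterm j i x))"
    by (rule linear_Sum_any[OF lin_A finite_Aterm])
  also have "\<dots> = Sum_any (\<lambda>i. Aterm j i (A 0 x)) + Sum_any (\<lambda>i. 2 *\<^sub>R (C i - D i))"
    unfolding eq by (rule Sum_any.distrib[OF finite_Aterm fin1])
  also have "Sum_any (\<lambda>i. 2 *\<^sub>R (C i - D i)) = 2 *\<^sub>R (of_int j *\<^sub>R bb j x)"
    using linear_Sum_any[OF linear_scale_self fin2, of 2] CD by simp
  finally have "A 0 (Sum_any (\<lambda>i. Aterm j i x)) = Sum_any (\<lambda>i. Aterm j i (A 0 x)) + (2 * of_int j) *\<^sub>R bb j x"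
    by simp
  then show ?thesis
    unfolding A_def[of j] by (simp add: A_b algebra_simps)
qed

text \<open>On such vectors mode -k of a function of b(z), polynomial or not, involves only the
  modes b_{-p} with 0 \<le> p \<le> k.\<close>

definition vac :: "'w \<Rightarrow> bool" where "vac x \<longleftrightarrow> (\<forall>i>0. b i x = 0)"

lemma vac_b: "vac x \<Longrightarrow> vac (b n x)"
  unfolding vac_def by (metis b_comm b_lin(1))

lemma vac_sum: "(\<And>i. i \<in> I \<Longrightarrow> vac (f i)) \<Longrightarrow> vac (\<Sum>i\<in>I. f i)"
  unfolding vac_def by (simp add: linear_sum[OF lin_b])

lemma bb_vac_eq_0: "vac x \<Longrightarrow> n > 0 \<Longrightarrow> bb n x = 0"
  unfolding vac_def by (rule bb_eq_0[of 0]) auto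

lemma bb_vac:
  assumes "vac x"
  shows "bb (- int n) x = (\<Sum>p\<le>n. b (- int p) (b (- int (n - p)) x))"
proof -
  have "bb (- int n) x = (\<Sum>p\<in>{- int n - 0..0}. b p (b (- int n - p) x))"
    using assms unfolding vac_def by (rule bb_eq_sum)
  also have "\<dots> = (\<Sum>p\<le>n. b (- int p) (b (- int (n - p)) x))"
    by (rule sum.reindex_bij_witness[where i = "\<lambda>p. - int p" and j = "\<lambda>p. nat (- p)"])
       (auto simp: minus_diff_commute intro!: arg_cong[of _ _ "b _"] arg_cong2[of _ _ _ _ b])
  finally show ?thesis .
qed

end

section \<open>The inverse field 1 / b(z)\<close>

locale heis_inv = heis +
  fixes v :: "'a \<Rightarrow> 'a"
  assumes lin_v: "linear v" and v_b0: "v (b 0 x) = x" and b0_v: "b 0 (v x) = x"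
begin

lemmas v_lin [simp] = linear_0[OF lin_v] linear_add[OF lin_v] linear_diff[OF lin_v] linear_neg[OF lin_v]
   linear_scale[OF lin_v]

lemma v_b: "v (b n x) = b n (v x)"
  by (metis b0_v v_b0 b_comm)

lemma vac_v: "vac x \<Longrightarrow> vac (v x)"
  unfolding vac_def by (metis v_b v_lin(1))

text \<open>\<open>beta k\<close> is the mode $-k$ of $1 / b(z)$ on vectors killed by all $b_i$ with $i > 0$.\<close>

function beta :: "nat \<Rightarrow> 'a \<Rightarrow> 'a" where
  "beta k x = (if k = 0 then v x else - v (\<Sum>p\<in>{1..k}. b (- int p) (beta (k - p) x)))"
  by pat_completeness auto
termination by (relation "Wellfounded.measure fst") auto

declare beta.simps [simp del]

lemma beta_0: "beta 0 x = v x" by (simp add: beta.simps)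

text \<open>Mode -k of the identity b(z) * (1 / b(z)) = 1.\<close>

lemma beta_conv: "(\<Sum>p\<le>k. b (- int p) (beta (k - p) x)) = (if k = 0 then x else 0)"
proof (cases "k = 0")
  case True
  then show ?thesis by (simp add: beta_0 b0_v)
next
  case False
  have "b 0 (beta k x) = - (\<Sum>p\<in>{1..k}. b (- int p) (beta (k - p) x))"
    using False by (subst beta.simps) (simp add: b0_v)
  moreover have "(\<Sum>p\<le>k. b (- int p) (beta (k - p) x)) =
      b 0 (beta k x) + (\<Sum>p\<in>{1..k}. b (- int p) (beta (k - p) x))"
    by (simp add: atMost_atLeast0 sum.atLeast_Suc_atMost)
  ultimately show ?thesis using False by simp
qed

lemma vac_beta: "vac x \<Longrightarrow> vac (beta k x)"
proof (induction k rule: less_induct)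
  case (less k)
  have neg: "vac (- y)" if "vac y" for y using that by (simp add: vac_def)
  show ?case using less
    by (subst beta.simps) (auto intro!: neg vac_v vac_sum vac_b simp del: v_lin)
qed

lemma lin_beta: "linear (beta k)"
proof (induction k rule: less_induct)
  case (less k)
  show ?case
  proof (cases "k = 0")
    case True
    then show ?thesis using lin_v by (simp add: beta_0[abs_def])
  next
    case False
    have "linear (\<lambda>x. - v (\<Sum>p\<in>{1..k}. b (- int p) (beta (k - p) x)))"
      using less False
      by (intro linear_compose_neg linear_compose[OF _ lin_v, unfolded o_def] linear_compose_sum ballI
            linear_compose[OF _ lin_b, unfolded o_def]) auto
    then show ?thesis using False by (subst beta.simps[abs_def]) simp
  qed
qed

lemma A0_v: "A 0 (v x) = v (A 0 x) - v (bb 0 (v x))"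
proof -
  have "A 0 (b 0 (v x)) = b 0 (A 0 (v x)) + bb 0 (v x)" using A_b[of 0 0 "v x"] by simp
  then have "b 0 (A 0 (v x)) = A 0 x - bb 0 (v x)" by (simp add: b0_v)
  then show ?thesis by (metis v_b0 v_lin(3))
qed

text \<open>The derivation b -> b^2 sends 1/b to -b^2/b^2 = -1, a constant field; only mode 0 sees
  it, hence k > 0.\<close>

lemma A0_beta:
  assumes "vac x" "k > 0"
  shows "A 0 (beta k x) = beta k (A 0 x)"
  using assms(2)
proof (induction k rule: less_induct)
  case (less k)
  have b0: "A 0 (beta 0 x) = beta 0 (A 0 x) - x"
  proof -
    have "bb 0 (v x) = b 0 (b 0 (v x))" using bb_vac[OF vac_v[OF assms(1)], of 0] by simp
    then show ?thesis by (simp add: beta_0 A0_v b0_v v_b0)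
  qed
  \<comment> \<open>Mode -k of b(z)^2 * (1 / b(z)) = b(z), by regrouping the triple convolution and
    applying \<open>beta_conv\<close> inside.\<close>
  have S1: "(\<Sum>p\<le>k. bb (- int p) (beta (k - p) x)) = b (- int k) x"
  proof -
    have "(\<Sum>p\<le>k. bb (- int p) (beta (k - p) x)) =
       (\<Sum>p\<le>k. \<Sum>r\<le>p. b (- int r) (b (- int (p - r)) (beta (k - (r + (p - r))) x)))"
      by (intro sum.cong refl) (simp add: bb_vac vac_beta assms(1))
    also have "\<dots> = (\<Sum>(r, s)\<in>{(i, j). i + j \<le> k}. b (- int r) (b (- int s) (beta (k - (r + s)) x)))"
      by (rule sum.triangle_reindex_eq[symmetric])
    also have "{(i, j). i + j \<le> k} = Sigma {..k} (\<lambda>i. {..k - i})" by auto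
    also have "(\<Sum>(r, s)\<in>Sigma {..k} (\<lambda>i. {..k - i}). b (- int r) (b (- int s) (beta (k - (r + s)) x))) =
        (\<Sum>r\<le>k. \<Sum>s\<le>k - r. b (- int r) (b (- int s) (beta (k - r - s) x)))"
      by (subst sum.Sigma[symmetric]) simp_all
    also have "\<dots> = (\<Sum>r\<le>k. b (- int r) (if k - r = 0 then x else 0))"
      by (simp add: linear_sum[OF lin_b, symmetric] beta_conv del: diff_diff_left)
    also have "\<dots> = (\<Sum>r\<le>k. if r = k then b (- int k) x else 0)"
      by (intro sum.cong) auto
    finally show ?thesis by simp
  qed
  have "0 = A 0 (\<Sum>p\<le>k. b (- int p) (beta (k - p) x))" using less.prems by (simp add: beta_conv)
  also have "\<dots> = (\<Sum>p\<le>k. b (- int p) (A 0 (beta (k - p) x)) + bb (- int p) (beta (k - p) x))"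
    by (simp add: linear_sum[OF lin_A] A_b)
  also have "\<dots> = (\<Sum>p\<le>k. b (- int p) (A 0 (beta (k - p) x))) + b (- int k) x"
    by (simp only: sum.distrib S1)
  also have "(\<Sum>p\<le>k. b (- int p) (A 0 (beta (k - p) x))) =
     b 0 (A 0 (beta k x)) + (\<Sum>p\<in>{1..k}. b (- int p) (A 0 (beta (k - p) x)))"
    by (simp add: atMost_atLeast0 sum.atLeast_Suc_atMost)
  \<comment> \<open>The summand p = k meets \<open>beta 0\<close>, whose defect -x produces exactly
    the term that cancels \<open>S1\<close>.\<close>
  also have "(\<Sum>p\<in>{1..k}. b (- int p) (A 0 (beta (k - p) x))) =
     (\<Sum>p\<in>{1..k}. b (- int p) (beta (k - p) (A 0 x)) - (if p = k then b (- int k) x else 0))"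
    using less.IH b0 by (intro sum.cong) (auto)
  also have "\<dots> = (\<Sum>p\<in>{1..k}. b (- int p) (beta (k - p) (A 0 x))) - b (- int k) x"
    using less.prems by (simp add: sum_subtractf)
  also have "(\<Sum>p\<in>{1..k}. b (- int p) (beta (k - p) (A 0 x))) = - b 0 (beta k (A 0 x))"
    using less.prems by (subst beta.simps[of k]) (simp add: b0_v)
  finally have "b 0 (A 0 (beta k x)) = b 0 (beta k (A 0 x))" by simp
  then show ?case by (metis v_b0)
qed

end

section \<open>States with holomorphic coefficients\<close>

abbreviation UH :: "complex set" where "UH \<equiv> {z. Im z > 0}"

lemma open_UH: "open UH" by (rule open_halfspace_Im_gt)

text \<open>The normalisation to 0 outside the half plane makes equality in this type the same as
  equality on the half plane.\<close>

typedef hol = "{f :: complex \<Rightarrow> complex. f holomorphic_on UH \<and> (\<forall>z. Im z \<le> 0 \<longrightarrow> f z = 0)}"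
  morphisms hv Abs_hol
  by (rule exI[of _ "\<lambda>_. 0"]) auto

setup_lifting type_definition_hol

lemma hv_holomorphic: "hv f holomorphic_on UH"
  using hv[of f] by simp

lemma hol_eqI:
  assumes "\<And>z. Im z > 0 \<Longrightarrow> hv f z = hv g z"
  shows "f = g"
proof -
  have "hv f z = hv g z" for z
    using assms hv[of f] hv[of g] by (cases "Im z > 0") auto
  then show ?thesis by (simp add: hv_inject[symmetric] fun_eq_iff)
qed

definition hol_of :: "(complex \<Rightarrow> complex) \<Rightarrow> hol" where
  "hol_of f = Abs_hol (\<lambda>z. if Im z > 0 then f z else 0)"

lemma hv_hol_of:
  assumes "f holomorphic_on UH" "Im z > 0"
  shows "hv (hol_of f) z = f z"
proof -
  have "(\<lambda>z. if Im z > 0 then f z else 0) holomorphic_on UH"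
    using assms(1) by (rule holomorphic_transform) auto
  then show ?thesis using assms(2) unfolding hol_of_def by (subst Abs_hol_inverse) auto
qed

instantiation hol :: comm_ring_1
begin
lift_definition zero_hol :: hol is "\<lambda>_. 0" by auto
lift_definition one_hol :: hol is "\<lambda>z. if Im z > 0 then 1 else 0"
  using holomorphic_transform[of "\<lambda>_. 1" UH "\<lambda>z. if Im z > 0 then 1 else 0"] by simp
lift_definition plus_hol :: "hol \<Rightarrow> hol \<Rightarrow> hol" is "\<lambda>f g z. f z + g z"
  by (auto intro!: holomorphic_intros)
lift_definition minus_hol :: "hol \<Rightarrow> hol \<Rightarrow> hol" is "\<lambda>f g z. f z - g z"
  by (auto intro!: holomorphic_intros)
lift_definition uminus_hol :: "hol \<Rightarrow> hol" is "\<lambda>f z. - f z"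
  by (auto intro!: holomorphic_intros)
lift_definition times_hol :: "hol \<Rightarrow> hol \<Rightarrow> hol" is "\<lambda>f g z. f z * g z"
  by (auto intro!: holomorphic_intros)
instance
proof
  show "(0::hol) \<noteq> 1"
  proof
    assume "(0::hol) = 1"
    then have "hv 0 \<i> = hv 1 \<i>" by simp
    then show False by (simp add: zero_hol.rep_eq one_hol.rep_eq)
  qed
qed (rule hol_eqI; simp add: zero_hol.rep_eq one_hol.rep_eq plus_hol.rep_eq minus_hol.rep_eq
      uminus_hol.rep_eq times_hol.rep_eq algebra_simps)+
end

instantiation hol :: real_vector
begin
lift_definition scaleR_hol :: "real \<Rightarrow> hol \<Rightarrow> hol" is "\<lambda>r f z. of_real r * f z"
  by (auto intro!: holomorphic_intros)
instance
  by standard (rule hol_eqI; simp add: scaleR_hol.rep_eq plus_hol.rep_eq algebra_simps)+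
end

lemma hv_simps [simp]:
  "hv 0 z = 0" "hv (f + g) z = hv f z + hv g z" "hv (f - g) z = hv f z - hv g z"
  "hv (- f) z = - hv f z" "hv (f * g) z = hv f z * hv g z" "hv (r *\<^sub>R f) z = of_real r * hv f z"
  by (simp_all add: zero_hol.rep_eq plus_hol.rep_eq minus_hol.rep_eq uminus_hol.rep_eq
      times_hol.rep_eq scaleR_hol.rep_eq)

lemma hv_1 [simp]: "Im z > 0 \<Longrightarrow> hv 1 z = 1" by (simp add: one_hol.rep_eq)

lemma hv_sum: "hv (\<Sum>i\<in>I. f i) z = (\<Sum>i\<in>I. hv (f i) z)"
  by (induction I rule: infinite_finite_induct) auto

lemma hv_of_nat [simp]: "Im z > 0 \<Longrightarrow> hv (of_nat n) z = of_nat n"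
  by (induction n) auto

lemma hv_numeral [simp]: "Im z > 0 \<Longrightarrow> hv (numeral n) z = numeral n"
  using hv_of_nat[of z "numeral n"] by simp

definition hc :: "complex \<Rightarrow> hol" where "hc c = hol_of (\<lambda>_. c)"

lemma hv_hc [simp]: "Im z > 0 \<Longrightarrow> hv (hc c) z = c"
  by (simp add: hc_def hv_hol_of)

lemma hc_simps: "hc 0 = 0" "hc 1 = 1" "hc (x + y) = hc x + hc y" "hc (x * y) = hc x * hc y" "hc (- x) = - hc x"
  by (rule hol_eqI; simp)+

lemma scaleR_hc: "r *\<^sub>R f = hc (of_real r) * f"
  by (rule hol_eqI) simp

lift_definition hD :: "hol \<Rightarrow> hol" is "\<lambda>f z. if Im z > 0 then deriv f z else 0"
  by (auto intro: holomorphic_transform[OF holomorphic_deriv[OF _ open_UH]])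

lemma hv_hD: "Im z > 0 \<Longrightarrow> hv (hD f) z = deriv (hv f) z"
  by (simp add: hD.rep_eq)

lemma hv_deriv: "Im z > 0 \<Longrightarrow> (hv f has_field_derivative hv (hD f) z) (at z)"
  using holomorphic_derivI[OF hv_holomorphic[of f] open_UH, of z] by (simp add: hv_hD)

lemma hD_unique:
  assumes "\<And>z. Im z > 0 \<Longrightarrow> (hv f has_field_derivative hv g z) (at z)"
  shows "hD f = g"
  by (rule hol_eqI) (metis DERIV_unique assms hv_deriv)

lemma hv_ext_add: "hv (f + g) = (\<lambda>z. hv f z + hv g z)" and hv_ext_mult: "hv (f * g) = (\<lambda>z. hv f z * hv g z)"
  and hv_ext_scale: "hv (r *\<^sub>R f) = (\<lambda>z. of_real r * hv f z)" and hv_ext_minus: "hv (- f) = (\<lambda>z. - hv f z)"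
  by auto

lemma hD_add [simp]: "hD (f + g) = hD f + hD g"
  by (rule hD_unique) (unfold hv_ext_add, auto intro!: derivative_eq_intros hv_deriv)

lemma hD_mult: "hD (f * g) = hD f * g + f * hD g"
  by (rule hD_unique) (unfold hv_ext_mult, auto intro!: derivative_eq_intros hv_deriv)

lemma hD_of:
  assumes "f holomorphic_on UH" "g holomorphic_on UH"
    "\<And>z. Im z > 0 \<Longrightarrow> (f has_field_derivative g z) (at z)"
  shows "hD (hol_of f) = hol_of g"
proof (rule hD_unique)
  fix z :: complex assume z: "Im z > 0"
  have "(hv (hol_of f) has_field_derivative g z) (at z)"
    by (rule has_field_derivative_transform_within_open[OF assms(3)[OF z] open_UH])
       (use z hv_hol_of[OF assms(1)] in auto)
  then show "(hv (hol_of f) has_field_derivative hv (hol_of g) z) (at z)"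
    using z hv_hol_of[OF assms(2)] by simp
qed

lemma hD_hc [simp]: "hD (hc c) = 0"
proof -
  have "hD (hol_of (\<lambda>_. c)) = hol_of (\<lambda>_. 0)"
    by (rule hD_of) auto
  also have "\<dots> = 0" by (rule hol_eqI) (simp add: hv_hol_of)
  finally show ?thesis by (simp add: hc_def)
qed

lemma hD_0 [simp]: "hD 0 = 0" using hD_hc[of 0] by (simp add: hc_simps)
lemma hD_1 [simp]: "hD 1 = 0" using hD_hc[of 1] by (simp add: hc_simps)

lemma hD_scaleR [simp]: "hD (r *\<^sub>R f) = r *\<^sub>R hD f"
  by (simp add: scaleR_hc hD_mult)

section \<open>Powers of \<gamma>\<tau>+\<delta> and pullback along g\<close>

definition den :: "mat2 \<Rightarrow> complex \<Rightarrow> complex" where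
  "den g z = of_real (gam g) * z + of_real (del g)"

lemma den_nz: "gam g \<noteq> 0 \<Longrightarrow> Im z > 0 \<Longrightarrow> den g z \<noteq> 0"
  by (auto simp: den_def complex_eq_iff)

definition U :: "mat2 \<Rightarrow> int \<Rightarrow> hol" where
  "U g e = hol_of (\<lambda>z. den g z powi e)"

lemma holomorphic_den: "gam g \<noteq> 0 \<Longrightarrow> (\<lambda>z. den g z powi e) holomorphic_on UH"
  using den_nz[of g] unfolding den_def by (auto intro!: holomorphic_intros)

lemma hv_U: "gam g \<noteq> 0 \<Longrightarrow> Im z > 0 \<Longrightarrow> hv (U g e) z = den g z powi e"
  unfolding U_def by (rule hv_hol_of[OF holomorphic_den])

lemma U_add: "gam g \<noteq> 0 \<Longrightarrow> U g (e + e') = U g e * U g e'"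
  by (rule hol_eqI) (simp add: hv_U den_nz power_int_add)

lemma U_0: "gam g \<noteq> 0 \<Longrightarrow> U g 0 = 1"
  by (rule hol_eqI) (simp add: hv_U)

lemma hD_U:
  assumes "gam g \<noteq> 0"
  shows "hD (U g e) = (of_int e * gam g) *\<^sub>R U g (e - 1)"
proof (rule hD_unique)
  fix z :: complex assume z: "Im z > 0"
  have nz: "den g z \<noteq> 0" using den_nz[OF assms z] .
  have d: "(den g has_field_derivative of_real (gam g)) (at z)"
    unfolding den_def[abs_def] by (auto intro!: derivative_eq_intros)
  have "((\<lambda>z. den g z powi e) has_field_derivative (of_int e * den g z powi (e - 1) * of_real (gam g))) (at z)"
    by (rule DERIV_power_int[OF d]) (use nz in simp)
  then have "(hv (U g e) has_field_derivative (of_int e * den g z powi (e - 1) * of_real (gam g))) (at z)"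
    by (rule has_field_derivative_transform_within_open[OF _ open_UH]) (use z assms in \<open>auto simp: hv_U\<close>)
  then show "(hv (U g e) has_field_derivative hv ((of_int e * gam g) *\<^sub>R U g (e - 1)) z) (at z)"
    using z assms by (simp add: hv_U mult_ac)
qed

definition hcomp :: "mat2 \<Rightarrow> hol \<Rightarrow> hol" where
  "hcomp g f = hol_of (\<lambda>z. hv f (mob g z))"

lemma mob_den: "mob g z = (of_real (fst g) * z + of_real (fst (snd g))) / den g z"
  by (simp add: mob_def den_def gam_def del_def case_prod_unfold)

lemma den_nz': "sl2R g \<Longrightarrow> Im z > 0 \<Longrightarrow> den g z \<noteq> 0"
  by (auto simp: den_def complex_eq_iff sl2R_def gam_def del_def case_prod_unfold)

lemma Im_mob:
  assumes "sl2R g" "Im z > 0"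
  shows "Im (mob g z) > 0"
proof -
  obtain a b c d where g: "g = (a, b, c, d)" by (cases g) auto
  have det: "a * d - b * c = 1" using assms g by (simp add: sl2R_def)
  have nz: "den g z \<noteq> 0" using den_nz'[OF assms] .
  have "Im (mob g z) = Im ((of_real a * z + of_real b) * cnj (den g z)) / (norm (den g z))\<^sup>2"
    unfolding mob_den complex_div_cnj[of _ "den g z"] by (simp add: g flip: of_real_power)
  also have "Im ((of_real a * z + of_real b) * cnj (den g z)) = (a * d - b * c) * Im z"
    by (simp add: den_def g gam_def del_def algebra_simps)
  finally show ?thesis using det assms nz by simp
qed

lemma holomorphic_mob: "sl2R g \<Longrightarrow> mob g holomorphic_on UH"
  unfolding mob_den[abs_def] by (auto intro!: holomorphic_intros simp: den_def den_nz'[unfolded den_def])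

lemma hv_hcomp: "sl2R g \<Longrightarrow> Im z > 0 \<Longrightarrow> hv (hcomp g f) z = hv f (mob g z)"
  unfolding hcomp_def
  by (rule hv_hol_of[OF holomorphic_on_compose_gen[OF holomorphic_mob hv_holomorphic, unfolded o_def]])
     (auto simp: Im_mob)

lemma mob_deriv:
  assumes "sl2R g" "Im z > 0"
  shows "(mob g has_field_derivative 1 / (den g z)\<^sup>2) (at z)"
proof -
  obtain a b c d where g: "g = (a, b, c, d)" by (cases g) auto
  have det: "a * d - b * c = 1" using assms g by (simp add: sl2R_def)
  have nz: "den g z \<noteq> 0" using den_nz'[OF assms] .
  have nz': "of_real c * z + of_real d \<noteq> 0" using nz by (simp add: den_def g gam_def del_def)
  have e: "of_real a * (of_real c * z + of_real d) - (of_real a * z + of_real b) * of_real c = (1::complex)"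
  proof -
    have "of_real a * (of_real c * z + of_real d) - (of_real a * z + of_real b) * of_real c = (of_real (a * d - b * c) :: complex)"
      by (simp add: algebra_simps)
    then show ?thesis using det by simp
  qed
  show ?thesis unfolding mob_def[abs_def] g
    using nz' by (auto intro!: derivative_eq_intros simp: e den_def g gam_def del_def power2_eq_square)
qed

lemma hD_hcomp:
  assumes "sl2R g" "gam g \<noteq> 0"
  shows "hD (hcomp g f) = U g (- 2) * hcomp g (hD f)"
proof (rule hD_unique)
  fix z :: complex assume z: "Im z > 0"
  have "((\<lambda>z. hv f (mob g z)) has_field_derivative (hv (hD f) (mob g z) * (1 / (den g z)\<^sup>2))) (at z)"
    by (rule DERIV_chain2[OF hv_deriv mob_deriv]) (use assms z Im_mob in auto)
  then have "(hv (hcomp g f) has_field_derivative (hv (hD f) (mob g z) * (1 / (den g z)\<^sup>2))) (at z)"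
    by (rule has_field_derivative_transform_within_open[OF _ open_UH]) (use z assms in \<open>auto simp: hv_hcomp\<close>)
  then show "(hv (hcomp g f) has_field_derivative hv (U g (- 2) * hcomp g (hD f)) z) (at z)"
    using z assms by (simp add: hv_U hv_hcomp power_int_minus divide_inverse mult.commute)
qed

lemma hcomp_simps: "sl2R g \<Longrightarrow> hcomp g (f + f') = hcomp g f + hcomp g f'"
  "sl2R g \<Longrightarrow> hcomp g (f * f') = hcomp g f * hcomp g f'" "sl2R g \<Longrightarrow> hcomp g 0 = 0" "sl2R g \<Longrightarrow> hcomp g 1 = 1"
  "sl2R g \<Longrightarrow> hcomp g (r *\<^sub>R f) = r *\<^sub>R hcomp g f" "sl2R g \<Longrightarrow> hcomp g (hc c) = hc c"
  by (rule hol_eqI; simp add: hv_hcomp Im_mob)+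

lifting_forget hol.lifting

section \<open>Finitely supported states and their Heisenberg modes\<close>

type_synonym W = "mono \<Rightarrow>\<^sub>0 hol"

instantiation poly_mapping :: (type, real_vector) real_vector
begin
lift_definition scaleR_poly_mapping :: "real \<Rightarrow> ('a \<Rightarrow>\<^sub>0 'b) \<Rightarrow> ('a \<Rightarrow>\<^sub>0 'b)" is "\<lambda>r f x. r *\<^sub>R f x"
  by (erule finite_subset[rotated]) auto
instance by standard (transfer; auto simp: algebra_simps fun_eq_iff)+
end

abbreviation lookup :: "('a \<Rightarrow>\<^sub>0 'b::zero) \<Rightarrow> 'a \<Rightarrow> 'b" where "lookup \<equiv> Poly_Mapping.lookup"

lemma lookup_scaleR [simp]: "lookup (r *\<^sub>R w) m = r *\<^sub>R lookup w m"
  by transfer simp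

lemma lookup_sum': "lookup (\<Sum>i\<in>I. f i) m = (\<Sum>i\<in>I. lookup (f i) m)"
  by (induction I rule: infinite_finite_induct) (auto simp: lookup_add)

lift_definition wamul :: "nat \<Rightarrow> W \<Rightarrow> W" is
  "\<lambda>k s (l, u). if k \<in># l then s (l - {#k#}, u) else 0"
proof -
  fix k :: nat and s :: "mono \<Rightarrow> hol" assume *: "finite {x. s x \<noteq> 0}"
  show "finite {x. (case x of (l, u) \<Rightarrow> if k \<in># l then s (l - {#k#}, u) else 0) \<noteq> 0}"
  proof (rule finite_subset[OF _ finite_imageI[OF *, of "\<lambda>(l, u). (add_mset k l, u)"]], safe)
    fix l u assume "(if k \<in># l then s (l - {#k#}, u) else 0) \<noteq> 0"
    then show "(l, u) \<in> (\<lambda>(l, u). (add_mset k l, u)) ` {x. s x \<noteq> 0}"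
      by (intro image_eqI[of _ _ "(l - {#k#}, u)"]) (auto split: if_splits)
  qed
qed

lift_definition wbmul :: "nat \<Rightarrow> W \<Rightarrow> W" is
  "\<lambda>k s (l, u). if k \<in># u then s (l, u - {#k#}) else 0"
proof -
  fix k :: nat and s :: "mono \<Rightarrow> hol" assume *: "finite {x. s x \<noteq> 0}"
  show "finite {x. (case x of (l, u) \<Rightarrow> if k \<in># u then s (l, u - {#k#}) else 0) \<noteq> 0}"
  proof (rule finite_subset[OF _ finite_imageI[OF *, of "\<lambda>(l, u). (l, add_mset k u)"]], safe)
    fix l u assume "(if k \<in># u then s (l, u - {#k#}) else 0) \<noteq> 0"
    then show "(l, u) \<in> (\<lambda>(l, u). (l, add_mset k u)) ` {x. s x \<noteq> 0}"
      by (intro image_eqI[of _ _ "(l, u - {#k#})"]) (auto split: if_splits)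
  qed
qed

lift_definition wapos :: "nat \<Rightarrow> W \<Rightarrow> W" is
  "\<lambda>k s (l, u). real (count u k + 1) *\<^sub>R s (l, add_mset k u)"
proof -
  fix k :: nat and s :: "mono \<Rightarrow> hol" assume *: "finite {x. s x \<noteq> 0}"
  show "finite {x. (case x of (l, u) \<Rightarrow> real (count u k + 1) *\<^sub>R s (l, add_mset k u)) \<noteq> 0}"
  proof (rule finite_subset[OF _ finite_imageI[OF *, of "\<lambda>(l, u). (l, u - {#k#})"]], safe)
    fix l u assume "real (count u k + 1) *\<^sub>R s (l, add_mset k u) \<noteq> 0"
    then show "(l, u) \<in> (\<lambda>(l, u). (l, u - {#k#})) ` {x. s x \<noteq> 0}"
      by (intro image_eqI[of _ _ "(l, add_mset k u)"]) auto
  qed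
qed

lift_definition wbpos :: "nat \<Rightarrow> W \<Rightarrow> W" is
  "\<lambda>k s (l, u). - real (count l k + 1) *\<^sub>R s (add_mset k l, u)"
proof -
  fix k :: nat and s :: "mono \<Rightarrow> hol" assume *: "finite {x. s x \<noteq> 0}"
  show "finite {x. (case x of (l, u) \<Rightarrow> - real (count l k + 1) *\<^sub>R s (add_mset k l, u)) \<noteq> 0}"
  proof (rule finite_subset[OF _ finite_imageI[OF *, of "\<lambda>(l, u). (l - {#k#}, u)"]], safe)
    fix l u assume "- real (count l k + 1) *\<^sub>R s (add_mset k l, u) \<noteq> 0"
    then show "(l, u) \<in> (\<lambda>(l, u). (l - {#k#}, u)) ` {x. s x \<noteq> 0}"
      by (intro image_eqI[of _ _ "(add_mset k l, u)"]) auto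
  qed
qed

lift_definition wscale :: "hol \<Rightarrow> W \<Rightarrow> W" is "\<lambda>f s m. f * s m"
  by (erule finite_subset[rotated]) auto

lift_definition wD :: "W \<Rightarrow> W" is "\<lambda>s m. hD (s m)"
  by (erule finite_subset[rotated]) auto

lemma lookup_w [simp]:
  "lookup (wamul k w) (l, u) = (if k \<in># l then lookup w (l - {#k#}, u) else 0)"
  "lookup (wbmul k w) (l, u) = (if k \<in># u then lookup w (l, u - {#k#}) else 0)"
  "lookup (wapos k w) (l, u) = real (count u k + 1) *\<^sub>R lookup w (l, add_mset k u)"
  "lookup (wbpos k w) (l, u) = - real (count l k + 1) *\<^sub>R lookup w (add_mset k l, u)"
  "lookup (wscale f w) m = f * lookup w m" "lookup (wD w) m = hD (lookup w m)"
  by (simp_all add: wamul.rep_eq wbmul.rep_eq wapos.rep_eq wbpos.rep_eq wscale.rep_eq wD.rep_eq)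

definition aW :: "int \<Rightarrow> W \<Rightarrow> W" where
  "aW j = (if j < 0 then wamul (nat (- j)) else if j = 0 then wD else wapos (nat j))"

text \<open>
  The modes of $\gamma^{-1} a(z)$ and $\gamma b(z) + \delta$. In these the action of $g$ no longer depends on $\gamma$ and
  $\delta$, except for an overall power of $\gamma$; $\pi(g) b = \alpha/\gamma - \gamma^{-1} (\gamma b + \delta)^{-1}$.\<close>

definition atil :: "mat2 \<Rightarrow> int \<Rightarrow> W \<Rightarrow> W" where
  "atil g i w = (1 / gam g) *\<^sub>R aW i w"

definition btil :: "mat2 \<Rightarrow> int \<Rightarrow> W \<Rightarrow> W" where
  "btil g i w = (if i < 0 then gam g *\<^sub>R wbmul (nat (- i)) w else if i = 0 then wscale (U g 1) w
     else gam g *\<^sub>R wbpos (nat i) w)"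

lemma W_eqI: "(\<And>l u. lookup x (l, u) = lookup y (l, u)) \<Longrightarrow> x = (y :: W)"
  by (rule poly_mapping_eqI) auto

lemma linear_W:
  "linear (wamul k)" "linear (wbmul k)" "linear (wapos k)" "linear (wbpos k)" "linear wD" "linear (wscale f)"
proof -
  show "linear wD" by (rule linearI; rule W_eqI; simp add: lookup_add)
qed (rule linearI; rule W_eqI; simp add: lookup_add algebra_simps scaleR_hc)+

lemma linear_aW: "linear (aW i)"
  by (simp add: aW_def linear_W)

lemma linear_atil: "linear (atil g i)"
  unfolding atil_def[abs_def] by (rule linear_compose_scale_right[OF linear_aW])

lemma linear_btil: "linear (btil g i)"
  unfolding btil_def[abs_def]
  by (cases "i < 0"; cases "i = 0"; simp add: linear_compose_scale_right linear_W)

lemma in_diff_single: "k \<noteq> k' \<Longrightarrow> k' \<in># l - {#k#} \<longleftrightarrow> k' \<in># l"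
  by (simp add: in_diff_count)

lemma wamul_comm: "wamul k (wamul k' w) = wamul k' (wamul k w)"
  by (rule W_eqI, cases "k = k'") (auto simp: in_diff_single add_mset_commute)

lemma wbmul_comm: "wbmul k (wbmul k' w) = wbmul k' (wbmul k w)"
  by (rule W_eqI, cases "k = k'") (auto simp: in_diff_single add_mset_commute)

lemma wapos_comm: "wapos k (wapos k' w) = wapos k' (wapos k w)"
  by (rule W_eqI, cases "k = k'") (auto simp: add_mset_commute mult.commute)

lemma wbpos_comm: "wbpos k (wbpos k' w) = wbpos k' (wbpos k w)"
  by (rule W_eqI, cases "k = k'") (auto simp: add_mset_commute mult.commute)

lemma mult_scaleR_hol: "f * (r *\<^sub>R f') = r *\<^sub>R (f * f' :: hol)"
  by (rule hol_eqI) simp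

lemma wmul_comm:
  "wamul k (wbmul k' w) = wbmul k' (wamul k w)" "wamul k (wapos k' w) = wapos k' (wamul k w)"
  "wbmul k (wbpos k' w) = wbpos k' (wbmul k w)" "wapos k (wbpos k' w) = wbpos k' (wapos k w)"
  "wD (wamul k w) = wamul k (wD w)" "wD (wbmul k w) = wbmul k (wD w)"
  "wD (wapos k w) = wapos k (wD w)" "wD (wbpos k w) = wbpos k (wD w)"
  "wscale f (wamul k w) = wamul k (wscale f w)" "wscale f (wbmul k w) = wbmul k (wscale f w)"
  "wscale f (wapos k w) = wapos k (wscale f w)" "wscale f (wbpos k w) = wbpos k (wscale f w)"
  by (rule W_eqI; simp add: mult_scaleR_hol)+

lemma wapos_wbmul: "wapos k (wbmul k' w) = wbmul k' (wapos k w) + (if k = k' then w else 0)"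
proof (rule W_eqI)
  fix l u
  show "lookup (wapos k (wbmul k' w)) (l, u) = lookup (wbmul k' (wapos k w) + (if k = k' then w else 0)) (l, u)"
  proof (cases "k = k'")
    case True
    show ?thesis
    proof (cases "k \<in># u")
      case in_u: True
      then obtain u' where "u = add_mset k u'" by (metis multi_member_split)
      then show ?thesis using True by (intro hol_eqI) (simp add: lookup_add algebra_simps)
    next
      case False
      moreover from this have "count u k = 0" by (simp add: not_in_iff)
      ultimately show ?thesis using True by (simp add: lookup_add)
    qed
  next
    case False
    then show ?thesis by (simp add: diff_add_mset_swap)
  qed
qed

lemma wamul_wbpos: "wamul k (wbpos k' w) = wbpos k' (wamul k w) + (if k = k' then w else 0)"
proof (rule W_eqI)
  fix l u
  show "lookup (wamul k (wbpos k' w)) (l, u) = lookup (wbpos k' (wamul k w) + (if k = k' then w else 0)) (l, u)"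
  proof (cases "k = k'")
    case True
    show ?thesis
    proof (cases "k \<in># l")
      case in_u: True
      then obtain l' where "l = add_mset k l'" by (metis multi_member_split)
      then show ?thesis using True by (intro hol_eqI) (simp add: lookup_add algebra_simps)
    next
      case False
      moreover from this have "count l k = 0" by (simp add: not_in_iff)
      ultimately show ?thesis using True by (simp add: lookup_add)
    qed
  next
    case False
    then show ?thesis by (simp add: diff_add_mset_swap)
  qed
qed

lemma wD_wscale: "wD (wscale f w) = wscale f (wD w) + wscale (hD f) w"
  by (rule W_eqI) (simp add: lookup_add hD_mult algebra_simps)

lemma wscale_wscale: "wscale f (wscale f' w) = wscale (f * f') w"
  by (rule W_eqI) (simp add: mult.assoc)

lemma wscale_1: "wscale 1 w = w" by (rule W_eqI) simp

lemma wscale_scaleR: "wscale (r *\<^sub>R f) w = r *\<^sub>R wscale f w"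
  by (rule W_eqI) (simp add: scaleR_hc mult.assoc)

lemmas lin_W_simps = linear_scale[OF linear_W(1)] linear_scale[OF linear_W(2)] linear_scale[OF linear_W(3)]
  linear_scale[OF linear_W(4)] linear_scale[OF linear_W(5)] linear_scale[OF linear_W(6)]

lemma aW_comm: "aW i (aW j w) = aW j (aW i w)"
  by (rule linorder_cases[of i 0]; rule linorder_cases[of j 0];
      simp add: aW_def wmul_comm wamul_comm[of "nat (- i)"] wapos_comm[of "nat i"])

lemma atil_comm: "atil g i (atil g j w) = atil g j (atil g i w)"
  by (simp add: atil_def linear_scale[OF linear_aW] aW_comm)

lemma btil_comm: "btil g i (btil g j w) = btil g j (btil g i w)"
  by (rule linorder_cases[of i 0]; rule linorder_cases[of j 0];
      simp add: btil_def lin_W_simps wmul_comm wbmul_comm[of "nat (- i)"] wbpos_comm[of "nat i"])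

text \<open>The factors 1/\<gamma> and \<gamma> cancel in the commutators; for i = j = 0 the second
  factor comes from the derivative of \<gamma>\<tau>+\<delta>.\<close>

lemma atil_btil:
  assumes "gam g \<noteq> 0"
  shows "atil g i (btil g j w) = btil g j (atil g i w) + (if i + j = 0 then w else 0)"
proof -
  have 1: "wD (wscale (U g 1) w) = wscale (U g 1) (wD w) + gam g *\<^sub>R w"
    using assms by (simp add: wD_wscale hD_U U_0 wscale_scaleR wscale_1)
  show ?thesis
    by (rule linorder_cases[of i 0]; rule linorder_cases[of j 0];
        use assms in \<open>auto simp: atil_def btil_def aW_def lin_W_simps wmul_comm wapos_wbmul wamul_wbpos 1 scaleR_add_right\<close>)
qed

text \<open>A finitely supported state contains only finitely many parts, and an annihilation mode
  beyond the largest of them finds nothing to remove.\<close>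

lemma W_loc_fin: "\<exists>N. \<forall>i>N. atil g i w = 0 \<and> btil g i w = 0"
proof -
  define P where "P = (\<Union>m\<in>Poly_Mapping.keys w. set_mset (fst m) \<union> set_mset (snd m))"
  have fP: "finite P" by (auto simp: P_def)
  define N where "N = int (Max (insert 0 P))"
  have "atil g i w = 0 \<and> btil g i w = 0" if "i > N" for i
  proof -
    have i0: "i > 0" using that by (simp add: N_def)
    have nP: "nat i \<notin> P"
    proof
      assume "nat i \<in> P"
      then have "nat i \<le> Max (insert 0 P)" using fP by (intro Max_ge) auto
      then show False using that by (simp add: N_def)
    qed
    have P: "k \<in> P" if "lookup w (l, u) \<noteq> 0" "k \<in># l \<or> k \<in># u" for k l u
    proof -
      have "(l, u) \<in> Poly_Mapping.keys w" using that by (simp add: in_keys_iff)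
      then show ?thesis using that(2) unfolding P_def by fastforce
    qed
    have "lookup w (l, add_mset (nat i) u) = 0" "lookup w (add_mset (nat i) l, u) = 0" for l u
      using nP P[of l "add_mset (nat i) u" "nat i"] P[of "add_mset (nat i) l" u "nat i"] by auto
    then have "wapos (nat i) w = 0" "wbpos (nat i) w = 0" by (auto intro!: W_eqI)
    then show ?thesis using i0 by (simp add: atil_def aW_def btil_def)
  qed
  then show ?thesis by blast
qed

lemma heis_W: "gam g \<noteq> 0 \<Longrightarrow> heis (atil g) (btil g)"
  by (rule heis.intro) (rule linear_atil linear_btil atil_comm btil_comm W_loc_fin | erule atil_btil)+

lemma heis_inv_W:
  assumes "gam g \<noteq> 0"
  shows "heis_inv (atil g) (btil g) (wscale (U g (- 1)))"
proof -
  have "U g (- 1) * U g 1 = 1" "U g 1 * U g (- 1) = 1"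
    using assms U_add[of g "- 1" 1] U_add[of g 1 "- 1"] by (simp_all add: U_0)
  then show ?thesis
    by (intro heis_inv.intro heis_W assms heis_inv_axioms.intro linear_W)
       (simp_all add: btil_def wscale_wscale wscale_1)
qed

section \<open>Comparison with the modes of the vertex algebra\<close>

lemma infsum_finite_support:
  assumes "finite F" "F \<subseteq> S" "\<And>x. x \<in> S - F \<Longrightarrow> f x = 0"
  shows "infsum f S = sum f F"
proof -
  have "infsum f S = infsum f F" by (rule infsum_cong_neutral) (use assms in auto)
  then show ?thesis using assms(1) by simp
qed

text \<open>Only the half plane is compared: a \<open>state\<close> may take any values elsewhere,
  whereas \<open>hv\<close> vanishes there.\<close>

definition rel :: "state \<Rightarrow> W \<Rightarrow> bool" where
  "rel s w \<longleftrightarrow> (\<forall>m \<tau>. Im \<tau> > 0 \<longrightarrow> s m \<tau> = hv (lookup w m) \<tau>)"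

lemma relI: "(\<And>l u \<tau>. Im \<tau> > 0 \<Longrightarrow> s (l, u) \<tau> = hv (lookup w (l, u)) \<tau>) \<Longrightarrow> rel s w"
  by (auto simp: rel_def)

lemma relD: "rel s w \<Longrightarrow> Im \<tau> > 0 \<Longrightarrow> s m \<tau> = hv (lookup w m) \<tau>"
  unfolding rel_def by blast

lemma rel_amode:
  assumes "rel s w" shows "rel (amode i s) (aW i w)"
proof (rule relI)
  fix l u :: "nat multiset" and \<tau> assume t: "Im \<tau> > 0"
  show "amode i s (l, u) \<tau> = hv (lookup (aW i w) (l, u)) \<tau>"
  proof (rule linorder_cases[of i 0])
    assume "i = 0"
    have "(s (l, u) has_field_derivative hv (hD (lookup w (l, u))) \<tau>) (at \<tau>)"
      by (rule has_field_derivative_transform_within_open[OF hv_deriv[OF t] open_UH])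
         (use t relD[OF assms] in auto)
    then show ?thesis using \<open>i = 0\<close> by (simp add: amode_def aW_def a0op_def DERIV_imp_deriv)
  qed (use t relD[OF assms] in \<open>auto simp: amode_def aW_def amul_def apos_def\<close>)
qed

lemma rel_bmode:
  assumes "rel s w" "i \<noteq> 0" "gam g \<noteq> 0"
  shows "rel (bmode i s) ((1 / gam g) *\<^sub>R btil g i w)"
  by (rule relI) (use relD[OF assms(1)] assms in \<open>auto simp: bmode_def btil_def bmul_def bpos_def\<close>)

lemma linear_fold: "(\<And>k. linear (f k)) \<Longrightarrow> linear (fold f ks)"
  by (induction ks) (auto simp: linear_id id_def[symmetric] intro: linear_compose)

lemma rel_fold_bmode:
  assumes "rel s w" "0 \<notin> set ms" "gam g \<noteq> 0"
  shows "rel (fold bmode ms s) ((1 / gam g) ^ length ms *\<^sub>R fold (btil g) ms w)"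
  using assms(1,2)
proof (induction ms arbitrary: s w)
  case (Cons x xs)
  then have "rel (fold bmode xs (bmode x s)) ((1 / gam g) ^ length xs *\<^sub>R fold (btil g) xs ((1 / gam g) *\<^sub>R btil g x w))"
    using assms(3) rel_bmode by (intro Cons.IH) auto
  then show ?case by (simp add: linear_scale[OF linear_fold[OF linear_btil]] mult.commute)
qed simp

lemma Yf_finite:
  assumes "rel s w" "gam g \<noteq> 0" "Im \<tau> > 0"
    "finite F" "F \<subseteq> {ms. 0 \<notin> set ms \<and> sum_list ms = n}"
    "\<And>ms. 0 \<notin> set ms \<Longrightarrow> sum_list ms = n \<Longrightarrow> ms \<notin> F \<Longrightarrow>
       (deriv ^^ length ms) f \<tau> = 0 \<or> fold (btil g) ms w = 0"
  shows "Yf f n s m \<tau> = (\<Sum>ms\<in>F. ((deriv ^^ length ms) f \<tau> / fact (length ms)) *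
     ((1 / of_real (gam g)) ^ length ms * hv (lookup (fold (btil g) ms w) m) \<tau>))"
proof -
  have e: "fold bmode ms s m \<tau> = (1 / of_real (gam g)) ^ length ms * hv (lookup (fold (btil g) ms w) m) \<tau>"
    if "0 \<notin> set ms" for ms
    using relD[OF rel_fold_bmode[OF assms(1) that assms(2)] assms(3)] by simp
  have "Yf f n s m \<tau> = (\<Sum>ms\<in>F. ((deriv ^^ length ms) f \<tau> / fact (length ms)) * fold bmode ms s m \<tau>)"
    unfolding Yf_def using assms(4,5,6) by (intro infsum_finite_support) (auto simp: e dest!: assms(6))
  also have "\<dots> = (\<Sum>ms\<in>F. ((deriv ^^ length ms) f \<tau> / fact (length ms)) *
     ((1 / of_real (gam g)) ^ length ms * hv (lookup (fold (btil g) ms w) m) \<tau>))"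
    using assms(5) e by (intro sum.cong) auto
  finally show ?thesis .
qed

definition bbt :: "mat2 \<Rightarrow> int \<Rightarrow> W \<Rightarrow> W" where "bbt g = heis.bb (btil g)"
definition At :: "mat2 \<Rightarrow> int \<Rightarrow> W \<Rightarrow> W" where "At g = heis.A (atil g) (btil g)"
definition bet :: "mat2 \<Rightarrow> nat \<Rightarrow> W \<Rightarrow> W" where "bet g = heis_inv.beta (btil g) (wscale (U g (- 1)))"
definition vacW :: "mat2 \<Rightarrow> W \<Rightarrow> bool" where "vacW g = heis.vac (btil g)"

lemma Pfun_derivs:
  "deriv (Pfun g) = (\<lambda>\<tau>. 2 * of_real (gam g) * den g \<tau>)"
  "deriv (\<lambda>\<tau>. 2 * of_real (gam g) * den g \<tau>) = (\<lambda>\<tau>. 2 * of_real (gam g) ^ 2)"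
  unfolding Pfun_def den_def[abs_def]
  by (rule ext, rule DERIV_imp_deriv, auto intro!: derivative_eq_intros simp: power2_eq_square)+

lemma Pfun_deriv_ge3: "k \<ge> 3 \<Longrightarrow> (deriv ^^ k) (Pfun g) = (\<lambda>_. 0)"
proof (induction k rule: dec_induct)
  case base
  then show ?case by (simp add: numeral_3_eq_3 Pfun_derivs)
next
  case (step n)
  then show ?case by simp
qed

lemma Pfun_den: "Pfun g \<tau> = den g \<tau> ^ 2"
  by (simp add: Pfun_def den_def)

text \<open>The Taylor expansion of the quadratic polynomial stops at lists of length 2. Those lists
  avoid the index 0, and the shorter ones supply the summands of \<open>bb\<close> that contain the
  mode \<open>btil g 0\<close>.\<close>

lemma rel_Yf_Pfun:
  assumes "rel s w" "gam g \<noteq> 0"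
  shows "rel (Yf (Pfun g) n s) (bbt g n w)"
proof (rule relI)
  fix l u :: "nat multiset" and \<tau> assume t: "Im \<tau> > 0"
  let ?m = "(l, u)"
  interpret heis "atil g" "btil g" by (rule heis_W[OF assms(2)])
  define c where "c = complex_of_real (gam g)"
  have c0: "c \<noteq> 0" using assms(2) by (simp add: c_def)
  obtain N0 where N0: "\<forall>i>N0. btil g i w = 0" using loc_fin by blast
  define N where "N = max N0 (max 0 n)"
  have N: "\<forall>i>N. btil g i w = 0" "N \<ge> 0" "N \<ge> n" using N0 by (auto simp: N_def)
  define I where "I = {p\<in>{n - N..N}. p \<noteq> 0 \<and> p \<noteq> n}"
  define F where "F = (if n = 0 then {[]} else {[n]}) \<union> (\<lambda>p. [n - p, p]) ` I"
  define T where "T p = hv (lookup (btil g p (btil g (n - p) w)) ?m) \<tau>" for p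
  define x where "x = hv (lookup w ?m) \<tau>"
  define Sm where "Sm ms = ((deriv ^^ length ms) (Pfun g) \<tau> / fact (length ms)) *
     ((1 / of_real (gam g)) ^ length ms * hv (lookup (fold (btil g) ms w) ?m) \<tau>)" for ms
  have fI: "finite I" by (rule finite_subset[of _ "{n - N..N}"]) (auto simp: I_def)
  have Y: "Yf (Pfun g) n s ?m \<tau> = sum Sm F"
    unfolding Sm_def
  proof (rule Yf_finite[OF assms t])
    from fI show "finite F" by (simp add: F_def)
    show "F \<subseteq> {ms. 0 \<notin> set ms \<and> sum_list ms = n}" by (auto simp: F_def I_def)
    fix ms :: "int list" assume ms: "0 \<notin> set ms" "sum_list ms = n" "ms \<notin> F"
    show "(deriv ^^ length ms) (Pfun g) \<tau> = 0 \<or> fold (btil g) ms w = 0"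
    proof (cases "length ms \<ge> 3")
      case True
      then show ?thesis by (simp add: Pfun_deriv_ge3)
    next
      case False
      then consider "ms = []" | y where "ms = [y]" | y z where "ms = [y, z]"
        by (cases ms; cases "tl ms"; cases "tl (tl ms)") auto
      then show ?thesis
      proof cases
        case 3
        then have p: "y = n - z" "z \<noteq> 0" "z \<noteq> n" using ms by auto
        then have "z \<notin> {n - N..N}" using ms 3 by (auto simp: F_def I_def)
        then have "btil g z (btil g (n - z) w) = 0" using bb_support[OF N(1), of z n] by auto
        then show ?thesis using 3 p by simp
      qed (use ms in \<open>auto simp: F_def\<close>)
    qed
  qed
  have inj: "inj_on (\<lambda>p. [n - p, p]) I" by (auto simp: inj_on_def)
  have S2: "sum Sm ((\<lambda>p. [n - p, p]) ` I) = (\<Sum>p\<in>I. T p)"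
    unfolding sum.reindex[OF inj] Sm_def
    by (intro sum.cong refl) (use c0 in \<open>simp add: Pfun_derivs T_def c_def power2_eq_square\<close>)
  have T0: "hv (lookup (btil g 0 y) ?m) \<tau> = den g \<tau> * hv (lookup y ?m) \<tau>" for y
    using t assms(2) by (simp add: btil_def hv_U)
  have "Yf (Pfun g) n s ?m \<tau> = (\<Sum>p\<in>{n - N..N}. T p)"
  proof (cases "n = 0")
    case True
    have "Yf (Pfun g) n s ?m \<tau> = Pfun g \<tau> * x + (\<Sum>p\<in>I. T p)"
      unfolding Y F_def using True S2 fI
      by (subst sum.union_disjoint) (auto simp: x_def Sm_def)
    also have "Pfun g \<tau> * x = T 0" using True unfolding T_def by (simp add: T0 Pfun_den x_def power2_eq_square)
    also have "T 0 + (\<Sum>p\<in>I. T p) = (\<Sum>p\<in>insert 0 I. T p)"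
      using fI by (subst sum.insert) (auto simp: I_def)
    also have "insert 0 I = {n - N..N}" using True N by (auto simp: I_def)
    finally show ?thesis .
  next
    case False
    have "Yf (Pfun g) n s ?m \<tau> = 2 * den g \<tau> * hv (lookup (btil g n w) ?m) \<tau> + (\<Sum>p\<in>I. T p)"
      unfolding Y F_def using False c0 S2 fI
      by (subst sum.union_disjoint) (auto simp: Pfun_derivs c_def Sm_def)
    \<comment> \<open>The linear Taylor term is the pair of summands p = 0 and p = n, where one of
      the two modes is multiplication by \<gamma>\<tau>+\<delta>.\<close>
    also have "2 * den g \<tau> * hv (lookup (btil g n w) ?m) \<tau> = T 0 + T n"
      unfolding T_def using T0 b_comm[of n 0 w] by simp
    also have "T 0 + T n + (\<Sum>p\<in>I. T p) = (\<Sum>p\<in>insert 0 (insert n I). T p)"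
    proof -
      have "0 \<notin> insert n I" "n \<notin> I" using False by (auto simp: I_def)
      then show ?thesis using fI by (simp add: add.assoc)
    qed
    also have "insert 0 (insert n I) = {n - N..N}" using False N by (auto simp: I_def)
    finally show ?thesis .
  qed
  also have "\<dots> = hv (lookup (bbt g n w) ?m) \<tau>"
    unfolding bbt_def bb_eq_sum[OF N(1)] T_def by (simp add: lookup_sum' hv_sum)
  finally show "Yf (Pfun g) n s ?m \<tau> = hv (lookup (bbt g n w) ?m) \<tau>" .
qed

text \<open>In rescaled fields, with a' = a/\<gamma> and b' = \<gamma>b+\<delta>, the transformed
  field is \<gamma> times :a' b'^2: + 2 \<partial>b', which is the field of
  \<open>heis.A\<close>.\<close>

lemma rel_Amode:
  assumes "rel s w" "gam g \<noteq> 0"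
  shows "rel (Amode g j s) (gam g *\<^sub>R At g j w)"
proof (rule relI)
  fix l u :: "nat multiset" and \<tau> assume t: "Im \<tau> > 0"
  let ?m = "(l, u)"
  interpret heis "atil g" "btil g" by (rule heis_W[OF assms(2)])
  define c where "c = complex_of_real (gam g)"
  have c0: "c \<noteq> 0" using assms(2) by (simp add: c_def)
  define F where "F = {i. Aterm j i w \<noteq> 0}"
  have fF: "finite F" unfolding F_def by (rule finite_Aterm)
  define T where "T i = c * hv (lookup (Aterm j i w) ?m) \<tau>" for i
  have T0: "T i = 0" if "i \<notin> F" for i using that by (simp add: T_def F_def)
  have neg: "amode i (Yf (Pfun g) (j - i) s) ?m \<tau> = T i" if "i < 0" for i
  proof -
    have "rel (amode i (Yf (Pfun g) (j - i) s)) (aW i (bbt g (j - i) w))"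
      by (intro rel_amode rel_Yf_Pfun assms)
    from relD[OF this t] show ?thesis using that c0
      by (simp add: T_def Aterm_def atil_def bbt_def c_def)
  qed
  have pos: "Yf (Pfun g) (j - i) (amode i s) ?m \<tau> = T i" if "i \<ge> 0" for i
  proof -
    have "rel (Yf (Pfun g) (j - i) (amode i s)) (bbt g (j - i) (aW i w))"
      by (intro rel_amode rel_Yf_Pfun assms)
    from relD[OF this t] show ?thesis using that c0
      by (simp add: T_def Aterm_def atil_def bbt_def c_def)
  qed
  have bj: "2 * c^2 * of_int j * bmode j s ?m \<tau> = c * (2 * of_int j * hv (lookup (btil g j w) ?m) \<tau>)"
  proof (cases "j = 0")
    case False
    from relD[OF rel_bmode[OF assms(1) False assms(2)] t] show ?thesis using c0
      by (simp add: c_def power2_eq_square)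
  qed simp
  have "(\<Sum>\<^sub>\<infinity> i \<in> {..-1::int}. amode i (Yf (Pfun g) (j - i) s) ?m \<tau>) = (\<Sum>\<^sub>\<infinity> i \<in> {..-1::int}. T i)"
    by (intro infsum_cong) (use neg in auto)
  also have "\<dots> = (\<Sum>i\<in>F \<inter> {..-1}. T i)"
    by (rule infsum_finite_support) (use fF T0 in auto)
  finally have 1: "(\<Sum>\<^sub>\<infinity> i \<in> {..-1::int}. amode i (Yf (Pfun g) (j - i) s) ?m \<tau>) = (\<Sum>i\<in>F \<inter> {..-1}. T i)" .
  have "(\<Sum>\<^sub>\<infinity> i \<in> {0::int..}. Yf (Pfun g) (j - i) (amode i s) ?m \<tau>) = (\<Sum>\<^sub>\<infinity> i \<in> {0::int..}. T i)"
    by (intro infsum_cong) (use pos in auto)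
  also have "\<dots> = (\<Sum>i\<in>F \<inter> {0..}. T i)"
    by (rule infsum_finite_support) (use fF T0 in auto)
  finally have 2: "(\<Sum>\<^sub>\<infinity> i \<in> {0::int..}. Yf (Pfun g) (j - i) (amode i s) ?m \<tau>) = (\<Sum>i\<in>F \<inter> {0..}. T i)" .
  have "F = (F \<inter> {..-1}) \<union> (F \<inter> {0..})" "(F \<inter> {..-1}) \<inter> (F \<inter> {0..}) = {}" by auto
  then have "(\<Sum>i\<in>F. T i) = (\<Sum>i\<in>F \<inter> {..-1}. T i) + (\<Sum>i\<in>F \<inter> {0..}. T i)"
    using sum.union_disjoint[of "F \<inter> {..-1}" "F \<inter> {0..}" T] fF by simp
  moreover have "(\<Sum>i\<in>F. T i) = c * hv (lookup (Sum_any (\<lambda>i. Aterm j i w)) ?m) \<tau>"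
    unfolding Sum_any.expand_set F_def[symmetric] T_def by (simp add: lookup_sum' hv_sum sum_distrib_left)
  ultimately show "Amode g j s ?m \<tau> = hv (lookup (gam g *\<^sub>R At g j w) ?m) \<tau>"
    unfolding Amode_def 1 2 c_def[symmetric] bj At_def A_def
    by (simp add: lookup_minus c_def algebra_simps)
qed

section \<open>Modes of the Moebius transform of b\<close>

lemma mob_deriv_higher:
  assumes "sl2R g" "gam g \<noteq> 0" "Im \<tau> > 0"
  shows "(deriv ^^ Suc i) (mob g) \<tau> / fact (Suc i) =
     (- 1) ^ i * of_real (gam g) ^ i / den g \<tau> ^ (i + 2)"
  using assms(3)
proof (induction i arbitrary: \<tau>)
  case 0
  then show ?case using DERIV_imp_deriv[OF mob_deriv[OF assms(1)]] by (simp add: power2_eq_square)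
next
  case (Suc i)
  define c where "c = complex_of_real (gam g)"
  have nz: "den g \<tau> \<noteq> 0" using den_nz[OF assms(2) Suc.prems] .
  have d: "(den g has_field_derivative c) (at \<tau>)"
    unfolding den_def[abs_def] c_def by (auto intro!: derivative_eq_intros)
  have IH: "(deriv ^^ Suc i) (mob g) x = fact (Suc i) * ((- 1) ^ i * c ^ i / den g x ^ (i + 2))" if "Im x > 0" for x
    using Suc.IH[OF that] unfolding c_def by (simp add: divide_eq_eq mult.commute del: funpow.simps fact_Suc)
  have "((\<lambda>\<tau>. fact (Suc i) * ((- 1) ^ i * c ^ i / den g \<tau> ^ (i + 2))) has_field_derivative
     fact (Suc i) * ((- 1) ^ i * c ^ i * (- (of_nat (i + 2) * c) / den g \<tau> ^ (i + 3)))) (at \<tau>)"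
    by (rule derivative_eq_intros d refl | (use nz in simp; fail))+
       (use nz in \<open>simp add: field_simps power_add power2_eq_square eval_nat_numeral\<close>)
  then have "((deriv ^^ Suc i) (mob g) has_field_derivative
     fact (Suc i) * ((- 1) ^ i * c ^ i * (- (of_nat (i + 2) * c) / den g \<tau> ^ (i + 3)))) (at \<tau>)"
    by (rule has_field_derivative_transform_within_open[OF _ open_UH])
       (use Suc.prems IH in \<open>auto simp del: funpow.simps\<close>)
  then have "(deriv ^^ Suc (Suc i)) (mob g) \<tau> =
     fact (Suc i) * ((- 1) ^ i * c ^ i * (- (of_nat (i + 2) * c) / den g \<tau> ^ (i + 3)))"
    by (simp add: DERIV_imp_deriv)
  also have "\<dots> = fact (Suc (Suc i)) * ((- 1) ^ Suc i * c ^ Suc i / den g \<tau> ^ (Suc i + 2))"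
  proof -
    have f: "fact (Suc (Suc i)) = of_nat (i + 2) * (fact (Suc i) :: complex)" by (simp add: algebra_simps)
    have D: "i + 3 = Suc i + 2" by simp
    show ?thesis unfolding f D by (simp del: fact_Suc of_nat_add)
  qed
  finally show ?case unfolding c_def by (simp del: funpow.simps fact_Suc)
qed

text \<open>Compositions of \<open>k\<close> with negated parts: the index lists that survive on
  vectors killed by all positive modes.\<close>

definition Lneg :: "nat \<Rightarrow> int list set" where
  "Lneg k = {ms. (\<forall>x\<in>set ms. x < 0) \<and> sum_list ms = - int k}"

lemma Lneg_bound:
  "(\<forall>x\<in>set ms. x < 0) \<Longrightarrow> int (length ms) \<le> - sum_list ms \<and> (\<forall>x\<in>set ms. sum_list ms \<le> x) \<and> sum_list ms \<le> (0::int)"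
  by (induction ms) auto

lemma finite_Lneg: "finite (Lneg k)"
proof (rule finite_subset)
  show "Lneg k \<subseteq> {ms. set ms \<subseteq> {- int k..0} \<and> length ms \<le> k}"
  proof
    fix ms assume "ms \<in> Lneg k"
    then have "\<forall>x\<in>set ms. x < 0" "sum_list ms = - int k" by (auto simp: Lneg_def)
    then show "ms \<in> {ms. set ms \<subseteq> {- int k..0} \<and> length ms \<le> k}"
      using Lneg_bound[of ms] by force
  qed
  show "finite {ms. set ms \<subseteq> {- int k..0} \<and> length ms \<le> k}"
    by (rule finite_lists_length_le) simp
qed

lemma Lneg_0: "Lneg 0 = {[]}"
proof -
  have "ms = []" if "\<forall>x\<in>set ms. x < 0" "sum_list ms = 0" for ms :: "int list"
    using Lneg_bound[OF that(1)] that(2) by simp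
  then show ?thesis by (auto simp: Lneg_def)
qed

lemma sum_Lneg:
  assumes "k > 0"
  shows "(\<Sum>ms\<in>Lneg k. F ms) = (\<Sum>p\<in>{1..k}. \<Sum>ms\<in>Lneg (k - p). F (- int p # ms))"
proof -
  have "(\<Sum>p\<in>{1..k}. \<Sum>ms\<in>Lneg (k - p). F (- int p # ms)) =
     (\<Sum>(p, ms)\<in>Sigma {1..k} (\<lambda>p. Lneg (k - p)). F (- int p # ms))"
    by (rule sum.Sigma) (auto simp: finite_Lneg)
  also have "\<dots> = (\<Sum>ms\<in>Lneg k. F ms)"
  proof (rule sum.reindex_bij_witness[where i = "\<lambda>ms. (nat (- hd ms), tl ms)" and j = "\<lambda>(p, ms). - int p # ms"])
    fix ms assume ms: "ms \<in> Lneg k"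
    then obtain x xs where x: "ms = x # xs" using assms by (cases ms) (auto simp: Lneg_def)
    then have "x < 0" "x + sum_list xs = - int k" "\<forall>y\<in>set xs. y < 0" using ms by (auto simp: Lneg_def)
    moreover from this have "sum_list xs \<le> 0" using Lneg_bound[of xs] by simp
    ultimately show "(nat (- hd ms), tl ms) \<in> Sigma {1..k} (\<lambda>p. Lneg (k - p))"
      "(case (nat (- hd ms), tl ms) of (p, ms) \<Rightarrow> - int p # ms) = ms"
      using x by (auto simp: Lneg_def of_nat_diff nat_le_iff)
  qed (auto simp: Lneg_def of_nat_diff)
  finally show ?thesis by simp
qed

lemma wscale_btil: "wscale f (btil g i w) = btil g i (wscale f w)"
  by (auto simp: btil_def wmul_comm lin_W_simps wscale_wscale mult.commute)

lemma fold_btil_comm: "fold (btil g) ms (btil g i w) = btil g i (fold (btil g) ms w)"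
  by (induction ms arbitrary: w) (auto simp: btil_comm[of g _ i])

text \<open>The recursion unrolls to the geometric series of the inverse around its zero mode: a
  list of length l contributes (-1)^l (\<gamma>\<tau>+\<delta>)^(-1-l).\<close>

lemma bet_eq_sum:
  assumes "gam g \<noteq> 0"
  shows "bet g k w = (\<Sum>ms\<in>Lneg k. (- 1) ^ length ms *\<^sub>R wscale (U g (- 1 - int (length ms))) (fold (btil g) ms w))"
proof (induction k rule: less_induct)
  case (less k)
  interpret heis_inv "atil g" "btil g" "wscale (U g (- 1))" by (rule heis_inv_W[OF assms])
  show ?case
  proof (cases "k = 0")
    case True
    then show ?thesis by (simp add: bet_def beta_0 Lneg_0)
  next
    case False
    let ?t = "\<lambda>ms. (- 1) ^ length ms *\<^sub>R wscale (U g (- 1 - int (length ms))) (fold (btil g) ms w)"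
    have step: "?t (- int p # ms) = - wscale (U g (- 1)) (btil g (- int p) (?t ms))" for p ms
    proof -
      have "- 1 - int (length (- int p # ms)) = - 1 + (- 1 - int (length ms))" by simp
      then have "U g (- 1 - int (length (- int p # ms))) = U g (- 1) * U g (- 1 - int (length ms))"
        by (simp only: U_add[OF assms])
      then show ?thesis
        by (simp add: fold_btil_comm wscale_btil wscale_wscale[symmetric] linear_scale[OF linear_btil] lin_W_simps)
    qed
    have "bet g k w = - wscale (U g (- 1)) (\<Sum>p\<in>{1..k}. btil g (- int p) (bet g (k - p) w))"
      unfolding bet_def using False by (subst beta.simps) simp
    also have "(\<Sum>p\<in>{1..k}. btil g (- int p) (bet g (k - p) w)) =
       (\<Sum>p\<in>{1..k}. \<Sum>ms\<in>Lneg (k - p). btil g (- int p) (?t ms))"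
      using less False by (intro sum.cong refl) (subst less, auto simp: linear_sum[OF linear_btil])
    also have "- wscale (U g (- 1)) \<dots> = (\<Sum>p\<in>{1..k}. \<Sum>ms\<in>Lneg (k - p). ?t (- int p # ms))"
      unfolding step by (simp only: linear_sum[OF linear_W(6)] sum_negf)
    also have "\<dots> = (\<Sum>ms\<in>Lneg k. ?t ms)" using False by (intro sum_Lneg[symmetric]) simp
    finally show ?thesis .
  qed
qed

text \<open>From g\<tau> = \<alpha>/\<gamma> - 1/(\<gamma>(\<gamma>\<tau>+\<delta>)): the constant
  \<alpha>/\<gamma> affects mode 0 only, so for k > 0 the mode is a multiple of that of the inverse
  field.\<close>

lemma rel_Bmode:
  assumes "rel s w" "gam g \<noteq> 0" "sl2R g" "vacW g w" "k > 0"
  shows "rel (Bmode g (- int k) s) ((- 1 / gam g) *\<^sub>R bet g k w)"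
proof (rule relI)
  fix l u :: "nat multiset" and \<tau> assume t: "Im \<tau> > 0"
  let ?m = "(l, u)"
  interpret heis "atil g" "btil g" by (rule heis_W[OF assms(2)])
  define c where "c = complex_of_real (gam g)"
  have c0: "c \<noteq> 0" using assms(2) by (simp add: c_def)
  have v: "btil g i w = 0" if "i > 0" for i using assms(4) that by (simp add: vacW_def vac_def)
  have f0: "fold (btil g) ms w = 0" if "x \<in> set ms" "x > 0" for ms x
  proof -
    from that obtain xs ys where "ms = xs @ x # ys" by (meson split_list)
    moreover have "btil g x (fold (btil g) xs w) = 0"
      using fold_btil_comm[of g xs x w] v[OF that(2)] by (simp add: linear_0[OF linear_fold[OF linear_btil]])
    ultimately show ?thesis by (simp add: linear_0[OF linear_fold[OF linear_btil]])
  qed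
  have "Bmode g (- int k) s ?m \<tau> = (\<Sum>ms\<in>Lneg k. ((deriv ^^ length ms) (mob g) \<tau> / fact (length ms)) *
     ((1 / of_real (gam g)) ^ length ms * hv (lookup (fold (btil g) ms w) ?m) \<tau>))"
    unfolding Bmode_def
  proof (rule Yf_finite[OF assms(1,2) t finite_Lneg])
    show "Lneg k \<subseteq> {ms. 0 \<notin> set ms \<and> sum_list ms = - int k}" by (auto simp: Lneg_def)
    fix ms :: "int list" assume "0 \<notin> set ms" "sum_list ms = - int k" "ms \<notin> Lneg k"
    then obtain x where "x \<in> set ms" "\<not> x < 0" "x \<noteq> 0" unfolding Lneg_def by blast
    then have "x \<in> set ms" "x > 0" by auto
    then show "(deriv ^^ length ms) (mob g) \<tau> = 0 \<or> fold (btil g) ms w = 0" using f0 by blast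
  qed
  also have "\<dots> = (\<Sum>ms\<in>Lneg k. (- 1 / c) * ((- 1) ^ length ms * (den g \<tau> powi (- 1 - int (length ms)) *
      hv (lookup (fold (btil g) ms w) ?m) \<tau>)))"
  proof (rule sum.cong[OF refl])
    fix ms assume "ms \<in> Lneg k"
    \<comment> \<open>Since k > 0 the list is nonempty, so only derivatives of positive order occur
      and the closed formula for them applies.\<close>
    then obtain i where i: "length ms = Suc i" using assms(5) by (cases ms) (auto simp: Lneg_def)
    have nz: "den g \<tau> \<noteq> 0" using den_nz[OF assms(2) t] .
    have "den g \<tau> powi (- 1 - int (length ms)) = 1 / den g \<tau> ^ (i + 2)"
      using nz i by (simp add: power_int_def nat_add_distrib inverse_eq_divide power_divide eval_nat_numeral)
    then show "((deriv ^^ length ms) (mob g) \<tau> / fact (length ms)) *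
     ((1 / of_real (gam g)) ^ length ms * hv (lookup (fold (btil g) ms w) ?m) \<tau>) =
     (- 1 / c) * ((- 1) ^ length ms * (den g \<tau> powi (- 1 - int (length ms)) * hv (lookup (fold (btil g) ms w) ?m) \<tau>))"
      unfolding i mob_deriv_higher[OF assms(3,2) t] c_def[symmetric]
      using c0 by (simp add: power_divide)
  qed
  also have "\<dots> = hv (lookup ((- 1 / gam g) *\<^sub>R bet g k w) ?m) \<tau>"
    unfolding bet_eq_sum[OF assms(2)] using t assms(2)
    by (simp add: lookup_sum' hv_sum sum_distrib_left hv_U c_def mult.assoc sum_negf)
  finally show "Bmode g (- int k) s ?m \<tau> = hv (lookup ((- 1 / gam g) *\<^sub>R bet g k w) ?m) \<tau>" .
qed

section \<open>Filtration by level and order of jets\<close>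

abbreviation single :: "'a \<Rightarrow> 'b \<Rightarrow> 'a \<Rightarrow>\<^sub>0 'b::zero" where "single \<equiv> Poly_Mapping.single"

lemma lookup_single': "lookup (single m f) m' = (if m = m' then f else 0)"
  by (simp add: lookup_single when_def)

definition good :: "mat2 \<Rightarrow> bool" where "good g \<longleftrightarrow> sl2R g \<and> gam g \<noteq> 0"

definition lev :: "mono \<Rightarrow> int" where "lev m = int (size (snd m)) - int (size (fst m))"

text \<open>The exponents are tied to level and jet order so that each rescaled mode maps such
  elements to combinations of such elements with coefficients free of g. The weight \<open>d\<close>
  goes up by one under a b mode and down by one under an a mode or division by
  \<gamma>\<tau>+\<delta>.\<close>

definition el :: "int \<Rightarrow> mat2 \<Rightarrow> hol \<Rightarrow> mono \<times> nat \<Rightarrow> W" where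
  "el d g \<phi> = (\<lambda>(m, k). single m ((gam g powi (lev m - int k)) *\<^sub>R
     (U g (d - lev m - int k) * hcomp g ((hD ^^ k) \<phi>))))"

text \<open>
  \<open>J d r T\<close>: \<open>T\<close> is a combination, with constants independent of $g$ and $\varphi$, of monomials of level \<open>n\<close>
  whose coefficients are $\gamma^{n-k} (\gamma\tau+\delta)^{d-n-k} \varphi^{(k)}(g\tau)$ with $n - k \ge r$.\<close>

definition J :: "int \<Rightarrow> int \<Rightarrow> (mat2 \<Rightarrow> hol \<Rightarrow> W) \<Rightarrow> bool" where
  "J d r T \<longleftrightarrow> (\<exists>S c. finite S \<and> (\<forall>(m, k)\<in>S. is_pp m \<and> lev m - int k \<ge> r) \<and>
     (\<forall>g \<phi>. good g \<longrightarrow> T g \<phi> = (\<Sum>x\<in>S. wscale (hc (c x)) (el d g \<phi> x))))"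

lemma J_cong:
  assumes "J d r T" "\<And>g \<phi>. good g \<Longrightarrow> T' g \<phi> = T g \<phi>"
  shows "J d r T'"
proof -
  obtain S c where "finite S" "\<forall>(m, k)\<in>S. is_pp m \<and> lev m - int k \<ge> r"
     "\<forall>g \<phi>. good g \<longrightarrow> T g \<phi> = (\<Sum>x\<in>S. wscale (hc (c x)) (el d g \<phi> x))"
    using assms(1) unfolding J_def by blast
  then show ?thesis unfolding J_def using assms(2) by (intro exI[of _ S] exI[of _ c]) simp
qed

lemma J_zero: "J d r (\<lambda>g \<phi>. 0)"
  unfolding J_def by (rule exI[of _ "{}"]) auto

lemma wscale_0 [simp]: "wscale 0 w = 0" by (rule W_eqI) simp

lemma wscale_add: "wscale (f + f') w = wscale f w + wscale f' w"
  by (rule W_eqI) (simp add: lookup_add algebra_simps)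

lemma J_add:
  assumes "J d r T" "J d r T'"
  shows "J d r (\<lambda>g \<phi>. T g \<phi> + T' g \<phi>)"
proof -
  obtain S c where S: "finite S" "\<forall>(m, k)\<in>S. is_pp m \<and> lev m - int k \<ge> r"
     "\<And>g \<phi>. good g \<Longrightarrow> T g \<phi> = (\<Sum>x\<in>S. wscale (hc (c x)) (el d g \<phi> x))"
    using assms(1) unfolding J_def by blast
  obtain S' c' where S': "finite S'" "\<forall>(m, k)\<in>S'. is_pp m \<and> lev m - int k \<ge> r"
     "\<And>g \<phi>. good g \<Longrightarrow> T' g \<phi> = (\<Sum>x\<in>S'. wscale (hc (c' x)) (el d g \<phi> x))"
    using assms(2) unfolding J_def by blast
  define C where "C x = (if x \<in> S then c x else 0) + (if x \<in> S' then c' x else 0)" for x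
  have "T g \<phi> + T' g \<phi> = (\<Sum>x\<in>S \<union> S'. wscale (hc (C x)) (el d g \<phi> x))" if "good g" for g \<phi>
  proof -
    have "T g \<phi> = (\<Sum>x\<in>S \<union> S'. wscale (hc (if x \<in> S then c x else 0)) (el d g \<phi> x))"
      unfolding S(3)[OF that] by (rule sum.mono_neutral_cong_left) (use S S' in \<open>auto simp: hc_simps\<close>)
    moreover have "T' g \<phi> = (\<Sum>x\<in>S \<union> S'. wscale (hc (if x \<in> S' then c' x else 0)) (el d g \<phi> x))"
      unfolding S'(3)[OF that] by (rule sum.mono_neutral_cong_left) (use S S' in \<open>auto simp: hc_simps\<close>)
    ultimately show ?thesis unfolding C_def hc_simps wscale_add sum.distrib by simp
  qed
  then show ?thesis unfolding J_def using S S' by (intro exI[of _ "S \<union> S'"] exI[of _ C]) auto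
qed

lemma J_scale: "J d r T \<Longrightarrow> J d r (\<lambda>g \<phi>. wscale (hc z) (T g \<phi>))"
  unfolding J_def
proof (elim exE conjE)
  fix S c assume S: "finite S" "\<forall>(m, k)\<in>S. is_pp m \<and> lev m - int k \<ge> r"
     "\<forall>g \<phi>. good g \<longrightarrow> T g \<phi> = (\<Sum>x\<in>S. wscale (hc (c x)) (el d g \<phi> x))"
  then show "\<exists>S c. finite S \<and> (\<forall>(m, k)\<in>S. is_pp m \<and> r \<le> lev m - int k) \<and>
     (\<forall>g \<phi>. good g \<longrightarrow> wscale (hc z) (T g \<phi>) = (\<Sum>x\<in>S. wscale (hc (c x)) (el d g \<phi> x)))"
    by (intro exI[of _ S] exI[of _ "\<lambda>x. z * c x"])
       (auto simp: linear_sum[OF linear_W(6)] wscale_wscale hc_simps)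
qed

lemma wscale_of_real: "wscale (hc (of_real r)) w = r *\<^sub>R w"
  by (rule W_eqI) (simp add: scaleR_hc)

lemma J_scaleR: "J d r T \<Longrightarrow> J d r (\<lambda>g \<phi>. x *\<^sub>R T g \<phi>)"
  using J_scale[of d r T "of_real x"] by (simp only: wscale_of_real)

lemma J_neg: "J d r T \<Longrightarrow> J d r (\<lambda>g \<phi>. - T g \<phi>)"
  using J_scaleR[of d r T "- 1"] by simp

lemma J_diff: "J d r T \<Longrightarrow> J d r T' \<Longrightarrow> J d r (\<lambda>g \<phi>. T g \<phi> - T' g \<phi>)"
  using J_add[OF _ J_neg, of d r T T'] by simp

lemma J_sum: "(\<And>i. i \<in> I \<Longrightarrow> J d r (T i)) \<Longrightarrow> J d r (\<lambda>g \<phi>. \<Sum>i\<in>I. T i g \<phi>)"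
  by (induction I rule: infinite_finite_induct) (auto intro: J_zero J_add)

lemma J_mono:
  assumes "J d r T" "r' \<le> r"
  shows "J d r' T"
proof -
  obtain S c where S: "finite S" "\<forall>(m, k)\<in>S. is_pp m \<and> lev m - int k \<ge> r"
     "\<forall>g \<phi>. good g \<longrightarrow> T g \<phi> = (\<Sum>x\<in>S. wscale (hc (c x)) (el d g \<phi> x))"
    using assms(1) unfolding J_def by blast
  then have "\<forall>(m, k)\<in>S. is_pp m \<and> lev m - int k \<ge> r'" using assms(2) by auto
  then show ?thesis unfolding J_def using S by (intro exI[of _ S] exI[of _ c]) simp
qed

lemma J_eq: "J d r T \<Longrightarrow> d = d' \<Longrightarrow> r = r' \<Longrightarrow> J d' r' T"
  by simp

lemma J_el: "is_pp m \<Longrightarrow> lev m - int k \<ge> r \<Longrightarrow> J d r (\<lambda>g \<phi>. el d g \<phi> (m, k))"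
  unfolding J_def
  by (intro exI[of _ "{(m, k)}"] exI[of _ "\<lambda>_. 1"]) (simp add: hc_simps wscale_1)

lemma J_op:
  assumes "J d r T" "\<And>g. good g \<Longrightarrow> linear (f g)"
    "\<And>g z w. good g \<Longrightarrow> f g (wscale (hc z) w) = wscale (hc z) (f g w)"
    "\<And>m k. is_pp m \<Longrightarrow> lev m - int k \<ge> r \<Longrightarrow> J d' r' (\<lambda>g \<phi>. f g (el d g \<phi> (m, k)))"
  shows "J d' r' (\<lambda>g \<phi>. f g (T g \<phi>))"
proof -
  obtain S c where S: "finite S" "\<forall>(m, k)\<in>S. is_pp m \<and> lev m - int k \<ge> r"
     "\<And>g \<phi>. good g \<Longrightarrow> T g \<phi> = (\<Sum>x\<in>S. wscale (hc (c x)) (el d g \<phi> x))"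
    using assms(1) unfolding J_def by blast
  have "J d' r' (\<lambda>g \<phi>. \<Sum>x\<in>S. wscale (hc (c x)) (f g (el d g \<phi> x)))"
  proof (intro J_sum J_scale)
    fix x assume "x \<in> S"
    then show "J d' r' (\<lambda>g \<phi>. f g (el d g \<phi> x))" using S(2) assms(4) by (cases x) auto
  qed
  then show ?thesis
    by (rule J_cong) (simp add: S(3) linear_sum[OF assms(2)] assms(3))
qed

section \<open>Rescaled modes on single monomials\<close>

lemma single_wbpos:
  "wbpos k (single (l, u) f) = (if k \<in># l then single (l - {#k#}, u) (- real (count l k) *\<^sub>R f) else 0)"
proof (cases "k \<in># l")
  case True
  then obtain l0 where "l = add_mset k l0" by (metis multi_member_split)
  then show ?thesis by (intro W_eqI) (auto simp: lookup_single')
next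
  case False
  then show ?thesis by (intro W_eqI) (auto simp: lookup_single')
qed

lemma single_wapos:
  "wapos k (single (l, u) f) = (if k \<in># u then single (l, u - {#k#}) (real (count u k) *\<^sub>R f) else 0)"
proof (cases "k \<in># u")
  case True
  then obtain u0 where "u = add_mset k u0" by (metis multi_member_split)
  then show ?thesis by (intro W_eqI) (auto simp: lookup_single')
next
  case False
  then show ?thesis by (intro W_eqI) (auto simp: lookup_single')
qed

lemma single_wmul:
  "wbmul k (single (l, u) f) = single (l, add_mset k u) f"
  "wamul k (single (l, u) f) = single (add_mset k l, u) f"
  by (rule W_eqI; auto simp: lookup_single' dest!: multi_member_split)+

lemma single_wscale: "wscale f' (single m f) = single m (f' * f)" and single_wD: "wD (single m f) = single m (hD f)"
  by (rule W_eqI; auto simp: lookup_single')+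

lemmas single_W = single_wmul single_wbpos single_wapos single_wscale single_wD

lemma scaleR_single: "r *\<^sub>R single m f = single m (r *\<^sub>R f)"
  by (rule poly_mapping_eqI) (simp add: lookup_single')

lemma goodD: "good g \<Longrightarrow> gam g \<noteq> 0" "good g \<Longrightarrow> sl2R g" by (auto simp: good_def)

definition elc :: "int \<Rightarrow> mat2 \<Rightarrow> hol \<Rightarrow> int \<Rightarrow> nat \<Rightarrow> hol" where
  "elc d g \<phi> n k = (gam g powi (n - int k)) *\<^sub>R (U g (d - n - int k) * hcomp g ((hD ^^ k) \<phi>))"

lemma el_elc: "el d g \<phi> (m, k) = single m (elc d g \<phi> (lev m) k)"
  by (simp add: el_def elc_def)

lemma elc_up: "gam g \<noteq> 0 \<Longrightarrow> gam g *\<^sub>R elc d g \<phi> n k = elc (d + 1) g \<phi> (n + 1) k"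
proof -
  assume g: "gam g \<noteq> 0"
  have "n + 1 - int k = n - int k + 1" "d + 1 - (n + 1) - int k = d - n - int k" by simp_all
  moreover have "gam g powi (n - int k + 1) = gam g * gam g powi (n - int k)"
    using g by (simp add: power_int_add_1 mult.commute)
  ultimately show ?thesis unfolding elc_def by (simp only: diff_add_eq scaleR_scaleR)
qed

lemma elc_down: "gam g \<noteq> 0 \<Longrightarrow> (1 / gam g) *\<^sub>R elc d g \<phi> n k = elc (d - 1) g \<phi> (n - 1) k"
  using elc_up[of g "d - 1" \<phi> "n - 1" k, symmetric] by simp

lemma el_bneg:
  assumes "good g" "i < 0"
  shows "btil g i (el d g \<phi> ((l, u), k)) = el (d + 1) g \<phi> ((l, add_mset (nat (- i)) u), k)"
proof -
  have "lev (l, add_mset (nat (- i)) u) = lev (l, u) + 1" by (simp add: lev_def)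
  then show ?thesis using assms goodD[OF assms(1)]
    by (simp add: btil_def el_elc single_W scaleR_single elc_up)
qed

lemma el_b0:
  assumes "good g"
  shows "btil g 0 (el d g \<phi> (m, k)) = el (d + 1) g \<phi> (m, k)"
proof -
  have "d + 1 - lev m - int k = 1 + (d - lev m - int k)" by simp
  then have "U g (d + 1 - lev m - int k) = U g 1 * U g (d - lev m - int k)"
    by (simp only: U_add[OF goodD(1)[OF assms]])
  then show ?thesis by (simp add: btil_def el_def single_W mult_scaleR_hol mult.assoc)
qed

lemma el_bpos:
  assumes "good g" "i > 0"
  shows "btil g i (el d g \<phi> ((l, u), k)) =
    (if nat i \<in># l then - real (count l (nat i)) *\<^sub>R el (d + 1) g \<phi> ((l - {#nat i#}, u), k) else 0)"
proof (cases "nat i \<in># l")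
  case True
  then have lv: "lev (l - {#nat i#}, u) = lev (l, u) + 1" by (auto simp: lev_def dest!: multi_member_split)
  have "btil g i (el d g \<phi> ((l, u), k)) = single (l - {#nat i#}, u)
      (- real (count l (nat i)) *\<^sub>R (gam g *\<^sub>R elc d g \<phi> (lev (l, u)) k))"
    using assms True by (simp add: btil_def el_elc single_W scaleR_single mult.commute)
  then show ?thesis using True
    by (simp only: elc_up[OF goodD(1)[OF assms(1)]] el_elc lv scaleR_single if_True)
next
  case False
  then show ?thesis using assms by (simp add: btil_def el_def single_W)
qed

lemma el_aneg:
  assumes "good g" "i < 0"
  shows "atil g i (el d g \<phi> ((l, u), k)) = el (d - 1) g \<phi> ((add_mset (nat (- i)) l, u), k)"
proof -
  have "lev (add_mset (nat (- i)) l, u) = lev (l, u) - 1" by (simp add: lev_def)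
  then show ?thesis using assms goodD[OF assms(1)] elc_down[of g d \<phi> "lev (l, u)" k]
    by (simp add: atil_def aW_def el_elc single_W scaleR_single)
qed

lemma el_apos:
  assumes "good g" "i > 0"
  shows "atil g i (el d g \<phi> ((l, u), k)) =
    (if nat i \<in># u then real (count u (nat i)) *\<^sub>R el (d - 1) g \<phi> ((l, u - {#nat i#}), k) else 0)"
proof (cases "nat i \<in># u")
  case True
  then have lv: "lev (l, u - {#nat i#}) = lev (l, u) - 1" by (auto simp: lev_def dest!: multi_member_split)
  have "atil g i (el d g \<phi> ((l, u), k)) = single (l, u - {#nat i#})
      (real (count u (nat i)) *\<^sub>R ((1 / gam g) *\<^sub>R elc d g \<phi> (lev (l, u)) k))"
    using assms True by (simp add: atil_def aW_def el_elc single_W scaleR_single mult.commute)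
  then show ?thesis using True
    by (simp only: elc_down[OF goodD(1)[OF assms(1)]] el_elc lv scaleR_single if_True)
next
  case False
  then show ?thesis using assms by (simp add: atil_def aW_def el_def single_W)
qed

text \<open>The derivative either raises the jet, where the chain rule costs
  (\<gamma>\<tau>+\<delta>)^(-2), or hits the power of \<gamma>\<tau>+\<delta>. Only the first term
  lowers n - k.\<close>

lemma hD_elc:
  assumes "good g"
  shows "(1 / gam g) *\<^sub>R hD (elc d g \<phi> n k) = elc (d - 1) g \<phi> n (Suc k) +
     real_of_int (d - n - int k) *\<^sub>R elc (d - 1) g \<phi> n k"
proof -
  note g = goodD[OF assms]
  define e where "e = d - n - int k"
  define f where "f = hcomp g ((hD ^^ k) \<phi>)"
  define f' where "f' = hcomp g ((hD ^^ Suc k) \<phi>)"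
  have "U g (e - 2) = U g e * U g (- 2)" using U_add[OF g(1), of e "- 2"] by simp
  then have 1: "hD (U g e * f) = (of_int e * gam g) *\<^sub>R (U g (e - 1) * f) + U g (e - 2) * f'"
    by (simp add: hD_mult hD_U[OF g(1)] f_def f'_def hD_hcomp[OF g(2,1)] mult.assoc scaleR_hc)
  have 2: "gam g powi (n - int k) = gam g * gam g powi (n - int (Suc k))"
    using power_int_add_1'[of "gam g" "n - int (Suc k)"] g(1) by simp
  have i1: "d - 1 - n - int k = e - 1" and i2: "d - 1 - n - int (Suc k) = e - 2" by (simp_all add: e_def)
  have "(1 / gam g) *\<^sub>R hD (elc d g \<phi> n k) =
      (1 / gam g * gam g powi (n - int k)) *\<^sub>R ((of_int e * gam g) *\<^sub>R (U g (e - 1) * f) + U g (e - 2) * f')"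
    unfolding elc_def e_def[symmetric] f_def[symmetric] by (simp add: 1)
  also have "\<dots> = of_int e *\<^sub>R ((gam g powi (n - int k)) *\<^sub>R (U g (e - 1) * f)) +
      (gam g powi (n - int (Suc k))) *\<^sub>R (U g (e - 2) * f')"
    unfolding scaleR_add_right scaleR_scaleR using g(1) by (simp add: 2)
  finally show ?thesis
    unfolding elc_def i1 i2 f_def[symmetric] f'_def[symmetric] e_def[symmetric] by (simp only: add.commute)
qed

lemma el_a0:
  assumes "good g"
  shows "atil g 0 (el d g \<phi> (m, k)) = el (d - 1) g \<phi> (m, Suc k) +
     real_of_int (d - lev m - int k) *\<^sub>R el (d - 1) g \<phi> (m, k)"
  unfolding atil_def aW_def el_elc
  by (simp add: single_W scaleR_single hD_elc[OF assms] single_add)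

lemma el_v:
  assumes "good g"
  shows "wscale (U g (- 1)) (el d g \<phi> (m, k)) = el (d - 1) g \<phi> (m, k)"
proof -
  have "d - 1 - lev m - int k = - 1 + (d - lev m - int k)" by simp
  then have "U g (d - 1 - lev m - int k) = U g (- 1) * U g (d - lev m - int k)"
    by (simp only: U_add[OF goodD(1)[OF assms]])
  then show ?thesis by (simp add: el_def single_W mult_scaleR_hol mult.assoc)
qed

lemma wscale_hc_atil: "atil g i (wscale (hc z) w) = wscale (hc z) (atil g i w)"
  by (rule linorder_cases[of i 0]; simp add: atil_def aW_def wmul_comm[symmetric] lin_W_simps wD_wscale)

lemma pp_diff: "is_pp (l, u) \<Longrightarrow> is_pp (l - {#k#}, u)" "is_pp (l, u) \<Longrightarrow> is_pp (l, u - {#k#})"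
  by (auto simp: is_pp_def dest: in_diffD)

lemma pp_add: "is_pp (l, u) \<Longrightarrow> k > 0 \<Longrightarrow> is_pp (add_mset k l, u)" "is_pp (l, u) \<Longrightarrow> k > 0 \<Longrightarrow> is_pp (l, add_mset k u)"
  by (auto simp: is_pp_def)

lemma J_b0:
  assumes "J d r T" shows "J (d + 1) r (\<lambda>g \<phi>. btil g 0 (T g \<phi>))"
proof (rule J_op[where f = "\<lambda>g. btil g 0", OF assms])
  show "J (d + 1) r (\<lambda>g \<phi>. btil g 0 (el d g \<phi> (m, k)))" if "is_pp m" "r \<le> lev m - int k" for m k
    by (rule J_cong[OF J_el[OF that]]) (simp add: el_b0)
qed (simp_all add: linear_btil wscale_btil)

text \<open>Every nonzero b mode raises the level, by creating a b part or removing an a part, and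
  leaves the jet order alone.\<close>

lemma J_b:
  assumes "J d r T" "i \<noteq> 0"
  shows "J (d + 1) (r + 1) (\<lambda>g \<phi>. btil g i (T g \<phi>))"
proof (rule J_op[where f = "\<lambda>g. btil g i", OF assms(1)])
  fix m k assume m: "is_pp m" "r \<le> lev m - int k"
  obtain l u where lu: "m = (l, u)" by (cases m)
  show "J (d + 1) (r + 1) (\<lambda>g \<phi>. btil g i (el d g \<phi> (m, k)))"
  proof (cases "i < 0")
    case True
    have "J (d + 1) (r + 1) (\<lambda>g \<phi>. el (d + 1) g \<phi> ((l, add_mset (nat (- i)) u), k))"
      by (rule J_el) (use m lu True in \<open>auto intro!: pp_add simp: lev_def\<close>)
    then show ?thesis by (rule J_cong) (use True lu el_bneg in simp)
  next
    case False
    then have i: "i > 0" using assms by simp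
    show ?thesis
    proof (cases "nat i \<in># l")
      case True
      then have "lev (l - {#nat i#}, u) = lev (l, u) + 1" by (auto simp: lev_def dest!: multi_member_split)
      then have "J (d + 1) (r + 1) (\<lambda>g \<phi>. - real (count l (nat i)) *\<^sub>R el (d + 1) g \<phi> ((l - {#nat i#}, u), k))"
        using m lu by (intro J_scaleR J_el) (auto intro!: pp_diff)
      then show ?thesis by (rule J_cong) (use True lu i el_bpos in simp)
    next
      case False
      show ?thesis by (rule J_cong[OF J_zero]) (use False lu i el_bpos in simp)
    qed
  qed
qed (simp_all add: linear_btil wscale_btil)

text \<open>A nonzero a mode lowers the level by one and \<open>a_0\<close> raises the jet order by
  at most one, so n - k drops by at most one in either case.\<close>

lemma J_a:
  assumes "J d r T"
  shows "J (d - 1) (r - 1) (\<lambda>g \<phi>. atil g i (T g \<phi>))"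
proof (rule J_op[where f = "\<lambda>g. atil g i", OF assms(1)])
  fix m k assume m: "is_pp m" "r \<le> lev m - int k"
  obtain l u where lu: "m = (l, u)" by (cases m)
  show "J (d - 1) (r - 1) (\<lambda>g \<phi>. atil g i (el d g \<phi> (m, k)))"
  proof (rule linorder_cases[of i 0])
    assume i: "i < 0"
    have "J (d - 1) (r - 1) (\<lambda>g \<phi>. el (d - 1) g \<phi> ((add_mset (nat (- i)) l, u), k))"
      by (rule J_el) (use m lu i in \<open>auto intro!: pp_add simp: lev_def\<close>)
    then show ?thesis by (rule J_cong) (use i lu el_aneg in simp)
  next
    assume i: "i = 0"
    have "J (d - 1) (r - 1) (\<lambda>g \<phi>. el (d - 1) g \<phi> (m, Suc k) +
        real_of_int (d - lev m - int k) *\<^sub>R el (d - 1) g \<phi> (m, k))"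
      by (intro J_add J_scaleR J_el) (use m in auto)
    then show ?thesis by (rule J_cong) (use i el_a0 in simp)
  next
    assume i: "i > 0"
    show ?thesis
    proof (cases "nat i \<in># u")
      case True
      then have "lev (l, u - {#nat i#}) = lev (l, u) - 1" by (auto simp: lev_def dest!: multi_member_split)
      then have "J (d - 1) (r - 1) (\<lambda>g \<phi>. real (count u (nat i)) *\<^sub>R el (d - 1) g \<phi> ((l, u - {#nat i#}), k))"
        using m lu by (intro J_scaleR J_el) (auto intro!: pp_diff)
      then show ?thesis by (rule J_cong) (use True lu i el_apos in simp)
    next
      case False
      show ?thesis by (rule J_cong[OF J_zero]) (use False lu i el_apos in simp)
    qed
  qed
qed (simp_all add: linear_atil wscale_hc_atil)

lemma J_v:
  assumes "J d r T" shows "J (d - 1) r (\<lambda>g \<phi>. wscale (U g (- 1)) (T g \<phi>))"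
proof (rule J_op[where f = "\<lambda>g. wscale (U g (- 1))", OF assms])
  show "J (d - 1) r (\<lambda>g \<phi>. wscale (U g (- 1)) (el d g \<phi> (m, k)))" if "is_pp m" "r \<le> lev m - int k" for m k
    by (rule J_cong[OF J_el[OF that]]) (simp add: el_v)
qed (simp_all add: linear_W wscale_wscale mult.commute)

text \<open>The finite index set in \<open>J\<close> does not depend on g or \<phi>, so one bound
  truncates all mode sums at once. This keeps infinite sums of modes within \<open>J\<close>, where
  the finite combination must be fixed beforehand.\<close>

lemma J_uniform:
  assumes "J d r T"
  obtains N :: int where "N \<ge> 0" "\<And>g \<phi>. good g \<Longrightarrow> \<forall>i>N. atil g i (T g \<phi>) = 0"
    "\<And>g \<phi>. good g \<Longrightarrow> \<forall>i>N. btil g i (T g \<phi>) = 0"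
proof -
  obtain S c where S: "finite S" "\<forall>(m, k)\<in>S. is_pp m \<and> lev m - int k \<ge> r"
     "\<And>g \<phi>. good g \<Longrightarrow> T g \<phi> = (\<Sum>x\<in>S. wscale (hc (c x)) (el d g \<phi> x))"
    using assms(1) unfolding J_def by blast
  define P where "P = (\<Union>x\<in>S. set_mset (fst (fst x)) \<union> set_mset (snd (fst x)))"
  have fP: "finite P" using S(1) by (auto simp: P_def)
  define N where "N = int (Max (insert 0 P))"
  have z: "atil g i (T g \<phi>) = 0 \<and> btil g i (T g \<phi>) = 0" if g: "good g" and "i > N" for g \<phi> i
  proof -
    have i0: "i > 0" using that by (simp add: N_def)
    have nP: "nat i \<notin> P"
    proof
      assume "nat i \<in> P"
      then have "nat i \<le> Max (insert 0 P)" using fP by (intro Max_ge) auto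
      then show False using that by (simp add: N_def)
    qed
    have "atil g i (el d g \<phi> x) = 0 \<and> btil g i (el d g \<phi> x) = 0" if "x \<in> S" for x
    proof -
      obtain l u k where x: "x = ((l, u), k)" by (metis prod.exhaust)
      have "nat i \<notin># l" "nat i \<notin># u" using nP that x unfolding P_def by fastforce+
      then show ?thesis unfolding x by (simp add: el_apos[OF g i0] el_bpos[OF g i0])
    qed
    then show ?thesis unfolding S(3)[OF g]
      by (simp add: linear_sum[OF linear_atil] linear_sum[OF linear_btil] wscale_hc_atil wscale_btil[symmetric]
          linear_0[OF linear_W(6)])
  qed
  show ?thesis by (rule that[of N]) (use z in \<open>auto simp: N_def\<close>)
qed

lemma J_bb:
  assumes "J d r T"
  shows "n \<noteq> 0 \<Longrightarrow> J (d + 2) (r + 1) (\<lambda>g \<phi>. bbt g n (T g \<phi>))"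
    "J (d + 2) (r + 2) (\<lambda>g \<phi>. bbt g 0 (T g \<phi>) - btil g 0 (btil g 0 (T g \<phi>)))"
proof -
  obtain N where N: "N \<ge> 0" "\<And>g \<phi>. good g \<Longrightarrow> \<forall>i>N. btil g i (T g \<phi>) = 0"
    using J_uniform[OF assms] by metis
  have bb: "bbt g n (T g \<phi>) = (\<Sum>p\<in>{n - N..N}. btil g p (btil g (n - p) (T g \<phi>)))" if "good g" for g \<phi> n
  proof -
    interpret heis "atil g" "btil g" by (rule heis_W) (use that goodD in auto)
    show ?thesis unfolding bbt_def by (rule bb_eq_sum[OF N(2)[OF that]])
  qed
  have two: "J (d + 2) (r + 2) (\<lambda>g \<phi>. btil g p (btil g q (T g \<phi>)))" if "p \<noteq> 0" "q \<noteq> 0" for p q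
    using J_b[OF J_b[OF assms that(2)] that(1)] by (simp add: add.commute add.left_commute)
  have one: "J (d + 2) (r + 1) (\<lambda>g \<phi>. btil g p (btil g q (T g \<phi>)))" if pq: "p \<noteq> 0 \<or> q \<noteq> 0" for p q
  proof -
    consider "p \<noteq> 0" "q \<noteq> 0" | "p \<noteq> 0" "q = 0" | "p = 0" "q \<noteq> 0" using pq by blast
    then show ?thesis
    proof cases
      case 1
      then show ?thesis by (intro J_mono[OF two]) auto
    next
      case 2
      then show ?thesis using J_b[OF J_b0[OF assms] 2(1)] by (simp add: add.assoc)
    next
      case 3
      then show ?thesis using J_b0[OF J_b[OF assms 3(2)]] by (simp add: add.assoc)
    qed
  qed
  show "J (d + 2) (r + 1) (\<lambda>g \<phi>. bbt g n (T g \<phi>))" if "n \<noteq> 0"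
    by (rule J_cong[OF J_sum[of "{n - N..N}" _ _ "\<lambda>p g \<phi>. btil g p (btil g (n - p) (T g \<phi>))"]])
       (use that in \<open>auto intro!: one simp: bb\<close>)
  have "J (d + 2) (r + 2) (\<lambda>g \<phi>. \<Sum>p\<in>{- N..N} - {0}. btil g p (btil g (- p) (T g \<phi>)))"
    by (intro J_sum two) auto
  then show "J (d + 2) (r + 2) (\<lambda>g \<phi>. bbt g 0 (T g \<phi>) - btil g 0 (btil g 0 (T g \<phi>)))"
    by (rule J_cong) (use N(1) in \<open>simp add: bb sum.remove[of "{- N..N}" 0]\<close>)
qed

text \<open>What is left of the creation mode after removing its leading part, the only summand in
  which a single nonzero mode acts and lowers the level.\<close>

definition Rest :: "mat2 \<Rightarrow> nat \<Rightarrow> W \<Rightarrow> W" where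
  "Rest g j w = At g (- int j) w - btil g 0 (btil g 0 (atil g (- int j) w))"

lemma J_Rest:
  assumes "J d r T" "j > 0"
  shows "J (d + 1) r (\<lambda>g \<phi>. Rest g j (T g \<phi>))"
proof -
  obtain N where N: "N \<ge> 0" "\<And>g \<phi>. good g \<Longrightarrow> \<forall>i>N. atil g i (T g \<phi>) = 0"
     "\<And>g \<phi>. good g \<Longrightarrow> \<forall>i>N. btil g i (T g \<phi>) = 0"
    using J_uniform[OF assms(1)] by metis
  define I where "I = {- int j - 2 * N..N}"
  \<comment> \<open>For i = -j the square of the zero mode is taken out; every other choice of i
    forces a nonzero b mode, which compensates the loss from the a mode.\<close>
  define V where "V i g \<phi> = (if i = - int j then
       atil g i (bbt g 0 (T g \<phi>) - btil g 0 (btil g 0 (T g \<phi>)))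
     else if i < 0 then atil g i (bbt g (- int j - i) (T g \<phi>)) else bbt g (- int j - i) (atil g i (T g \<phi>)))" for i g \<phi>
  have JV: "J (d + 1) r (V i)" for i
  proof (cases "i = - int j")
    case True
    have "J (d + 2 - 1) (r + 2 - 1) (\<lambda>g \<phi>. atil g i (bbt g 0 (T g \<phi>) - btil g 0 (btil g 0 (T g \<phi>))))"
      by (rule J_a[OF J_bb(2)[OF assms(1)]])
    then have "J (d + 2 - 1) r (\<lambda>g \<phi>. atil g i (bbt g 0 (T g \<phi>) - btil g 0 (btil g 0 (T g \<phi>))))"
      by (rule J_mono) simp
    then have "J (d + 1) r (\<lambda>g \<phi>. atil g i (bbt g 0 (T g \<phi>) - btil g 0 (btil g 0 (T g \<phi>))))"
      by (rule J_eq) auto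
    then show ?thesis unfolding V_def using True by simp
  next
    case False
    show ?thesis
    proof (cases "i < 0")
      case neg: True
      have "J (d + 2 - 1) (r + 1 - 1) (\<lambda>g \<phi>. atil g i (bbt g (- int j - i) (T g \<phi>)))"
        using False by (intro J_a J_bb(1) assms) auto
      then have "J (d + 1) r (\<lambda>g \<phi>. atil g i (bbt g (- int j - i) (T g \<phi>)))" by (rule J_eq) auto
      then show ?thesis unfolding V_def using False neg by simp
    next
      case pos: False
      have "J (d - 1 + 2) (r - 1 + 1) (\<lambda>g \<phi>. bbt g (- int j - i) (atil g i (T g \<phi>)))"
        using False by (intro J_a J_bb(1) assms) auto
      then have "J (d + 1) r (\<lambda>g \<phi>. bbt g (- int j - i) (atil g i (T g \<phi>)))" by (rule J_eq) auto
      then show ?thesis unfolding V_def using False pos by simp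
    qed
  qed
  have "J (d + 1) r (\<lambda>g \<phi>. (\<Sum>i\<in>I. V i g \<phi>) + (2 * real j) *\<^sub>R btil g (- int j) (T g \<phi>))"
    using assms(2) by (intro J_add J_sum JV J_scaleR J_mono[OF J_b[OF assms(1)]]) auto
  then show ?thesis
  proof (rule J_cong)
    fix g \<phi> assume g: "good g"
    interpret heis "atil g" "btil g" by (rule heis_W) (use g goodD in auto)
    let ?x = "T g \<phi>"
    have "Sum_any (\<lambda>i. Aterm (- int j) i ?x) = (\<Sum>i\<in>I. Aterm (- int j) i ?x)"
      by (rule Sum_any.expand_superset)
         (use Aterm_support[OF N(1) N(2)[OF g] N(3)[OF g], of "- int j"] N(1) in \<open>auto simp: I_def\<close>)
    also have "\<dots> = (\<Sum>i\<in>I. V i g \<phi> + (if i = - int j then btil g 0 (btil g 0 (atil g i ?x)) else 0))"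
      using assms(2) by (intro sum.cong) (auto simp: Aterm_def V_def bbt_def a_b)
    also have "\<dots> = (\<Sum>i\<in>I. V i g \<phi>) + btil g 0 (btil g 0 (atil g (- int j) ?x))"
      unfolding sum.distrib using N(1) by (simp add: I_def)
    finally show "Rest g j ?x = (\<Sum>i\<in>I. V i g \<phi>) + (2 * real j) *\<^sub>R btil g (- int j) ?x"
      unfolding Rest_def At_def A_def by simp
  qed
qed

section \<open>Leading terms of the transformed modes\<close>

lemma linear_At: "gam g \<noteq> 0 \<Longrightarrow> linear (At g j)"
  unfolding At_def by (rule heis.lin_A[OF heis_W])

text \<open>\<open>JL m k d T\<close>: the part of lowest $n - k$ of \<open>T\<close> is the single term \<open>el d g \<phi> (m, k)\<close>.\<close>

definition JL :: "mono \<Rightarrow> nat \<Rightarrow> int \<Rightarrow> (mat2 \<Rightarrow> hol \<Rightarrow> W) \<Rightarrow> bool" where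
  "JL m k d T \<longleftrightarrow> is_pp m \<and> J d (lev m - int k + 1) (\<lambda>g \<phi>. T g \<phi> - el d g \<phi> (m, k))"

lemma JL_J: "JL m k d T \<Longrightarrow> J d (lev m - int k) T"
proof -
  assume *: "JL m k d T"
  then have "J d (lev m - int k) (\<lambda>g \<phi>. T g \<phi> - el d g \<phi> (m, k))"
    unfolding JL_def by (auto intro: J_mono)
  moreover have "J d (lev m - int k) (\<lambda>g \<phi>. el d g \<phi> (m, k))" using * by (intro J_el) (auto simp: JL_def)
  ultimately have "J d (lev m - int k) (\<lambda>g \<phi>. (T g \<phi> - el d g \<phi> (m, k)) + el d g \<phi> (m, k))" by (rule J_add)
  then show ?thesis by simp
qed

text \<open>The leading part \<open>btil g 0\<close> twice after \<open>atil g (- int j)\<close>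
  just adjoins a_{-j}; by \<open>J_Rest\<close> everything else stays at least one step higher in n
  - k.\<close>

lemma JL_At:
  assumes "JL (l, u) k d T" "j > 0"
  shows "JL (add_mset j l, u) k (d + 1) (\<lambda>g \<phi>. At g (- int j) (T g \<phi>))"
proof -
  have lev: "lev (add_mset j l, u) = lev (l, u) - 1" by (simp add: lev_def)
  define T' where "T' g \<phi> = T g \<phi> - el d g \<phi> ((l, u), k)" for g \<phi>
  have T': "J d (lev (l, u) - int k + 1) T'" using assms(1) unfolding JL_def T'_def by auto
  have "J (d - 1 + 1 + 1) (lev (l, u) - int k + 1 - 1) (\<lambda>g \<phi>. btil g 0 (btil g 0 (atil g (- int j) (T' g \<phi>))))"
    by (intro J_b0 J_a T')
  moreover have "J (d + 1) (lev (l, u) - int k) (\<lambda>g \<phi>. Rest g j (T g \<phi>))"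
    by (intro J_Rest JL_J assms)
  ultimately have "J (d + 1) (lev (l, u) - int k)
     (\<lambda>g \<phi>. btil g 0 (btil g 0 (atil g (- int j) (T' g \<phi>))) + Rest g j (T g \<phi>))"
    by (intro J_add; elim J_eq) auto
  then have "J (d + 1) (lev (l, u) - int k) (\<lambda>g \<phi>. At g (- int j) (T g \<phi>) - el (d + 1) g \<phi> ((add_mset j l, u), k))"
  proof (rule J_cong)
    fix g \<phi> assume g: "good g"
    have "btil g 0 (btil g 0 (atil g (- int j) (el d g \<phi> ((l, u), k)))) = el (d + 1) g \<phi> ((add_mset j l, u), k)"
      using g assms(2) by (simp add: el_aneg el_b0)
    then show "At g (- int j) (T g \<phi>) - el (d + 1) g \<phi> ((add_mset j l, u), k) =
       btil g 0 (btil g 0 (atil g (- int j) (T' g \<phi>))) + Rest g j (T g \<phi>)"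
      unfolding T'_def Rest_def by (simp add: linear_diff[OF linear_atil] linear_diff[OF linear_btil])
  qed
  then show ?thesis unfolding JL_def lev using assms by (auto simp: JL_def intro!: pp_add)
qed

lemma linear_bet: "gam g \<noteq> 0 \<Longrightarrow> linear (bet g k)"
  unfolding bet_def by (rule heis_inv.lin_beta[OF heis_inv_W])

lemma bet_rec:
  assumes "gam g \<noteq> 0"
  shows "bet g k w = (if k = 0 then wscale (U g (- 1)) w
     else - wscale (U g (- 1)) (\<Sum>p\<in>{1..k}. btil g (- int p) (bet g (k - p) w)))"
proof -
  interpret heis_inv "atil g" "btil g" "wscale (U g (- 1))" by (rule heis_inv_W[OF assms])
  show ?thesis unfolding bet_def by (subst beta.simps) simp
qed

lemma bet_0: "gam g \<noteq> 0 \<Longrightarrow> bet g 0 w = wscale (U g (- 1)) w"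
  using bet_rec[of g 0 w] by (simp only: if_True refl simp_thms)

lemma J_bet:
  assumes "J d r T"
  shows "J (d - 1) (if k = 0 then r else r + 1) (\<lambda>g \<phi>. bet g k (T g \<phi>))"
proof (induction k rule: less_induct)
  case (less k)
  show ?case
  proof (cases "k = 0")
    case True
    have "J (d - 1) r (\<lambda>g \<phi>. wscale (U g (- 1)) (T g \<phi>))" by (rule J_v[OF assms])
    then have "J (d - 1) r (\<lambda>g \<phi>. bet g k (T g \<phi>))"
    proof (rule J_cong)
      fix g \<phi> assume "good g"
      from bet_0[OF goodD(1)[OF this], of "T g \<phi>"] True
      show "bet g k (T g \<phi>) = wscale (U g (- 1)) (T g \<phi>)" by simp
    qed
    then show ?thesis using True by simp
  next
    case False
    have b: "J (d - 1 + 1) (r + 1) (\<lambda>g \<phi>. btil g (- int p) (bet g (k - p) (T g \<phi>)))" if p: "p \<in> {1..k}" for p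
    proof -
      have "J (d - 1) r (\<lambda>g \<phi>. bet g (k - p) (T g \<phi>))"
        by (rule J_mono[OF less]) (use p False in auto)
      then show ?thesis by (rule J_b) (use p in auto)
    qed
    have "J (d - 1 + 1 - 1) (r + 1) (\<lambda>g \<phi>. - wscale (U g (- 1)) (\<Sum>p\<in>{1..k}. btil g (- int p) (bet g (k - p) (T g \<phi>))))"
      by (rule J_neg[OF J_v[OF J_sum[OF b]]])
    then have "J (d - 1 + 1 - 1) (r + 1) (\<lambda>g \<phi>. bet g k (T g \<phi>))"
    proof (rule J_cong)
      fix g \<phi> assume "good g"
      from bet_rec[OF goodD(1)[OF this], of k "T g \<phi>"] False
      show "bet g k (T g \<phi>) = - wscale (U g (- 1)) (\<Sum>p\<in>{1..k}. btil g (- int p) (bet g (k - p) (T g \<phi>)))"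
        by (simp only: if_False)
    qed
    then show ?thesis using False by simp
  qed
qed

text \<open>To first order the inverse field is minus the b mode divided on both sides by
  \<gamma>\<tau>+\<delta>, which adjoins b_{-j}. The remaining terms of the recursion contain a
  further nonzero b mode and lie one step higher.\<close>

lemma JL_bet:
  assumes "JL (l, u) k d T" "j > 0"
  shows "JL (l, add_mset j u) k (d - 1) (\<lambda>g \<phi>. - bet g j (T g \<phi>))"
proof -
  have lev: "lev (l, add_mset j u) = lev (l, u) + 1" by (simp add: lev_def)
  define r where "r = lev (l, u) - int k"
  define T' where "T' g \<phi> = T g \<phi> - el d g \<phi> ((l, u), k)" for g \<phi>
  have T': "J d (r + 1) T'" using assms(1) unfolding JL_def T'_def r_def by auto
  let ?v = "\<lambda>g. wscale (U g (- 1))"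
  have 1: "J (d - 1 + 1 - 1) (r + 1 + 1) (\<lambda>g \<phi>. ?v g (btil g (- int j) (?v g (T' g \<phi>))))"
    using assms(2) by (intro J_v J_b T') auto
  have 2: "J (d - 1 + 1 - 1) (r + 1 + 1) (\<lambda>g \<phi>. ?v g (\<Sum>p\<in>{1..<j}. btil g (- int p) (bet g (j - p) (T g \<phi>))))"
  proof (intro J_v J_sum J_b)
    fix p assume "p \<in> {1..<j}"
    then show "J (d - 1) (r + 1) (\<lambda>g \<phi>. bet g (j - p) (T g \<phi>))"
      using J_bet[OF JL_J[OF assms(1)], of "j - p"] unfolding r_def by simp
  qed auto
  have "J (d - 1) (r + 1 + 1) (\<lambda>g \<phi>. ?v g (btil g (- int j) (?v g (T' g \<phi>))) +
      ?v g (\<Sum>p\<in>{1..<j}. btil g (- int p) (bet g (j - p) (T g \<phi>))))"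
    using J_add[OF 1 2] by simp
  then have "J (d - 1) (r + 1 + 1) (\<lambda>g \<phi>. - bet g j (T g \<phi>) - el (d - 1) g \<phi> ((l, add_mset j u), k))"
  proof (rule J_cong)
    fix g \<phi> assume g: "good g"
    have e: "?v g (btil g (- int j) (?v g (el d g \<phi> ((l, u), k)))) = el (d - 1) g \<phi> ((l, add_mset j u), k)"
      using g assms(2) by (simp add: el_v el_bneg)
    have "{1..j} = insert j {1..<j}" using assms(2) by auto
    then have "bet g j (T g \<phi>) = - ?v g (btil g (- int j) (?v g (T g \<phi>)) +
        (\<Sum>p\<in>{1..<j}. btil g (- int p) (bet g (j - p) (T g \<phi>))))"
      using assms(2) bet_0[OF goodD(1)[OF g], of "T g \<phi>"] bet_rec[OF goodD(1)[OF g], of j "T g \<phi>"]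
      by simp
    then show "- bet g j (T g \<phi>) - el (d - 1) g \<phi> ((l, add_mset j u), k) =
       ?v g (btil g (- int j) (?v g (T' g \<phi>))) + ?v g (\<Sum>p\<in>{1..<j}. btil g (- int p) (bet g (j - p) (T g \<phi>)))"
      unfolding T'_def e[symmetric]
      by (simp add: linear_diff[OF linear_W(6)] linear_diff[OF linear_btil] linear_add[OF linear_W(6)])
  qed
  then show ?thesis unfolding JL_def lev r_def using assms by (auto simp: JL_def algebra_simps intro!: pp_add)
qed

lemma JL_cong:
  assumes "JL m k d T" "\<And>g \<phi>. good g \<Longrightarrow> T' g \<phi> = T g \<phi>"
  shows "JL m k d T'"
proof -
  have "J d (lev m - int k + 1) (\<lambda>g \<phi>. T g \<phi> - el d g \<phi> (m, k))" using assms(1) by (simp add: JL_def)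
  then have "J d (lev m - int k + 1) (\<lambda>g \<phi>. T' g \<phi> - el d g \<phi> (m, k))"
    by (rule J_cong) (simp add: assms(2))
  then show ?thesis using assms(1) by (simp add: JL_def)
qed

lemma JL_el: "is_pp m \<Longrightarrow> JL m k d (\<lambda>g \<phi>. el d g \<phi> (m, k))"
  unfolding JL_def by (auto intro: J_zero)

lemma JL_a0:
  assumes "JL m k d T"
  shows "JL m (Suc k) (d - 1) (\<lambda>g \<phi>. atil g 0 (T g \<phi>))"
proof -
  define T' where "T' g \<phi> = T g \<phi> - el d g \<phi> (m, k)" for g \<phi>
  have T': "J d (lev m - int k + 1) T'" and pp: "is_pp m" using assms(1) unfolding JL_def T'_def by auto
  have "J (d - 1) (lev m - int k) (\<lambda>g \<phi>. atil g 0 (T' g \<phi>))"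
    using J_a[OF T', of 0] by (rule J_eq) auto
  moreover have "J (d - 1) (lev m - int k) (\<lambda>g \<phi>. real_of_int (d - lev m - int k) *\<^sub>R el (d - 1) g \<phi> (m, k))"
    by (rule J_scaleR, rule J_el[OF pp]) simp
  ultimately have "J (d - 1) (lev m - int k)
      (\<lambda>g \<phi>. atil g 0 (T' g \<phi>) + real_of_int (d - lev m - int k) *\<^sub>R el (d - 1) g \<phi> (m, k))"
    by (rule J_add)
  then have "J (d - 1) (lev m - int k) (\<lambda>g \<phi>. atil g 0 (T g \<phi>) - el (d - 1) g \<phi> (m, Suc k))"
    by (rule J_cong) (simp add: T'_def linear_diff[OF linear_atil] el_a0)
  then show ?thesis unfolding JL_def using pp by simp
qed

lemma JL_fold_At:
  assumes "JL (l, u) k d T" "\<forall>j\<in>set js. j > 0"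
  shows "JL (l + mset js, u) k (d + int (length js)) (\<lambda>g \<phi>. fold (\<lambda>j. At g (- int j)) js (T g \<phi>))"
  using assms
proof (induction js arbitrary: l d T)
  case (Cons j js)
  from Cons.IH[OF JL_At[OF Cons.prems(1), of j]] Cons.prems(2) show ?case by (simp add: add.assoc)
qed simp

lemma JL_fold_bet:
  assumes "JL (l, u) k d T" "\<forall>j\<in>set js. j > 0"
  shows "JL (l, u + mset js) k (d - int (length js)) (\<lambda>g \<phi>. fold (\<lambda>j w. - bet g j w) js (T g \<phi>))"
  using assms
proof (induction js arbitrary: u d T)
  case (Cons j js)
  from Cons.IH[OF JL_bet[OF Cons.prems(1), of j]] Cons.prems(2) show ?case by (simp add: algebra_simps)
qed simp

section \<open>The action on monomials\<close>

text \<open>The action of g on one monomial with coefficient \<open>f\<close>, in rescaled modes;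
  the true action is \<gamma>^(-lev m) times this, as \<open>rel_apply_mono\<close> shows.\<close>

definition piT :: "mat2 \<Rightarrow> mono \<Rightarrow> hol \<Rightarrow> W" where
  "piT g m f = fold (\<lambda>j. At g (- int j)) (sorted_list_of_multiset (fst m))
     (fold (\<lambda>j w. - bet g j w) (sorted_list_of_multiset (snd m)) (single ({#}, {#}) (hcomp g f)))"

text \<open>The power \<gamma>^(-k) turns the vacuum with coefficient \<phi>^(k)(g\<tau>) into an
  \<open>el\<close> of weight k. Each mode then adjoins its own part to the leading term, so the
  leading monomial is \<open>m\<close> with unchanged jet order.\<close>

lemma JL_piT:
  assumes "is_pp m"
  shows "JL m k (int k - lev m) (\<lambda>g \<phi>. (gam g powi (- int k)) *\<^sub>R piT g m ((hD ^^ k) \<phi>))"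
proof -
  obtain l u where m: "m = (l, u)" by (cases m)
  have pos: "\<forall>j\<in>set (sorted_list_of_multiset l). j > 0" "\<forall>j\<in>set (sorted_list_of_multiset u). j > 0"
    using assms by (auto simp: m is_pp_def)
  have "JL ({#}, {#}) k (int k) (\<lambda>g \<phi>. el (int k) g \<phi> (({#}, {#}), k))"
    by (rule JL_el) (simp add: is_pp_def)
  from JL_fold_At[OF JL_fold_bet[OF this pos(2)] pos(1)]
  have "JL m k (int k - lev m) (\<lambda>g \<phi>. fold (\<lambda>j. At g (- int j)) (sorted_list_of_multiset l)
      (fold (\<lambda>j w. - bet g j w) (sorted_list_of_multiset u) (el (int k) g \<phi> (({#}, {#}), k))))"
    by (simp add: m lev_def algebra_simps flip: size_mset)
  then show ?thesis
  proof (rule JL_cong)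
    fix g \<phi> assume g: "good g"
    note g0 = goodD(1)[OF g]
    have "el (int k) g \<phi> (({#}, {#}), k) = (gam g powi (- int k)) *\<^sub>R single ({#}, {#}) (hcomp g ((hD ^^ k) \<phi>))"
      using g0 by (simp add: el_def lev_def U_0 scaleR_single)
    moreover have "linear (\<lambda>w. - bet g j w)" for j by (rule linear_compose_neg[OF linear_bet[OF g0]])
    ultimately show "(gam g powi (- int k)) *\<^sub>R piT g m ((hD ^^ k) \<phi>) =
       fold (\<lambda>j. At g (- int j)) (sorted_list_of_multiset l)
         (fold (\<lambda>j w. - bet g j w) (sorted_list_of_multiset u) (el (int k) g \<phi> (({#}, {#}), k)))"
      by (simp add: piT_def m linear_scale[OF linear_fold] linear_At[OF g0])
  qed
qed

section \<open>Agreement of the rescaled action with \<open>pi_act\<close>\<close>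

lemma vacW_iff: "gam g \<noteq> 0 \<Longrightarrow> vacW g w \<longleftrightarrow> (\<forall>i>0. btil g i w = 0)"
  unfolding vacW_def by (rule heis.vac_def[OF heis_W])

lemma vacW_scaleR: "gam g \<noteq> 0 \<Longrightarrow> vacW g w \<Longrightarrow> vacW g (r *\<^sub>R w)"
  by (simp add: vacW_iff linear_scale[OF linear_btil])

lemma vacW_bet: "gam g \<noteq> 0 \<Longrightarrow> vacW g w \<Longrightarrow> vacW g (- bet g k w)"
  using vacW_scaleR[of g "bet g k w" "- 1"] heis_inv.vac_beta[OF heis_inv_W, of g w k]
  by (simp add: vacW_def bet_def)

lemma vacW_single: "gam g \<noteq> 0 \<Longrightarrow> vacW g (single ({#}, u) f)"
  by (simp add: vacW_iff btil_def single_W)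

lemma rel_fold_Amode:
  assumes "rel s w" "gam g \<noteq> 0"
  shows "rel (fold (\<lambda>k. Amode g (- int k)) ks s) (gam g ^ length ks *\<^sub>R fold (\<lambda>j. At g (- int j)) ks w)"
  using assms(1)
proof (induction ks arbitrary: s w)
  case (Cons k ks)
  from Cons.IH[OF rel_Amode[OF Cons.prems assms(2), of "- int k"]] show ?case
    by (simp add: linear_scale[OF linear_fold[OF linear_At[OF assms(2)]]] mult.commute)
qed simp

lemma rel_fold_Bmode:
  assumes "rel s w" "good g" "vacW g w" "\<forall>k\<in>set ks. k > 0"
  shows "rel (fold (\<lambda>k. Bmode g (- int k)) ks s) ((1 / gam g) ^ length ks *\<^sub>R fold (\<lambda>j w. - bet g j w) ks w)"
  using assms(1,3,4)
proof (induction ks arbitrary: s w)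
  case (Cons k ks)
  note g = goodD[OF assms(2)]
  have lin: "linear (\<lambda>w. - bet g j w)" for j by (rule linear_compose_neg[OF linear_bet[OF g(1)]])
  have "rel (Bmode g (- int k) s) ((- 1 / gam g) *\<^sub>R bet g k w)"
    using Cons.prems by (intro rel_Bmode g) auto
  then have "rel (Bmode g (- int k) s) ((1 / gam g) *\<^sub>R (- bet g k w))" by simp
  moreover have "vacW g ((1 / gam g) *\<^sub>R (- bet g k w))"
    using Cons.prems g by (intro vacW_scaleR vacW_bet) auto
  ultimately have "rel (fold (\<lambda>k. Bmode g (- int k)) ks (Bmode g (- int k) s))
     ((1 / gam g) ^ length ks *\<^sub>R fold (\<lambda>j w. - bet g j w) ks ((1 / gam g) *\<^sub>R (- bet g k w)))"
    using Cons.prems by (intro Cons.IH) auto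
  moreover have "(1 / gam g) ^ length (k # ks) = (1 / gam g) ^ length ks * (1 / gam g)" by simp
  ultimately show ?case
    by (simp only: linear_scale[OF linear_fold[OF lin]] scaleR_scaleR fold.simps comp_apply)
qed simp

lemma rel_vac:
  assumes "\<And>\<tau>. Im \<tau> > 0 \<Longrightarrow> h \<tau> = hv f \<tau>"
  shows "rel (vac_state h) (single ({#}, {#}) f)"
  by (rule relI) (auto simp: vac_state_def lookup_single' assms)

lemma rel_apply_mono:
  assumes "good g" "is_pp m" "\<And>\<tau>. Im \<tau> > 0 \<Longrightarrow> h \<tau> = hv f \<tau>"
  shows "rel (apply_mono g m (h \<circ> mob g)) ((gam g powi (- lev m)) *\<^sub>R piT g m f)"
proof -
  note g = goodD[OF assms(1)]
  obtain l u where m: "m = (l, u)" by (cases m)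
  have pos: "\<forall>j\<in>set (sorted_list_of_multiset u). j > 0"
    using assms(2) by (auto simp: m is_pp_def)
  have "rel (vac_state (h \<circ> mob g)) (single ({#}, {#}) (hcomp g f))"
    by (rule rel_vac) (simp add: hv_hcomp g assms(3) Im_mob)
  from rel_fold_Bmode[OF this assms(1) vacW_single[OF g(1)] pos]
  have 1: "rel (fold (\<lambda>k. Bmode g (- int k)) (sorted_list_of_multiset u) (vac_state (h \<circ> mob g)))
     ((1 / gam g) ^ size u *\<^sub>R fold (\<lambda>j w. - bet g j w) (sorted_list_of_multiset u) (single ({#}, {#}) (hcomp g f)))"
    by (simp flip: size_mset)
  have pw: "gam g powi (- lev m) = gam g ^ size l * (1 / gam g) ^ size u"
    using g(1) by (simp add: lev_def m power_int_diff power_divide)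
  from rel_fold_Amode[OF 1 g(1), of "sorted_list_of_multiset l"]
  show ?thesis unfolding apply_mono_def piT_def pw
    by (simp add: m linear_scale[OF linear_fold[OF linear_At[OF g(1)]]] flip: size_mset)
qed

lemma linear_piT: "good g \<Longrightarrow> linear (piT g m)"
proof -
  assume g: "good g"
  have 1: "linear (\<lambda>f. single ({#}, {#}) (hcomp g f) :: W)"
    by (rule linearI) (simp_all add: hcomp_simps goodD[OF g] single_add scaleR_single)
  have 2: "linear (fold (\<lambda>j w. - bet g j w) ks)" for ks
    by (rule linear_fold) (rule linear_compose_neg[OF linear_bet[OF goodD(1)[OF g]]])
  have 3: "linear (fold (\<lambda>j. At g (- int j)) ks)" for ks
    by (rule linear_fold) (rule linear_At[OF goodD(1)[OF g]])
  show ?thesis unfolding piT_def[abs_def]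
    using linear_compose[OF linear_compose[OF 1 2] 3] by (simp add: o_def)
qed

lemma pi_act_W:
  assumes "good g" "finite D" "{m. s m \<noteq> (\<lambda>_. 0)} \<subseteq> D" "\<And>m. m \<in> D \<Longrightarrow> is_pp m"
    "\<And>m \<tau>. m \<in> D \<Longrightarrow> Im \<tau> > 0 \<Longrightarrow> s m \<tau> = hv (f m) \<tau>" "Im \<tau> > 0"
  shows "pi_act g s m' \<tau> = hv (lookup (\<Sum>m\<in>D. (gam g powi (- lev m)) *\<^sub>R piT g m (f m)) m') \<tau>"
proof -
  have e: "apply_mono g m (s m \<circ> mob g) m' \<tau> = hv (lookup ((gam g powi (- lev m)) *\<^sub>R piT g m (f m)) m') \<tau>"
    if "m \<in> D" for m
    by (rule relD[OF rel_apply_mono]) (use assms that in auto)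
  have z: "apply_mono g m (s m \<circ> mob g) m' \<tau> = 0" if "m \<in> D" "s m = (\<lambda>_. 0)" for m
  proof -
    have "f m = 0" by (rule hol_eqI) (use assms(5)[OF that(1)] that(2) in auto)
    then show ?thesis using e[OF that(1)] linear_0[OF linear_piT[OF assms(1)]] by simp
  qed
  have "pi_act g s m' \<tau> = (\<Sum>m\<in>D. apply_mono g m (s m \<circ> mob g) m' \<tau>)"
    unfolding pi_act_def by (rule sum.mono_neutral_left) (use assms z in auto)
  then show ?thesis using e by (simp add: lookup_sum' hv_sum)
qed

section \<open>The zero mode on transformed monomials\<close>

lemma At0_At: "gam g \<noteq> 0 \<Longrightarrow> At g 0 (At g j w) = At g j (At g 0 w)"
  unfolding At_def by (rule heis.A0_A[OF heis_W])

lemma At0_bet: "gam g \<noteq> 0 \<Longrightarrow> vacW g w \<Longrightarrow> k > 0 \<Longrightarrow> At g 0 (bet g k w) = bet g k (At g 0 w)"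
  unfolding At_def bet_def vacW_def by (rule heis_inv.A0_beta[OF heis_inv_W])

lemma At0_fold_At:
  "gam g \<noteq> 0 \<Longrightarrow> At g 0 (fold (\<lambda>j. At g (- int j)) ks w) = fold (\<lambda>j. At g (- int j)) ks (At g 0 w)"
  by (induction ks arbitrary: w) (simp_all add: At0_At)

lemma At0_fold_bet:
  assumes "gam g \<noteq> 0" "vacW g w" "\<forall>k\<in>set ks. k > 0"
  shows "At g 0 (fold (\<lambda>j w. - bet g j w) ks w) = fold (\<lambda>j w. - bet g j w) ks (At g 0 w)"
  using assms(2,3)
proof (induction ks arbitrary: w)
  case (Cons k ks)
  have "At g 0 (- bet g k w) = - bet g k (At g 0 w)"
    using Cons.prems assms(1) by (simp add: linear_neg[OF linear_At] At0_bet)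
  then show ?case using Cons.IH[OF vacW_bet[OF assms(1) Cons.prems(1)]] Cons.prems by simp
qed simp

lemma At0_vac:
  assumes "good g"
  shows "At g 0 (single ({#}, {#}) f) = single ({#}, {#}) (U g 2 * ((1 / gam g) *\<^sub>R hD f))"
proof -
  note g = goodD[OF assms]
  interpret heis "atil g" "btil g" by (rule heis_W[OF g(1)])
  let ?x = "single ({#}, {#}) f :: W"
  have vac: "vac (single ({#}, {#}) h :: W)" for h using vacW_single[OF g(1)] by (simp add: vacW_def)
  have U2: "U g 2 = U g 1 * U g 1" using U_add[OF g(1), of 1 1] by simp
  have a0: "atil g 0 ?x = single ({#}, {#}) ((1 / gam g) *\<^sub>R hD f)"
    by (simp add: atil_def aW_def single_W scaleR_single)
  have "Aterm 0 i ?x = (if i = 0 then single ({#}, {#}) (U g 2 * ((1 / gam g) *\<^sub>R hD f)) else 0)" for i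
  proof (rule linorder_cases[of i 0])
    assume "i < 0"
    then show ?thesis using bb_vac_eq_0[OF vac, of "- i"] by (simp add: Aterm_def)
  next
    assume "i > 0"
    then show ?thesis by (simp add: Aterm_def atil_def aW_def single_W)
  next
    assume i: "i = 0"
    have "bb (- int 0) (single ({#}, {#}) h :: W) = btil g 0 (btil g 0 (single ({#}, {#}) h))" for h
      by (subst bb_vac[OF vac]) simp
    then show ?thesis using i by (simp add: Aterm_def a0 btil_def single_W U2 mult.assoc)
  qed
  then show ?thesis unfolding At_def A_def by simp
qed

text \<open>The zero mode passes through all modes down to the vacuum, where its factor
  (\<gamma>\<tau>+\<delta>)^2 cancels the chain rule factor of the pullback.\<close>

lemma At0_piT:
  assumes "good g" "is_pp m"
  shows "At g 0 (piT g m f) = (1 / gam g) *\<^sub>R piT g m (hD f)"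
proof -
  note g = goodD[OF assms(1)]
  have pos: "\<forall>j\<in>set (sorted_list_of_multiset (snd m)). j > 0"
    using assms(2) by (auto simp: is_pp_def)
  have "U g 2 * ((1 / gam g) *\<^sub>R hD (hcomp g f)) = (1 / gam g) *\<^sub>R (U g 2 * U g (- 2) * hcomp g (hD f))"
    by (simp add: hD_hcomp g mult_scaleR_hol mult.assoc)
  also have "U g 2 * U g (- 2) = 1" using U_add[OF g(1), of 2 "- 2"] by (simp add: U_0 g)
  finally have 1: "At g 0 (single ({#}, {#}) (hcomp g f)) = single ({#}, {#}) (hcomp g ((1 / gam g) *\<^sub>R hD f))"
    by (simp add: At0_vac[OF assms(1)] hcomp_simps g)
  have "At g 0 (piT g m f) = piT g m ((1 / gam g) *\<^sub>R hD f)"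
    unfolding piT_def At0_fold_At[OF g(1)] At0_fold_bet[OF g(1) vacW_single[OF g(1)] pos] 1 ..
  then show ?thesis by (simp only: linear_scale[OF linear_piT[OF assms(1)]])
qed

lemma hD_funpow_1: "k > 0 \<Longrightarrow> (hD ^^ k) 1 = 0"
proof (induction k)
  case (Suc k)
  then show ?case by (cases "k = 0") simp_all
qed simp

text \<open>The constants c^0 come from the filtered expansion at \<phi> = 1: jets of positive order
  vanish there, and what remains has coefficients independent of g.\<close>

lemma cc_exists:
  assumes "is_pp m0" "lev m0 = 0"
  obtains cc where "finite {m. cc m \<noteq> 0}" "\<And>m. cc m \<noteq> 0 \<Longrightarrow> is_pp m \<and> lev m \<ge> 1"
    "\<And>g. good g \<Longrightarrow> piT g m0 1 = single m0 1 +
       (\<Sum>m\<in>{m. cc m \<noteq> 0}. single m (hc (cc m) * ((gam g powi lev m) *\<^sub>R U g (- lev m))))"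
proof -
  have "JL m0 0 (int 0 - lev m0) (\<lambda>g \<phi>. (gam g powi (- int 0)) *\<^sub>R piT g m0 ((hD ^^ 0) \<phi>))"
    by (rule JL_piT[OF assms(1)])
  then have "J 0 1 (\<lambda>g \<phi>. piT g m0 \<phi> - el 0 g \<phi> (m0, 0))" by (simp add: JL_def assms(2))
  then obtain S c where S: "finite S" "\<forall>(m, k)\<in>S. is_pp m \<and> lev m - int k \<ge> 1"
     "\<And>g \<phi>. good g \<Longrightarrow> piT g m0 \<phi> - el 0 g \<phi> (m0, 0) = (\<Sum>x\<in>S. wscale (hc (c x)) (el 0 g \<phi> x))"
    unfolding J_def by blast
  define cc where "cc m = (if (m, 0) \<in> S then c (m, 0) else 0)" for m
  define M where "M = {m. cc m \<noteq> 0}"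
  have sub: "(\<lambda>m. (m, 0)) ` M \<subseteq> S" by (auto simp: M_def cc_def split: if_splits)
  have inj: "inj_on (\<lambda>m. (m, 0::nat)) M" by (auto simp: inj_on_def)
  have fM: "finite M" using finite_imageD[OF finite_subset[OF sub S(1)] inj] .
  have "is_pp m \<and> lev m \<ge> 1" if "cc m \<noteq> 0" for m
  proof -
    have "(m, 0) \<in> S" using that by (auto simp: cc_def split: if_splits)
    then show ?thesis using S(2) by force
  qed
  moreover have "piT g m0 1 = single m0 1 + (\<Sum>m\<in>M. single m (hc (cc m) * ((gam g powi lev m) *\<^sub>R U g (- lev m))))"
    if g: "good g" for g
  proof -
    have h1: "hcomp g 1 = 1" using goodD[OF g] by (simp add: hcomp_simps)
    have e0: "el 0 g 1 (m, 0) = single m ((gam g powi lev m) *\<^sub>R U g (- lev m))" for m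
      by (simp add: el_def h1)
    have "(\<Sum>x\<in>S. wscale (hc (c x)) (el 0 g 1 x)) = (\<Sum>x\<in>(\<lambda>m. (m, 0)) ` M. wscale (hc (c x)) (el 0 g 1 x))"
    proof (rule sum.mono_neutral_right[OF S(1) sub], rule ballI)
      fix x assume x: "x \<in> S - (\<lambda>m. (m, 0)) ` M"
      obtain m k where mk: "x = (m, k)" by (cases x)
      show "wscale (hc (c x)) (el 0 g 1 x) = 0"
      proof (cases "k = 0")
        case True
        then have "m \<notin> M" "(m, 0) \<in> S" using x mk by auto
        then have "c x = 0" using mk True by (auto simp: M_def cc_def)
        then show ?thesis by (simp add: hc_simps)
      next
        case False
        then have "(hD ^^ k) 1 = 0" using hD_funpow_1 by auto
        then have "el 0 g 1 x = 0" using goodD[OF g] by (simp add: mk el_def hcomp_simps)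
        then show ?thesis by (simp add: linear_0[OF linear_W(6)])
      qed
    qed
    also have "\<dots> = (\<Sum>m\<in>M. wscale (hc (c (m, 0))) (el 0 g 1 (m, 0)))"
      by (simp add: sum.reindex[OF inj])
    also have "\<dots> = (\<Sum>m\<in>M. single m (hc (cc m) * ((gam g powi lev m) *\<^sub>R U g (- lev m))))"
      by (rule sum.cong) (auto simp: e0 single_W M_def cc_def split: if_splits)
    finally have "piT g m0 1 - el 0 g 1 (m0, 0) = (\<Sum>m\<in>M. single m (hc (cc m) * ((gam g powi lev m) *\<^sub>R U g (- lev m))))"
      unfolding S(3)[OF g] .
    moreover have "el 0 g 1 (m0, 0) = single m0 1"
      using goodD[OF g] by (simp add: e0 assms(2) U_0)
    ultimately show ?thesis by (simp add: algebra_simps)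
  qed
  ultimately show ?thesis using fM by (intro that[of cc]) (auto simp: M_def)
qed

section \<open>The action for \<gamma> = 0, which is diagonal on monomials\<close>

definition conc :: "mono \<Rightarrow> (complex \<Rightarrow> complex) \<Rightarrow> state" where
  "conc m h = (\<lambda>m' \<tau>. if m' = m then h \<tau> else 0)"

text \<open>For \<gamma> = 0 the function multiplying a(z) is the constant \<delta>^2, so only the
  empty list contributes to \<open>Yf\<close> and only i = -k to the sum over modes.\<close>

lemma Amode_conc:
  assumes "gam g = 0" "k > 0"
  shows "Amode g (- int k) (conc (l, u) h) = conc (add_mset k l, u) (\<lambda>\<tau>. (of_real (del g))\<^sup>2 * h \<tau>)"
proof -
  define d where "d = (complex_of_real (del g))\<^sup>2"
  have P: "Pfun g = (\<lambda>_. d)" using assms(1) by (simp add: Pfun_def d_def)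
  have dk: "(deriv ^^ n) (\<lambda>_. c :: complex) = (\<lambda>_. 0)" if "n > 0" for n and c :: complex
    using that
  proof (induction n)
    case (Suc n)
    then show ?case by (cases "n = 0") simp_all
  qed simp
  have Y: "Yf (Pfun g) n s = (\<lambda>m \<tau>. if n = 0 then d * s m \<tau> else 0)" for n s
  proof (intro ext)
    fix m \<tau>
    let ?F = "if n = 0 then {[]} else {} :: int list set"
    have "Yf (Pfun g) n s m \<tau> = (\<Sum>ms\<in>?F. ((deriv ^^ length ms) (Pfun g) \<tau> / fact (length ms)) * fold bmode ms s m \<tau>)"
      unfolding Yf_def
    proof (rule infsum_finite_support)
      show "finite ?F" by simp
      show "?F \<subseteq> {ms. 0 \<notin> set ms \<and> sum_list ms = n}" by auto
      fix ms :: "int list" assume "ms \<in> {ms. 0 \<notin> set ms \<and> sum_list ms = n} - ?F"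
      then have "length ms > 0" by (auto split: if_splits)
      then show "((deriv ^^ length ms) (Pfun g) \<tau> / fact (length ms)) * fold bmode ms s m \<tau> = 0"
        by (simp add: P dk)
    qed
    then show "Yf (Pfun g) n s m \<tau> = (if n = 0 then d * s m \<tau> else 0)" by (simp add: P)
  qed
  show ?thesis
  proof (intro ext)
    fix m :: mono and \<tau>
    obtain l' u' where m: "m = (l', u')" by (cases m)
    let ?s = "conc (l, u) h"
    have "(\<Sum>\<^sub>\<infinity> i \<in> {..-1::int}. amode i (Yf (Pfun g) (- int k - i) ?s) m \<tau>) =
       (\<Sum>i\<in>{- int k}. amode i (Yf (Pfun g) (- int k - i) ?s) m \<tau>)"
    proof (rule infsum_finite_support)
      show "{- int k} \<subseteq> {..-1}" using assms(2) by auto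
      fix i :: int assume i: "i \<in> {..- 1} - {- int k}"
      then have "- int k - i \<noteq> 0" by auto
      then have "Yf (Pfun g) (- int k - i) ?s = (\<lambda>_ _. 0)" unfolding Y by simp
      then show "amode i (Yf (Pfun g) (- int k - i) ?s) m \<tau> = 0" using i
        by (simp add: amode_def amul_def m)
    qed simp
    moreover have "(\<Sum>\<^sub>\<infinity> i \<in> {0::int..}. Yf (Pfun g) (- int k - i) (amode i ?s) m \<tau>) = 0"
      by (rule infsum_0) (use assms(2) in \<open>auto simp: Y\<close>)
    ultimately have "Amode g (- int k) ?s m \<tau> = amul k (\<lambda>m \<tau>. d * ?s m \<tau>) m \<tau>"
      unfolding Amode_def using assms by (simp add: Y amode_def)
    also have "\<dots> = conc (add_mset k l, u) (\<lambda>\<tau>. d * h \<tau>) m \<tau>"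
      by (auto simp: amul_def conc_def m dest!: multi_member_split)
    finally show "Amode g (- int k) ?s m \<tau> = conc (add_mset k l, u) (\<lambda>\<tau>. (of_real (del g))\<^sup>2 * h \<tau>) m \<tau>"
      unfolding d_def .
  qed
qed

text \<open>For \<gamma> = 0 the Moebius map is affine with slope \<alpha>/\<delta>, so the only
  list with a nonzero contribution to mode -k is \<open>[- int k]\<close>.\<close>

lemma Bmode_conc:
  assumes "gam g = 0" "sl2R g" "k > 0"
  shows "Bmode g (- int k) (conc (l, u) h) = conc (l, add_mset k u) (\<lambda>\<tau>. of_real (fst g / del g) * h \<tau>)"
proof (intro ext)
  fix m :: mono and \<tau>
  define c where "c = complex_of_real (fst g / del g)"
  obtain l' u' where m: "m = (l', u')" by (cases m)
  have d0: "del g \<noteq> 0" using assms by (auto simp: sl2R_def gam_def del_def case_prod_unfold)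
  have mob: "mob g = (\<lambda>\<tau>. c * \<tau> + of_real (fst (snd g) / del g))"
    using assms(1) by (auto simp: mob_den den_def c_def add_divide_distrib)
  have d1: "deriv (mob g) = (\<lambda>_. c)"
    unfolding mob by (rule ext, rule DERIV_imp_deriv) (auto intro!: derivative_eq_intros)
  have dk: "(deriv ^^ n) (mob g) = (\<lambda>_. 0)" if "n \<ge> 2" for n
    using that
  proof (induction n rule: dec_induct)
    case base
    show ?case by (simp add: numeral_2_eq_2 d1)
  qed simp
  let ?s = "conc (l, u) h"
  have "Bmode g (- int k) ?s m \<tau> = (\<Sum>ms\<in>{[- int k]}. ((deriv ^^ length ms) (mob g) \<tau> / fact (length ms)) * fold bmode ms ?s m \<tau>)"
    unfolding Bmode_def Yf_def
  proof (rule infsum_finite_support)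
    show "{[- int k]} \<subseteq> {ms. 0 \<notin> set ms \<and> sum_list ms = - int k}" using assms(3) by auto
    fix ms :: "int list" assume ms: "ms \<in> {ms. 0 \<notin> set ms \<and> sum_list ms = - int k} - {[- int k]}"
    have "length ms \<ge> 2"
    proof (rule ccontr)
      assume "\<not> length ms \<ge> 2"
      then have "length ms = 0 \<or> length ms = 1" by linarith
      then show False using ms assms(3) by (auto simp: length_Suc_conv)
    qed
    then show "((deriv ^^ length ms) (mob g) \<tau> / fact (length ms)) * fold bmode ms ?s m \<tau> = 0"
      by (simp add: dk)
  qed simp
  also have "\<dots> = c * bmul k ?s m \<tau>" using assms(3) by (simp add: d1 bmode_def)
  also have "\<dots> = conc (l, add_mset k u) (\<lambda>\<tau>. c * h \<tau>) m \<tau>"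
    by (auto simp: bmul_def conc_def m dest!: multi_member_split)
  finally show "Bmode g (- int k) ?s m \<tau> = conc (l, add_mset k u) (\<lambda>\<tau>. of_real (fst g / del g) * h \<tau>) m \<tau>"
    unfolding c_def .
qed

lemma apply_mono_gam0:
  assumes "gam g = 0" "sl2R g" "is_pp m"
  shows "apply_mono g m h = conc m (\<lambda>\<tau>. ((of_real (del g))\<^sup>2) ^ size (fst m) * (of_real (fst g / del g) ^ size (snd m) * h \<tau>))"
proof -
  obtain l u where m: "m = (l, u)" by (cases m)
  have B: "\<forall>j\<in>set ks. j > 0 \<Longrightarrow> fold (\<lambda>k. Bmode g (- int k)) ks (conc (l', u') h) =
     conc (l', u' + mset ks) (\<lambda>\<tau>. of_real (fst g / del g) ^ length ks * h \<tau>)" for ks l' u' h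
  proof (induction ks arbitrary: u' h)
    case (Cons k ks)
    from Cons.prems have "k > 0" "\<forall>j\<in>set ks. j > 0" by auto
    then show ?case by (simp add: Bmode_conc[OF assms(1,2)] Cons.IH mult.assoc mult.left_commute)
  qed simp
  have A: "\<forall>j\<in>set ks. j > 0 \<Longrightarrow> fold (\<lambda>k. Amode g (- int k)) ks (conc (l', u') h) =
     conc (l' + mset ks, u') (\<lambda>\<tau>. ((of_real (del g))\<^sup>2) ^ length ks * h \<tau>)" for ks l' u' h
  proof (induction ks arbitrary: l' h)
    case (Cons k ks)
    from Cons.prems have "k > 0" "\<forall>j\<in>set ks. j > 0" by auto
    then show ?case by (simp add: Amode_conc[OF assms(1)] Cons.IH mult.assoc mult.left_commute)
  qed simp
  have v: "vac_state h = conc ({#}, {#}) h" by (auto simp: vac_state_def conc_def fun_eq_iff)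
  have pos: "\<forall>j\<in>set (sorted_list_of_multiset l). j > 0" "\<forall>j\<in>set (sorted_list_of_multiset u). j > 0"
    using assms(3) by (auto simp: m is_pp_def)
  show ?thesis unfolding apply_mono_def v m fst_conv snd_conv B[OF pos(2)] A[OF pos(1)]
    by (simp flip: size_mset)
qed

lemma pi_act_gam0:
  assumes "gam g = 0" "sl2R g" "finite {m. s m \<noteq> (\<lambda>_. 0)}" "\<And>m. s m \<noteq> (\<lambda>_. 0) \<Longrightarrow> is_pp m"
  shows "pi_act g s m \<tau> = ((of_real (del g))\<^sup>2) ^ size (fst m) * (of_real (fst g / del g) ^ size (snd m) * s m (mob g \<tau>))"
proof -
  have "pi_act g s m \<tau> = (\<Sum>m'\<in>{m. s m \<noteq> (\<lambda>_. 0)}. if m' = m then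
      ((of_real (del g))\<^sup>2) ^ size (fst m) * (of_real (fst g / del g) ^ size (snd m) * s m (mob g \<tau>)) else 0)"
    unfolding pi_act_def
    by (intro sum.cong refl) (auto simp: apply_mono_gam0[OF assms(1,2)] assms(4) conc_def)
  also have "\<dots> = ((of_real (del g))\<^sup>2) ^ size (fst m) * (of_real (fst g / del g) ^ size (snd m) * s m (mob g \<tau>))"
    using assms(3) by (auto simp: sum.delta')
  finally show ?thesis .
qed

section \<open>The zero mode and the level grading\<close>

definition homog :: "int \<Rightarrow> W \<Rightarrow> bool" where
  "homog n w \<longleftrightarrow> (\<forall>m. lookup w m \<noteq> 0 \<longrightarrow> lev m = n)"

lemma homog_0: "homog n 0" by (simp add: homog_def)

lemma homog_add: "homog n x \<Longrightarrow> homog n y \<Longrightarrow> homog n (x + y)"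
  unfolding homog_def lookup_add by (metis add.right_neutral add.left_neutral)

lemma homog_sum: "(\<And>i. i \<in> I \<Longrightarrow> homog n (f i)) \<Longrightarrow> homog n (\<Sum>i\<in>I. f i)"
  by (induction I rule: infinite_finite_induct) (simp_all add: homog_0 homog_add)

lemma homog_Sum_any: "(\<And>i. homog n (f i)) \<Longrightarrow> homog n (Sum_any f)"
  unfolding Sum_any.expand_set by (rule homog_sum)

lemma homog_btil:
  assumes "homog n w" "i \<noteq> 0"
  shows "homog (n + 1) (btil g i w)"
  unfolding homog_def
proof (intro allI impI)
  fix m assume nz: "lookup (btil g i w) m \<noteq> 0"
  obtain l u where m: "m = (l, u)" by (cases m)
  show "lev m = n + 1"
  proof (cases "i < 0")
    case True
    then have "nat (- i) \<in># u" "lookup w (l, u - {#nat (- i)#}) \<noteq> 0"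
      using nz by (auto simp: btil_def m split: if_splits)
    moreover from this have "lev (l, u - {#nat (- i)#}) = n" using assms(1) by (simp add: homog_def)
    ultimately show ?thesis unfolding m by (auto simp: lev_def dest!: multi_member_split)
  next
    case False
    then have "lookup w (add_mset (nat i) l, u) \<noteq> 0" using nz assms(2) by (auto simp: btil_def m)
    then have "lev (add_mset (nat i) l, u) = n" using assms(1) by (simp add: homog_def)
    then show ?thesis unfolding m by (simp add: lev_def)
  qed
qed

lemma homog_atil:
  assumes "homog n w" "i \<noteq> 0"
  shows "homog (n - 1) (atil g i w)"
  unfolding homog_def
proof (intro allI impI)
  fix m assume nz: "lookup (atil g i w) m \<noteq> 0"
  obtain l u where m: "m = (l, u)" by (cases m)
  show "lev m = n - 1"
  proof (cases "i < 0")
    case True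
    then have "nat (- i) \<in># l" "lookup w (l - {#nat (- i)#}, u) \<noteq> 0"
      using nz by (auto simp: atil_def aW_def m split: if_splits)
    moreover from this have "lev (l - {#nat (- i)#}, u) = n" using assms(1) by (simp add: homog_def)
    ultimately show ?thesis unfolding m by (auto simp: lev_def dest!: multi_member_split)
  next
    case False
    then have "lookup w (l, add_mset (nat i) u) \<noteq> 0" using nz assms(2) by (auto simp: atil_def aW_def m)
    then have "lev (l, add_mset (nat i) u) = n" using assms(1) by (simp add: homog_def)
    then show ?thesis unfolding m by (simp add: lev_def)
  qed
qed

lemma homog_single: "homog (lev m) (single m f)"
  by (simp add: homog_def lookup_single')

lemma homog_bb:
  assumes "gam g \<noteq> 0" "homog n w"
  shows "homog (n + 2) (bbt g 0 w - btil g 0 (btil g 0 w))"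
    "p \<noteq> 0 \<Longrightarrow> homog (n + 2) (bbt g p w - 2 *\<^sub>R btil g 0 (btil g p w))"
proof -
  interpret heis "atil g" "btil g" by (rule heis_W[OF assms(1)])
  obtain N0 where N0: "\<forall>i>N0. btil g i w = 0" using loc_fin by blast
  have two: "homog (n + 2) (btil g i (btil g j w))" if "i \<noteq> 0" "j \<noteq> 0" for i j
    using homog_btil[OF homog_btil[OF assms(2) that(2)] that(1)] by (simp add: add.assoc)
  define N where "N = max N0 (max 0 p)"
  have N: "\<forall>i>N. btil g i w = 0" "N \<ge> 0" "N \<ge> p" using N0 by (auto simp: N_def)
  have "bbt g 0 w - btil g 0 (btil g 0 w) = (\<Sum>i\<in>{- N..N} - {0}. btil g i (btil g (- i) w))"
    unfolding bbt_def bb_eq_sum[OF N(1), of 0] using N(2) by (simp add: sum.remove[of "{- N..N}" 0])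
  then show "homog (n + 2) (bbt g 0 w - btil g 0 (btil g 0 w))" by (auto intro!: homog_sum two)
  assume p: "p \<noteq> 0"
  have mem: "0 \<in> {p - N..N}" "p \<in> {p - N..N} - {0}" using N p by auto
  have "bbt g p w = btil g 0 (btil g (p - 0) w) + (\<Sum>i\<in>{p - N..N} - {0}. btil g i (btil g (p - i) w))"
    unfolding bbt_def bb_eq_sum[OF N(1), of p] by (rule sum.remove[OF _ mem(1)]) simp
  also have "(\<Sum>i\<in>{p - N..N} - {0}. btil g i (btil g (p - i) w)) =
     btil g p (btil g (p - p) w) + (\<Sum>i\<in>{p - N..N} - {0} - {p}. btil g i (btil g (p - i) w))"
    by (rule sum.remove[OF _ mem(2)]) simp
  finally have "bbt g p w - 2 *\<^sub>R btil g 0 (btil g p w) = (\<Sum>i\<in>{p - N..N} - {0} - {p}. btil g i (btil g (p - i) w))"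
    using b_comm[of p 0 w] by (simp add: scaleR_2)
  then show "homog (n + 2) (bbt g p w - 2 *\<^sub>R btil g 0 (btil g p w))" by (auto intro!: homog_sum two)
qed

text \<open>The removed part is diagonal: choosing one of the two b factors as the zero mode gives
  2(\<gamma>\<tau>+\<delta>) times the zero mode of :ab:, whose eigenvalue is the level.\<close>

definition A0_rest :: "mat2 \<Rightarrow> mono \<Rightarrow> W" where
  "A0_rest g m = At g 0 (single m 1) - (2 * of_int (lev m)) *\<^sub>R single m (U g 1)"

definition bb0_rest :: "mat2 \<Rightarrow> mono \<Rightarrow> W" where
  "bb0_rest g m = bbt g 0 (single m 1) - single m (U g 2)"

lemma U_2: "gam g \<noteq> 0 \<Longrightarrow> U g 2 = U g 1 * U g 1"
  using U_add[of g 1 1] by simp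

lemma homog_bb0_rest:
  assumes "gam g \<noteq> 0" shows "homog (lev m + 2) (bb0_rest g m)"
  using homog_bb(1)[OF assms homog_single[of m 1]] unfolding bb0_rest_def
  by (simp add: btil_def single_W U_2[OF assms])

lemma sum_count_pos:
  fixes u :: "nat multiset"
  assumes "\<forall>k\<in>#u. k > 0" "\<forall>k\<in>#u. k \<le> n"
  shows "(\<Sum>k\<in>{1..n}. count u k) = size u"
proof -
  have "size u = (\<Sum>k\<in>set_mset u. count u k)" by (simp add: size_multiset_overloaded_eq)
  also have "\<dots> = (\<Sum>k\<in>{1..n}. count u k)"
    by (rule sum.mono_neutral_left) (use assms in \<open>auto simp: not_in_iff Suc_le_eq\<close>)
  finally show ?thesis by simp
qed

text \<open>The zero mode of :ab: is an Euler operator counting b parts minus a parts; the constant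
  coefficient makes its \<open>a_0\<close> term vanish.\<close>

lemma ab0_single:
  assumes "gam g \<noteq> 0" "is_pp m"
  shows "heis.ab (atil g) (btil g) 0 (single m 1) = of_int (lev m) *\<^sub>R single m 1"
proof -
  interpret heis "atil g" "btil g" by (rule heis_W[OF assms(1)])
  obtain l u where m: "m = (l, u)" by (cases m)
  define n where "n = Max (insert 0 (set_mset l \<union> set_mset u))"
  have le: "\<forall>k\<in>#l. k \<le> n" "\<forall>k\<in>#u. k \<le> n" by (auto simp: n_def)
  have pos: "\<forall>k\<in>#l. k > 0" "\<forall>k\<in>#u. k > 0" using assms(2) by (auto simp: m is_pp_def)
  let ?x = "single m (1::hol)"
  define co where "co i = (if i < 0 then - real (count l (nat (- i))) else if i = 0 then 0 else real (count u (nat i)))" for i :: int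
  have trm: "(if i < 0 then atil g i (btil g (0 - i) ?x) else btil g (0 - i) (atil g i ?x)) = co i *\<^sub>R ?x" for i
  proof (rule linorder_cases[of i 0])
    assume i: "i < 0"
    show ?thesis
    proof (cases "nat (- i) \<in># l")
      case True
      then show ?thesis using i assms(1)
        by (simp add: btil_def atil_def aW_def m single_W scaleR_single co_def)
    next
      case False
      then have "count l (nat (- i)) = 0" by (simp add: not_in_iff)
      then show ?thesis using i False
        by (simp add: btil_def atil_def aW_def m single_W co_def linear_0[OF linear_W(1)])
    qed
  next
    assume i: "i = 0"
    then show ?thesis by (simp add: atil_def aW_def single_W co_def linear_0[OF linear_btil])
  next
    assume i: "i > 0"
    show ?thesis
    proof (cases "nat i \<in># u")
      case True
      then show ?thesis using i assms(1)
        by (simp add: btil_def atil_def aW_def m single_W scaleR_single co_def)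
    next
      case False
      then have "count u (nat i) = 0" by (simp add: not_in_iff)
      then show ?thesis using i False
        by (simp add: btil_def atil_def aW_def m single_W co_def linear_0[OF linear_W(2)])
    qed
  qed
  have co0: "co i = 0" if "i \<notin> {- int n..int n}" for i
  proof -
    have "nat (- i) \<notin># l" if "i < 0" using le(1) \<open>i \<notin> {- int n..int n}\<close> that by force
    moreover have "nat i \<notin># u" if "i > 0" using le(2) \<open>i \<notin> {- int n..int n}\<close> that by force
    ultimately show ?thesis by (auto simp: co_def not_in_iff)
  qed
  have "ab 0 ?x = Sum_any (\<lambda>i. co i *\<^sub>R ?x)" unfolding ab_def trm ..
  also have "\<dots> = (\<Sum>i\<in>{- int n..int n}. co i *\<^sub>R ?x)"
    by (rule Sum_any.expand_superset, simp, rule subsetI, rule ccontr) (simp add: co0)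
  also have "\<dots> = (\<Sum>i\<in>{- int n..int n}. co i) *\<^sub>R ?x" by (simp add: scaleR_left.sum)
  also have "(\<Sum>i\<in>{- int n..int n}. co i) = of_int (lev m)"
  proof -
    have split: "{- int n..int n} = (\<lambda>k. - int k) ` {1..n} \<union> ({0} \<union> int ` {1..n})"
    proof (intro equalityI subsetI)
      fix i assume i: "i \<in> {- int n..int n}"
      show "i \<in> (\<lambda>k. - int k) ` {1..n} \<union> ({0} \<union> int ` {1..n})"
      proof (rule linorder_cases[of i 0])
        assume "i < 0"
        then have "i \<in> (\<lambda>k. - int k) ` {1..n}" using i by (intro image_eqI[of _ _ "nat (- i)"]) auto
        then show ?thesis by blast
      next
        assume "i > 0"
        then have "i \<in> int ` {1..n}" using i by (intro image_eqI[of _ _ "nat i"]) auto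
        then show ?thesis by blast
      qed simp
    qed auto
    have "(\<Sum>i\<in>{- int n..int n}. co i) = (\<Sum>i\<in>(\<lambda>k. - int k) ` {1..n}. co i) + ((\<Sum>i\<in>{0}. co i) + (\<Sum>i\<in>int ` {1..n}. co i))"
      unfolding split by (subst sum.union_disjoint; (subst sum.union_disjoint)?) auto
    also have "(\<Sum>i\<in>(\<lambda>k. - int k) ` {1..n}. co i) = (\<Sum>k\<in>{1..n}. - real (count l k))"
      by (subst sum.reindex) (auto simp: inj_on_def co_def intro!: sum.cong)
    also have "(\<Sum>i\<in>int ` {1..n}. co i) = (\<Sum>k\<in>{1..n}. real (count u k))"
      by (subst sum.reindex) (auto simp: inj_on_def co_def intro!: sum.cong)
    also have "(\<Sum>k\<in>{1..n}. - real (count l k)) = - real (size l)"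
      using sum_count_pos[OF pos(1) le(1)] by (simp add: sum_negf flip: of_nat_sum)
    also have "(\<Sum>k\<in>{1..n}. real (count u k)) = real (size u)"
      using sum_count_pos[OF pos(2) le(2)] by (simp flip: of_nat_sum)
    finally show ?thesis by (simp add: co_def lev_def m)
  qed
  finally show ?thesis .
qed

text \<open>In each remaining summand one nonzero a mode and two nonzero b modes act, for a net
  change of level of 2 - 1.\<close>

lemma homog_A0_rest:
  assumes "gam g \<noteq> 0" "is_pp m" shows "homog (lev m + 1) (A0_rest g m)"
proof -
  interpret heis "atil g" "btil g" by (rule heis_W[OF assms(1)])
  let ?x = "single m (1::hol)"
  define t where "t i = (if i < 0 then atil g i (btil g (0 - i) ?x) else btil g (0 - i) (atil g i ?x))" for i
  define V where "V i = Aterm 0 i ?x - 2 *\<^sub>R btil g 0 (t i)" for i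
  have hx: "homog (lev m) ?x" by (rule homog_single)
  have hV: "homog (lev m + 1) (V i)" for i
  proof (rule linorder_cases[of i 0])
    assume i: "i < 0"
    have "V i = atil g i (bbt g (- i) ?x - 2 *\<^sub>R btil g 0 (btil g (- i) ?x))"
      using i by (simp add: V_def t_def Aterm_def bbt_def a_b[of i 0])
    moreover have "homog (lev m + 2 - 1) (atil g i (bbt g (- i) ?x - 2 *\<^sub>R btil g 0 (btil g (- i) ?x)))"
      by (rule homog_atil[OF homog_bb(2)[OF assms(1) hx]]) (use i in auto)
    ultimately show ?thesis by (simp add: add.commute)
  next
    assume i: "i = 0"
    then show ?thesis by (simp add: V_def t_def Aterm_def atil_def aW_def single_W homog_0)
  next
    assume i: "i > 0"
    have "V i = bbt g (- i) (atil g i ?x) - 2 *\<^sub>R btil g 0 (btil g (- i) (atil g i ?x))"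
      using i by (simp add: V_def t_def Aterm_def bbt_def)
    moreover have "homog (lev m - 1 + 2) (bbt g (- i) (atil g i ?x) - 2 *\<^sub>R btil g 0 (btil g (- i) (atil g i ?x)))"
      by (rule homog_bb(2)[OF assms(1) homog_atil[OF hx]]) (use i in auto)
    ultimately show ?thesis by (simp add: add.commute)
  qed
  have fint: "finite {i. t i \<noteq> 0}" unfolding t_def by (rule finite_ab)
  have f2: "finite {i. 2 *\<^sub>R btil g 0 (t i) \<noteq> 0}"
    by (rule finite_subset[OF _ fint]) auto
  have fV: "finite {i. V i \<noteq> 0}"
    by (rule finite_subset[OF _ finite_UnI[OF finite_Aterm[of 0 ?x] f2]]) (auto simp: V_def)
  have lin: "linear (\<lambda>w. 2 *\<^sub>R btil g 0 w)" by (rule linear_compose_scale_right[OF linear_btil])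
  have "Sum_any V + Sum_any (\<lambda>i. 2 *\<^sub>R btil g 0 (t i)) = Sum_any (\<lambda>i. Aterm 0 i ?x)"
    by (subst Sum_any.distrib[OF fV f2, symmetric]) (simp add: V_def)
  moreover have "Sum_any (\<lambda>i. 2 *\<^sub>R btil g 0 (t i)) = 2 *\<^sub>R btil g 0 (ab 0 ?x)"
    using linear_Sum_any[OF lin fint] unfolding ab_def t_def by simp
  ultimately have "At g 0 ?x = Sum_any V + 2 *\<^sub>R btil g 0 (ab 0 ?x)"
    unfolding At_def A_def by simp
  then have "A0_rest g m = Sum_any V"
    unfolding A0_rest_def ab0_single[OF assms] by (simp add: btil_def single_W scaleR_single mult_scaleR_hol)
  then show ?thesis using homog_Sum_any[OF hV] by simp
qed

section \<open>The zero mode as a differential operator on coefficients\<close>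

definition dt :: "mat2 \<Rightarrow> hol \<Rightarrow> hol" where "dt g f = (1 / gam g) *\<^sub>R hD f"

lemma bbt_wscale: "gam g \<noteq> 0 \<Longrightarrow> bbt g n (wscale f w) = wscale f (bbt g n w)"
proof -
  assume g: "gam g \<noteq> 0"
  interpret heis "atil g" "btil g" by (rule heis_W[OF g])
  show ?thesis unfolding bbt_def bb_def linear_Sum_any[OF linear_W(6) finite_bb] by (simp add: wscale_btil)
qed

lemma atil_wscale: "i \<noteq> 0 \<Longrightarrow> atil g i (wscale f w) = wscale f (atil g i w)"
  by (auto simp: atil_def aW_def wmul_comm lin_W_simps)

text \<open>Multiplication by \<open>f\<close> commutes with all modes except
  \<open>atil g 0\<close>, and in the zero mode that one is accompanied by mode 0 of b(z)^2.\<close>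

lemma At0_wscale:
  assumes "gam g \<noteq> 0"
  shows "At g 0 (wscale f w) = wscale f (At g 0 w) + wscale (dt g f) (bbt g 0 w)"
proof -
  interpret heis "atil g" "btil g" by (rule heis_W[OF assms])
  have a0: "atil g 0 (wscale f w) = wscale f (atil g 0 w) + wscale (dt g f) w"
    by (simp add: atil_def aW_def wD_wscale dt_def wscale_scaleR lin_W_simps scaleR_add_right)
  have bw: "bb n (wscale f w) = wscale f (bb n w)" for n f w using bbt_wscale[OF assms] by (simp add: bbt_def)
  have eq: "Aterm 0 i (wscale f w) = wscale f (Aterm 0 i w) + (if i = 0 then wscale (dt g f) (bb 0 w) else 0)" for i
    by (cases "i = 0") (simp_all add: Aterm_def atil_wscale bw a0)
  have f1: "finite {i. wscale f (Aterm 0 i w) \<noteq> 0}"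
    by (rule finite_subset[OF _ finite_Aterm[of 0 w]]) (auto simp: linear_0[OF linear_W(6)])
  have f2: "finite {i. (if i = (0::int) then wscale (dt g f) (bb 0 w) else 0) \<noteq> 0}"
    by (rule finite_subset[of _ "{0}"]) auto
  have "Sum_any (\<lambda>i. Aterm 0 i (wscale f w)) = wscale f (Sum_any (\<lambda>i. Aterm 0 i w)) + wscale (dt g f) (bb 0 w)"
    unfolding eq Sum_any.distrib[OF f1 f2] by (simp add: linear_Sum_any[OF linear_W(6) finite_Aterm])
  then show ?thesis unfolding At_def A_def bbt_def by simp
qed

text \<open>The zero mode splits by level: a first-order operator preserving \<open>m\<close>, a
  part raising the level by 1 and a part raising it by 2 that sees the derivative of
  \<open>f\<close>.\<close>

lemma At0_single:
  assumes "gam g \<noteq> 0"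
  shows "At g 0 (single m f) = single m (U g 2 * dt g f + (2 * of_int (lev m)) *\<^sub>R (U g 1 * f)) +
     wscale f (A0_rest g m) + wscale (dt g f) (bb0_rest g m)"
proof -
  have "single m f = wscale f (single m 1)" by (simp add: single_W)
  then have "At g 0 (single m f) = wscale f (At g 0 (single m 1)) + wscale (dt g f) (bbt g 0 (single m 1))"
    using At0_wscale[OF assms] by simp
  also have "At g 0 (single m 1) = A0_rest g m + (2 * of_int (lev m)) *\<^sub>R single m (U g 1)" by (simp add: A0_rest_def)
  also have "bbt g 0 (single m 1) = bb0_rest g m + single m (U g 2)" by (simp add: bb0_rest_def)
  finally show ?thesis
    by (simp add: linear_add[OF linear_W(6)] lin_W_simps single_W scaleR_single single_add mult_scaleR_hol algebra_simps)
qed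

lemma lookup_At0_sum:
  assumes "gam g \<noteq> 0" "finite S"
  shows "lookup (At g 0 (\<Sum>m\<in>S. single m (f m))) m' =
    (if m' \<in> S then U g 2 * dt g (f m') + (2 * of_int (lev m')) *\<^sub>R (U g 1 * f m') else 0) +
    ((\<Sum>m\<in>S. f m * lookup (A0_rest g m) m') + (\<Sum>m\<in>S. dt g (f m) * lookup (bb0_rest g m) m'))"
proof -
  have "lookup (At g 0 (\<Sum>m\<in>S. single m (f m))) m' = (\<Sum>m\<in>S.
      (if m = m' then U g 2 * dt g (f m) + (2 * of_int (lev m)) *\<^sub>R (U g 1 * f m) else 0) +
      (f m * lookup (A0_rest g m) m' + dt g (f m) * lookup (bb0_rest g m) m'))"
    unfolding linear_sum[OF linear_At[OF assms(1)]] lookup_sum'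
    by (intro sum.cong refl) (simp add: At0_single[OF assms(1)] lookup_add lookup_single' add.assoc)
  also have "\<dots> = (\<Sum>m\<in>S. if m = m' then U g 2 * dt g (f m) + (2 * of_int (lev m)) *\<^sub>R (U g 1 * f m) else 0) +
      ((\<Sum>m\<in>S. f m * lookup (A0_rest g m) m') + (\<Sum>m\<in>S. dt g (f m) * lookup (bb0_rest g m) m'))"
    by (simp only: sum.distrib)
  finally show ?thesis using assms(2) by simp
qed

lemma scaleR_mult_hol: "(r *\<^sub>R f) * f' = r *\<^sub>R (f * f' :: hol)"
  by (rule hol_eqI) simp

lemma linear_hD: "linear hD"
  by (rule linearI) simp_all

lemma linear_hD_pow: "linear (hD ^^ k)"
proof (induction k)
  case 0
  then show ?case by (auto intro: linearI)
next
  case (Suc k)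
  then show ?case using linear_compose[OF Suc linear_hD] by (simp add: o_def)
qed

lemma hD_pow_hc: "(hD ^^ k) (hc z * \<phi>) = hc z * (hD ^^ k) \<phi>"
  by (induction k) (simp_all add: hD_mult)

lemma hD_pow_Suc: "(hD ^^ k) (hD \<phi>) = (hD ^^ Suc k) \<phi>"
  by (simp add: funpow_swap1)

text \<open>The normalisation of the derivatives in the theorem; by \<open>ps_U\<close> it turns
  \<gamma>/(\<gamma>\<tau>+\<delta>) into its own power of exponent k+1.\<close>

definition ps :: "nat \<Rightarrow> hol \<Rightarrow> hol" where
  "ps k \<phi> = hc ((- 1) ^ k / fact k) * (hD ^^ k) \<phi>"

lemma ps_coeff: "((- 1) ^ k / fact k :: complex) = - of_nat (Suc k) * ((- 1) ^ Suc k / fact (Suc k))"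
  by (simp add: field_simps del: of_nat_Suc)

lemma hD_ps: "hD (ps k \<phi>) = - real (Suc k) *\<^sub>R ps (Suc k) \<phi>"
proof -
  have "hD (ps k \<phi>) = hc ((- 1) ^ k / fact k) * (hD ^^ Suc k) \<phi>" by (simp add: ps_def hD_mult)
  also have "hc ((- 1) ^ k / fact k) = hc (- of_nat (Suc k)) * hc ((- 1) ^ Suc k / fact (Suc k))"
    by (subst ps_coeff) (rule hc_simps(4))
  finally show ?thesis by (simp add: ps_def scaleR_hc mult.assoc del: of_nat_Suc)
qed

lemma ps_hD: "ps k (hD \<phi>) = hD (ps k \<phi>)"
  by (simp add: ps_def hD_pow_Suc hD_mult)

lemma linear_ps: "linear (ps k)"
  by (rule linearI) (simp_all add: ps_def linear_add[OF linear_hD_pow] linear_scale[OF linear_hD_pow]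
     algebra_simps mult_scaleR_hol scaleR_mult_hol)

lemma linear_dt: "linear (dt g)"
  unfolding dt_def[abs_def] by (rule linear_compose_scale_right[OF linear_hD])

lemma U_mult: "gam g \<noteq> 0 \<Longrightarrow> e + e' = e'' \<Longrightarrow> U g e * U g e' = U g e''"
  using U_add[of g e e'] by simp

lemma U_mult': "gam g \<noteq> 0 \<Longrightarrow> e + e' = e'' \<Longrightarrow> U g e * (U g e' * f) = U g e'' * f"
  using U_mult[of g e e' e''] by (simp add: mult.assoc[symmetric])

text \<open>Leibniz's rule ends with the second derivative of a quadratic polynomial. For k = 0 the
  last coefficient is 0, so the truncated subtraction there is harmless.\<close>

lemma Leibniz_U2:
  assumes "gam g \<noteq> 0"
  shows "(hD ^^ Suc k) (U g 2 * \<phi>) = U g 2 * (hD ^^ Suc k) \<phi> + (2 * real (Suc k) * gam g) *\<^sub>R (U g 1 * (hD ^^ k) \<phi>) +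
     (real (Suc k) * real k * (gam g)\<^sup>2) *\<^sub>R (hD ^^ (k - 1)) \<phi>"
proof (induction k)
  case 0
  show ?case by (rule hol_eqI) (simp add: hD_mult hD_U[OF assms] algebra_simps)
next
  case (Suc k)
  define A where "A = (hD ^^ Suc k) \<phi>"
  define B where "B = (hD ^^ k) \<phi>"
  have hB: "hD B = A" by (simp add: A_def B_def)
  have h3: "(real (Suc k) * real k * (gam g)\<^sup>2) *\<^sub>R hD ((hD ^^ (k - 1)) \<phi>) = (real (Suc k) * real k * (gam g)\<^sup>2) *\<^sub>R B"
    by (cases k) (simp_all add: B_def)
  have "(hD ^^ Suc (Suc k)) (U g 2 * \<phi>) = hD (U g 2 * A + (2 * real (Suc k) * gam g) *\<^sub>R (U g 1 * B) +
     (real (Suc k) * real k * (gam g)\<^sup>2) *\<^sub>R (hD ^^ (k - 1)) \<phi>)"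
    using Suc unfolding A_def B_def by (simp only: funpow.simps o_apply)
  also have "\<dots> = (2 * gam g) *\<^sub>R (U g 1 * A) + U g 2 * hD A +
      (2 * real (Suc k) * gam g) *\<^sub>R (gam g *\<^sub>R B + U g 1 * A) + (real (Suc k) * real k * (gam g)\<^sup>2) *\<^sub>R B"
    using h3 by (simp only: hD_add hD_scaleR hD_mult hD_U[OF assms] hB)
      (simp add: U_0[OF assms] scaleR_hc mult.assoc)
  also have "\<dots> = U g 2 * hD A + (2 * real (Suc (Suc k)) * gam g) *\<^sub>R (U g 1 * A) +
     (real (Suc (Suc k)) * real (Suc k) * (gam g)\<^sup>2) *\<^sub>R B"
    by (rule hol_eqI) (simp add: algebra_simps power2_eq_square)
  finally show ?case by (simp add: A_def B_def)
qed

text \<open>With 2(k+1) = 2n the first two terms are the diagonal part of the zero mode at level n.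
  The last term is what the level-raising parts must produce, and this is the content of the
  recurrence.\<close>

lemma ps_dt:
  assumes "gam g \<noteq> 0"
  shows "ps k (dt g (U g 2 * \<phi>)) = U g 2 * dt g (ps k \<phi>) + (2 * real (Suc k)) *\<^sub>R (U g 1 * ps k \<phi>) -
     (if k = 0 then 0 else (real (Suc k) * gam g) *\<^sub>R ps (k - 1) \<phi>)"
proof -
  define a where "a = ((- 1) ^ k / fact k :: complex)"
  define c where "c = complex_of_real (gam g)"
  have c0: "c \<noteq> 0" using assms by (simp add: c_def)
  define A where "A = (hD ^^ Suc k) \<phi>"
  define B where "B = (hD ^^ k) \<phi>"
  define C where "C = (hD ^^ (k - 1)) \<phi>"
  have L: "ps k (dt g (U g 2 * \<phi>)) = hc a * ((1 / gam g) *\<^sub>R (U g 2 * A + (2 * real (Suc k) * gam g) *\<^sub>R (U g 1 * B) +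
     (real (Suc k) * real k * (gam g)\<^sup>2) *\<^sub>R C))"
    unfolding ps_def dt_def linear_scale[OF linear_hD_pow] hD_pow_Suc Leibniz_U2[OF assms] a_def A_def B_def C_def ..
  have D: "dt g (ps k \<phi>) = (1 / gam g) *\<^sub>R (hc a * A)"
    by (simp add: dt_def ps_def hD_mult a_def A_def)
  have E: "ps k \<phi> = hc a * B" by (simp add: ps_def a_def B_def)
  have F: "(if k = 0 then 0 else (real (Suc k) * gam g) *\<^sub>R ps (k - 1) \<phi>) =
      - (real (Suc k) * real k * gam g) *\<^sub>R (hc a * C)"
  proof (cases k)
    case (Suc j)
    have "hc ((- 1) ^ j / fact j) = hc (- of_nat (Suc j)) * hc a"
      unfolding a_def Suc by (subst ps_coeff) (rule hc_simps(4))
    then have "ps (k - 1) \<phi> = - real k *\<^sub>R (hc a * C)"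
      unfolding ps_def C_def Suc by (simp add: scaleR_hc mult.assoc del: of_nat_Suc)
    then show ?thesis using Suc by (simp add: mult_ac del: of_nat_Suc)
  qed simp
  show ?thesis unfolding F L D unfolding E
    by (rule hol_eqI) (use c0 assms in \<open>simp add: c_def[symmetric] field_simps power2_eq_square\<close>)
qed

lemma dt_U: "gam g \<noteq> 0 \<Longrightarrow> dt g (U g e) = of_int e *\<^sub>R U g (e - 1)"
  by (simp add: dt_def hD_U)

lemma dt_hc: "dt g (hc z * f) = hc z * dt g f"
  by (simp add: dt_def hD_mult mult_scaleR_hol)

text \<open>The order of the derivative of E attached to \<open>m\<close>; truncation occurs only at
  levels below 1, which carry no constants.\<close>

definition kk :: "mono \<Rightarrow> nat" where "kk m = nat (lev m) - 1"

section \<open>Recurrence for the structure constants\<close>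

text \<open>\<open>cc\<close> is the family produced by \<open>cc_exists\<close>; that it equals
  \<open>c0\<close> is shown in \<open>c0_eq\<close>.\<close>

locale cdo_inv =
  fixes m0 :: mono and cc :: "mono \<Rightarrow> complex"
  assumes pp0: "is_pp m0" and lev0: "lev m0 = 0"
    and finS: "finite {m. cc m \<noteq> 0}" and ccD: "cc m \<noteq> 0 \<Longrightarrow> is_pp m \<and> lev m \<ge> 1"
    and rep: "good g \<Longrightarrow> piT g m0 1 = single m0 1 +
       (\<Sum>m\<in>{m. cc m \<noteq> 0}. single m (hc (cc m) * ((gam g powi lev m) *\<^sub>R U g (- lev m))))"
begin

definition S0 :: "mono set" where "S0 = {m. cc m \<noteq> 0}"

text \<open>The leading monomial, at level 0 with constant 1, becomes part of one sum with the
  corrections.\<close>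

definition c1 :: "mono \<Rightarrow> complex" where "c1 m = (if m = m0 then 1 else cc m)"

definition Xs :: "mat2 \<Rightarrow> mono \<Rightarrow> hol" where
  "Xs g m' = (\<Sum>m\<in>insert m0 S0. hc (c1 m) * lookup (A0_rest g m) m')"

definition Ys :: "mat2 \<Rightarrow> mono \<Rightarrow> hol" where
  "Ys g m' = (\<Sum>m\<in>insert m0 S0. hc (c1 m) * lookup (bb0_rest g m) m')"

definition Xi :: "hol \<Rightarrow> W" where
  "Xi \<phi> = (\<Sum>m\<in>S0. single m (hc (cc m) * ps (kk m) \<phi>))"

lemma fS0: "finite S0" using finS by (simp add: S0_def)

lemma S0D: "m \<in> S0 \<Longrightarrow> is_pp m" "m \<in> S0 \<Longrightarrow> lev m \<ge> 1" "m \<in> S0 \<Longrightarrow> cc m \<noteq> 0"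
  using ccD by (auto simp: S0_def)

lemma m0_notin: "m0 \<notin> S0" using S0D(2)[of m0] lev0 by auto

lemma cc_notin: "m \<notin> S0 \<Longrightarrow> cc m = 0" by (simp add: S0_def)

lemma c1_S0: "m \<in> S0 \<Longrightarrow> c1 m = cc m" using m0_notin by (auto simp: c1_def)

lemma piT_c1:
  assumes "good g"
  shows "piT g m0 1 = (\<Sum>m\<in>insert m0 S0. single m (hc (c1 m) * ((gam g powi lev m) *\<^sub>R U g (- lev m))))"
proof -
  have "(\<Sum>m\<in>S0. single m (hc (c1 m) * ((gam g powi lev m) *\<^sub>R U g (- lev m)))) =
     (\<Sum>m\<in>S0. single m (hc (cc m) * ((gam g powi lev m) *\<^sub>R U g (- lev m))))"
    by (intro sum.cong refl) (simp add: c1_S0)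
  moreover have "single m0 (hc (c1 m0) * ((gam g powi lev m0) *\<^sub>R U g (- lev m0))) = single m0 1"
    using goodD[OF assms] by (simp add: c1_def lev0 U_0 hc_simps)
  ultimately show ?thesis using rep[OF assms] m0_notin fS0 unfolding S0_def[symmetric] by simp
qed

lemma A0_rest_lev: "gam g \<noteq> 0 \<Longrightarrow> is_pp m \<Longrightarrow> lookup (A0_rest g m) m' \<noteq> 0 \<Longrightarrow> lev m' = lev m + 1"
  using homog_A0_rest[of g m] unfolding homog_def by blast

lemma bb0_rest_lev: "gam g \<noteq> 0 \<Longrightarrow> lookup (bb0_rest g m) m' \<noteq> 0 \<Longrightarrow> lev m' = lev m + 2"
  using homog_bb0_rest[of g m] unfolding homog_def by blast

text \<open>The coefficient of \<open>m'\<close> in \<open>At g 0 (piT g m0 1) = 0\<close>. By the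
  level shifts of the three parts every summand carries the same power
  (\<gamma>\<tau>+\<delta>)^(1-n), which is divided out.\<close>

lemma cc_recurrence:
  assumes g: "good g" and n: "lev m' = n" "n \<ge> 1"
  shows "(of_int n * gam g powi n) *\<^sub>R hc (cc m') + (gam g powi (n - 1)) *\<^sub>R Xs g m' -
     (of_int (n - 2) * gam g powi (n - 2)) *\<^sub>R Ys g m' = 0"
proof -
  note g0 = goodD(1)[OF g]
  define f where "f m = hc (c1 m) * ((gam g powi lev m) *\<^sub>R U g (- lev m))" for m
  have dtf: "dt g (f m) = hc (c1 m) * ((- of_int (lev m) * gam g powi lev m) *\<^sub>R U g (- lev m - 1))" for m
    by (simp add: f_def dt_hc linear_scale[OF linear_dt] dt_U[OF g0] mult.commute)
  have "At g 0 (piT g m0 1) = 0"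
    using At0_piT[OF g pp0, of 1] linear_0[OF linear_piT[OF g]] by simp
  then have 0: "lookup (At g 0 (\<Sum>m\<in>insert m0 S0. single m (f m))) m' = 0"
    unfolding f_def piT_c1[OF g, symmetric] by simp
  \<comment> \<open>The factor n is 2n from the eigenvalue minus n from differentiating
    (\<gamma>\<tau>+\<delta>)^(-n).\<close>
  have main: "(if m' \<in> insert m0 S0 then U g 2 * dt g (f m') + (2 * of_int (lev m')) *\<^sub>R (U g 1 * f m') else 0) =
     U g (1 - n) * ((of_int n * gam g powi n) *\<^sub>R hc (cc m'))"
  proof (cases "m' \<in> S0")
    case True
    have u: "U g 2 * U g (- n - 1) = U g (1 - n)" "U g 1 * U g (- n) = U g (1 - n)"
      by (rule U_mult[OF g0], simp)+
    have "U g 2 * dt g (f m') = (- of_int n * gam g powi n) *\<^sub>R (hc (cc m') * (U g 2 * U g (- n - 1)))"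
      unfolding dtf n c1_S0[OF True] by (simp add: scaleR_hc mult_ac)
    moreover have "U g 1 * f m' = (gam g powi n) *\<^sub>R (hc (cc m') * (U g 1 * U g (- n)))"
      unfolding f_def n c1_S0[OF True] by (simp add: scaleR_hc mult_ac)
    ultimately show ?thesis using True unfolding u n
      by (intro hol_eqI) (simp add: algebra_simps)
  next
    case False
    then have "m' \<notin> insert m0 S0" "cc m' = 0" using n lev0 cc_notin by auto
    then show ?thesis by (simp add: hc_simps)
  qed
  have X: "(\<Sum>m\<in>insert m0 S0. f m * lookup (A0_rest g m) m') = U g (1 - n) * ((gam g powi (n - 1)) *\<^sub>R Xs g m')"
    unfolding Xs_def scaleR_right.sum sum_distrib_left
  proof (rule sum.cong[OF refl])
    fix m assume m: "m \<in> insert m0 S0"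
    show "f m * lookup (A0_rest g m) m' = U g (1 - n) * ((gam g powi (n - 1)) *\<^sub>R (hc (c1 m) * lookup (A0_rest g m) m'))"
    proof (cases "lookup (A0_rest g m) m' = 0")
      case False
      have "is_pp m" using m S0D(1) pp0 by blast
      from A0_rest_lev[OF g0 this False] n have "lev m = n - 1" by simp
      then show ?thesis unfolding f_def by (simp add: scaleR_hc mult_ac)
    qed simp
  qed
  have Y: "(\<Sum>m\<in>insert m0 S0. dt g (f m) * lookup (bb0_rest g m) m') =
     U g (1 - n) * ((- of_int (n - 2) * gam g powi (n - 2)) *\<^sub>R Ys g m')"
    unfolding Ys_def scaleR_right.sum sum_distrib_left
  proof (rule sum.cong[OF refl])
    fix m
    show "dt g (f m) * lookup (bb0_rest g m) m' =
       U g (1 - n) * ((- of_int (n - 2) * gam g powi (n - 2)) *\<^sub>R (hc (c1 m) * lookup (bb0_rest g m) m'))"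
    proof (cases "lookup (bb0_rest g m) m' = 0")
      case False
      from bb0_rest_lev[OF g0 False] n have l: "lev m = n - 2" by simp
      have "- lev m - 1 = 1 - n" using l by simp
      then show ?thesis unfolding dtf by (simp add: l scaleR_hc mult_ac)
    qed simp
  qed
  have "U g (1 - n) * ((of_int n * gam g powi n) *\<^sub>R hc (cc m') + (gam g powi (n - 1)) *\<^sub>R Xs g m' -
     (of_int (n - 2) * gam g powi (n - 2)) *\<^sub>R Ys g m') = 0"
    using 0 unfolding lookup_At0_sum[OF g0 finite_insert[THEN iffD2, OF fS0]] main X Y
    by (simp add: algebra_simps)
  then have "U g (n - 1) * (U g (1 - n) * ((of_int n * gam g powi n) *\<^sub>R hc (cc m') + (gam g powi (n - 1)) *\<^sub>R Xs g m' -
     (of_int (n - 2) * gam g powi (n - 2)) *\<^sub>R Ys g m')) = 0" by simp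
  then show ?thesis using U_mult'[OF g0, of "n - 1" "1 - n" 0] by (simp add: U_0[OF g0])
qed

lemma lookup_Xi: "lookup (Xi \<phi>) m = hc (cc m) * ps (kk m) \<phi>"
proof -
  have "lookup (Xi \<phi>) m = (\<Sum>m'\<in>S0. if m' = m then hc (cc m) * ps (kk m) \<phi> else 0)"
    unfolding Xi_def lookup_sum' by (intro sum.cong refl) (simp add: lookup_single')
  also have "\<dots> = hc (cc m) * ps (kk m) \<phi>"
    using fS0 cc_notin[of m] by (auto simp: hc_simps)
  finally show ?thesis .
qed

lemma linear_Xi: "linear Xi"
  by (rule linearI; rule poly_mapping_eqI)
     (simp_all add: lookup_Xi lookup_add linear_add[OF linear_ps] linear_scale[OF linear_ps] algebra_simps mult_scaleR_hol scaleR_mult_hol)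

text \<open>The contributions from levels n-1 and n-2 both reduce to
  \<open>ps (n - 2) \<phi>\<close>, so they combine through the recurrence for the constants and
  give exactly the last term of \<open>ps_dt\<close>.\<close>

lemma At0_Xi:
  assumes g: "good g"
  shows "At g 0 (Xi \<phi>) = Xi (dt g (U g 2 * \<phi>))"
proof (rule poly_mapping_eqI)
  fix m'
  note g0 = goodD(1)[OF g]
  define n where "n = lev m'"
  define f where "f m = hc (cc m) * ps (kk m) \<phi>" for m
  define k where "k = kk m'"
  define PX where "PX = (\<Sum>m\<in>S0. f m * lookup (A0_rest g m) m')"
  define PY where "PY = (\<Sum>m\<in>S0. dt g (f m) * lookup (bb0_rest g m) m')"
  have L: "lookup (At g 0 (Xi \<phi>)) m' =
     (if m' \<in> S0 then U g 2 * dt g (f m') + (2 * of_int n) *\<^sub>R (U g 1 * f m') else 0) + (PX + PY)"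
    unfolding Xi_def f_def[symmetric] lookup_At0_sum[OF g0 fS0] PX_def PY_def n_def ..
  have main: "(if m' \<in> S0 then U g 2 * dt g (f m') + (2 * of_int n) *\<^sub>R (U g 1 * f m') else 0) =
     hc (cc m') * (U g 2 * dt g (ps k \<phi>) + (2 * of_int n) *\<^sub>R (U g 1 * ps k \<phi>))"
    using cc_notin[of m'] by (auto simp: f_def dt_hc k_def hc_simps algebra_simps mult_scaleR_hol)
  show "lookup (At g 0 (Xi \<phi>)) m' = lookup (Xi (dt g (U g 2 * \<phi>))) m'"
  proof (cases "n \<ge> 2")
    \<comment> \<open>At level 1 the raising parts could only start from \<open>m0\<close>, which
      \<open>Xi\<close> does not contain; correspondingly the last term of \<open>ps_dt\<close> is
      absent for k = 0.\<close>
    case False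
    have "PX = 0" unfolding PX_def
    proof (rule sum.neutral, rule ballI)
      fix m assume m: "m \<in> S0"
      have "lookup (A0_rest g m) m' = 0"
        using A0_rest_lev[OF g0 S0D(1)[OF m], of m'] S0D(2)[OF m] False n_def by fastforce
      then show "f m * lookup (A0_rest g m) m' = 0" by simp
    qed
    moreover have "PY = 0" unfolding PY_def
    proof (rule sum.neutral, rule ballI)
      fix m assume m: "m \<in> S0"
      have "lookup (bb0_rest g m) m' = 0"
        using bb0_rest_lev[OF g0, of m m'] S0D(2)[OF m] False n_def by fastforce
      then show "dt g (f m) * lookup (bb0_rest g m) m' = 0" by simp
    qed
    moreover have "hc (cc m') * (U g 2 * dt g (ps k \<phi>) + (2 * of_int n) *\<^sub>R (U g 1 * ps k \<phi>)) =
       hc (cc m') * ps k (dt g (U g 2 * \<phi>))"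
    proof (cases "m' \<in> S0")
      case True
      then have "n = 1" using S0D(2)[OF True] False n_def by simp
      moreover have "k = 0" using \<open>n = 1\<close> by (simp add: k_def kk_def n_def)
      ultimately show ?thesis by (simp add: ps_dt[OF g0])
    qed (simp add: cc_notin hc_simps)
    ultimately show ?thesis unfolding L main lookup_Xi k_def by simp
  next
    case True
    define j where "j = nat (n - 2)"
    have k: "k = Suc j" "k \<noteq> 0" "k - 1 = j" "real (Suc k) = of_int n" using True by (auto simp: k_def kk_def n_def j_def)
    \<comment> \<open>The recurrence includes \<open>m0\<close> but \<open>Xi\<close> does not; from
      level 0 this part reaches level 1 only.\<close>
    have Xs: "Xs g m' = (\<Sum>m\<in>S0. hc (cc m) * lookup (A0_rest g m) m')"
    proof -
      have "lookup (A0_rest g m0) m' = 0" using A0_rest_lev[OF g0 pp0, of m'] lev0 True n_def by fastforce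
      then show ?thesis unfolding Xs_def using m0_notin fS0 by (simp add: c1_S0)
    qed
    have PX: "PX = ps j \<phi> * Xs g m'"
      unfolding PX_def Xs sum_distrib_left
    proof (rule sum.cong[OF refl])
      fix m assume m: "m \<in> S0"
      show "f m * lookup (A0_rest g m) m' = ps j \<phi> * (hc (cc m) * lookup (A0_rest g m) m')"
      proof (cases "lookup (A0_rest g m) m' = 0")
        case False
        from A0_rest_lev[OF g0 S0D(1)[OF m] False] have "kk m = j" by (simp add: kk_def j_def n_def nat_diff_distrib')
        then show ?thesis by (simp add: f_def mult_ac)
      qed simp
    qed
    have PY: "PY = - (of_int (n - 2) / gam g) *\<^sub>R (ps j \<phi> * Ys g m')"
    proof -
      have "PY = (\<Sum>m\<in>S0. - (of_int (n - 2) / gam g) *\<^sub>R (ps j \<phi> * (hc (cc m) * lookup (bb0_rest g m) m')))"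
        unfolding PY_def
      proof (rule sum.cong[OF refl])
        fix m assume m: "m \<in> S0"
        show "dt g (f m) * lookup (bb0_rest g m) m' = - (of_int (n - 2) / gam g) *\<^sub>R (ps j \<phi> * (hc (cc m) * lookup (bb0_rest g m) m'))"
        proof (cases "lookup (bb0_rest g m) m' = 0")
          case False
          from bb0_rest_lev[OF g0 False] have l: "lev m = n - 2" by (simp add: n_def)
          then have e: "real (Suc (kk m)) = of_int (n - 2)" "Suc (kk m) = j" using S0D(2)[OF m] by (auto simp: kk_def j_def)
          have gen: "(1 / x) *\<^sub>R (- y *\<^sub>R w) = - (y / x) *\<^sub>R w" for x y and w :: hol by simp
          have "dt g (ps (kk m) \<phi>) = - (of_int (n - 2) / gam g) *\<^sub>R ps j \<phi>"
            unfolding dt_def hD_ps e(1) unfolding e(2) gen ..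
          then have "dt g (f m) = hc (cc m) * (- (of_int (n - 2) / gam g) *\<^sub>R ps j \<phi>)"
            by (simp only: f_def dt_hc)
          then show ?thesis by (simp add: scaleR_hc mult_ac)
        qed simp
      qed
      also have "\<dots> = - (of_int (n - 2) / gam g) *\<^sub>R (ps j \<phi> * (\<Sum>m\<in>S0. hc (cc m) * lookup (bb0_rest g m) m'))"
        by (simp only: scaleR_right.sum sum_distrib_left)
      \<comment> \<open>Here \<open>m0\<close> does contribute at level 2, and there the factor n -
        2 vanishes.\<close>
      also have "\<dots> = - (of_int (n - 2) / gam g) *\<^sub>R (ps j \<phi> * Ys g m')"
      proof (cases "n = 2")
        case False
        have "lookup (bb0_rest g m0) m' = 0" using bb0_rest_lev[OF g0, of m0 m'] lev0 False n_def by fastforce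
        then have "Ys g m' = (\<Sum>m\<in>S0. hc (cc m) * lookup (bb0_rest g m) m')"
          unfolding Ys_def using m0_notin fS0 by (simp add: c1_S0)
        then show ?thesis by simp
      qed simp
      finally show ?thesis .
    qed
    have rc: "Xs g m' - (of_int (n - 2) / gam g) *\<^sub>R Ys g m' = - (of_int n * gam g) *\<^sub>R hc (cc m')"
    proof -
      have p: "gam g powi n = gam g powi (n - 1) * gam g" "gam g powi (n - 2) = gam g powi (n - 1) / gam g"
        using g0 by (simp_all add: power_int_diff power2_eq_square)
      have nz: "gam g powi (n - 1) \<noteq> 0" using g0 by simp
      have "(gam g powi (n - 1)) *\<^sub>R ((of_int n * gam g) *\<^sub>R hc (cc m') + Xs g m' - (of_int (n - 2) / gam g) *\<^sub>R Ys g m') = 0"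
        using cc_recurrence[OF g n_def[symmetric]] True unfolding p by (simp add: scaleR_add_right scaleR_diff_right mult_ac)
      then have "(of_int n * gam g) *\<^sub>R hc (cc m') + Xs g m' - (of_int (n - 2) / gam g) *\<^sub>R Ys g m' = 0"
        using nz unfolding scaleR_eq_0_iff by blast
      then show ?thesis by (simp add: algebra_simps eq_neg_iff_add_eq_0)
    qed
    have "PX + PY = ps j \<phi> * (Xs g m' - (of_int (n - 2) / gam g) *\<^sub>R Ys g m')"
      unfolding PX PY by (simp add: right_diff_distrib mult_scaleR_hol)
    also have "\<dots> = hc (cc m') * (- ((of_int n * gam g) *\<^sub>R ps j \<phi>))"
      unfolding rc by (simp add: scaleR_hc mult_ac hc_simps(5))
    finally have "lookup (At g 0 (Xi \<phi>)) m' = hc (cc m') *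
       (U g 2 * dt g (ps k \<phi>) + (2 * of_int n) *\<^sub>R (U g 1 * ps k \<phi>) - (of_int n * gam g) *\<^sub>R ps j \<phi>)"
      unfolding L main by (simp add: algebra_simps)
    also have "\<dots> = hc (cc m') * ps k (dt g (U g 2 * \<phi>))"
      unfolding ps_dt[OF g0] using k by (simp del: of_nat_Suc)
    finally show ?thesis unfolding lookup_Xi k_def .
  qed
qed

end

section \<open>Equivariance of the correction terms\<close>

lemma elc_U:
  assumes "gam g \<noteq> 0" "d + e = d'"
  shows "U g e * elc d g \<phi> n k = elc d' g \<phi> n k"
proof -
  have "U g e * (U g (d - n - int k) * hcomp g ((hD ^^ k) \<phi>)) = U g (d' - n - int k) * hcomp g ((hD ^^ k) \<phi>)"
    by (rule U_mult'[OF assms(1)]) (use assms(2) in simp)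
  then show ?thesis unfolding elc_def by (simp only: mult_scaleR_hol)
qed

lemma elc_hD:
  assumes "gam g \<noteq> 0"
  shows "elc (- 1) g (hD \<phi>) n k = gam g *\<^sub>R elc 0 g \<phi> n (Suc k)"
proof -
  have 1: "gam g powi (n - int k) = gam g * gam g powi (n - int (Suc k))"
    using power_int_add_1'[of "gam g" "n - int (Suc k)"] assms by simp
  have 2: "- 1 - n - int k = 0 - n - int (Suc k)" by simp
  show ?thesis unfolding elc_def 1 2 hD_pow_Suc scaleR_scaleR ..
qed

text \<open>The eigenvalue 2n meets the exponent -1-n-k of \<gamma>\<tau>+\<delta>. The resulting
  factor n - 1 - k vanishes exactly for n - k = 1, which is why only the leading part of a solution
  is free.\<close>

lemma elc_0_dt:
  assumes "good g"
  shows "U g 2 * dt g (elc (- 1) g \<phi> n k) + (2 * of_int n) *\<^sub>R (U g 1 * elc (- 1) g \<phi> n k) =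
    elc 0 g \<phi> n (Suc k) + of_int (n - 1 - int k) *\<^sub>R elc 0 g \<phi> n k"
proof -
  note g0 = goodD(1)[OF assms]
  have "dt g (elc (- 1) g \<phi> n k) = elc (- 2) g \<phi> n (Suc k) + of_int (- 1 - n - int k) *\<^sub>R elc (- 2) g \<phi> n k"
    unfolding dt_def using hD_elc[OF assms, of "- 1" \<phi> n k] by simp
  then have e1: "U g 2 * dt g (elc (- 1) g \<phi> n k) = elc 0 g \<phi> n (Suc k) + of_int (- 1 - n - int k) *\<^sub>R elc 0 g \<phi> n k"
    by (simp add: distrib_left mult_scaleR_hol elc_U[OF g0])
  have e2: "U g 1 * elc (- 1) g \<phi> n k = elc 0 g \<phi> n k" by (rule elc_U[OF g0]) simp
  show ?thesis unfolding e1 e2 by (rule hol_eqI) (simp add: algebra_simps)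
qed

lemma hD_pow_power:
  assumes "k \<le> K"
  shows "(hD ^^ k) (hol_of (\<lambda>z. (z - z0) ^ K)) = hol_of (\<lambda>z. fact K / fact (K - k) * (z - z0) ^ (K - k))"
  using assms
proof (induction k)
  case (Suc k)
  have hol: "(\<lambda>z. c * (z - z0) ^ j) holomorphic_on UH" for c j by (intro holomorphic_intros)
  have f: "(fact (K - k) :: complex) = of_nat (K - k) * fact (K - Suc k)"
    using Suc.prems by (metis Suc_diff_Suc Suc_le_lessD fact_Suc)
  have nz: "of_nat (K - k) \<noteq> (0::complex)" using Suc.prems by simp
  have "(hD ^^ Suc k) (hol_of (\<lambda>z. (z - z0) ^ K)) = hD (hol_of (\<lambda>z. fact K / fact (K - k) * (z - z0) ^ (K - k)))"
    using Suc by simp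
  also have "\<dots> = hol_of (\<lambda>z. fact K / fact (K - Suc k) * (z - z0) ^ (K - Suc k))"
  proof (rule hD_of[OF hol hol])
    fix z
    show "((\<lambda>z. fact K / fact (K - k) * (z - z0) ^ (K - k)) has_field_derivative
        fact K / fact (K - Suc k) * (z - z0) ^ (K - Suc k)) (at z)"
      by (rule derivative_eq_intros refl)+ (use nz in \<open>simp add: f\<close>)
  qed
  finally show ?case .
qed simp

text \<open>On a monomial of lowest level the raising parts contribute nothing, so the equation
  reduces to the diagonal part. The terms with raised jets cancel between the two sides, leaving the
  terms weighted by n - 1 - k, which is nonzero since n - k \<ge> 2.\<close>

lemma J_vanish:
  assumes "J (- 1) 2 T" "good g" "\<And>\<phi>. At g 0 (T g \<phi>) = (1 / gam g) *\<^sub>R T g (hD \<phi>)"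
  shows "T g \<phi> = 0"
proof -
  note g = goodD[OF assms(2)]
  obtain S c where S: "finite S" "\<forall>(m, k)\<in>S. is_pp m \<and> lev m - int k \<ge> 2"
     "\<And>\<phi>. T g \<phi> = (\<Sum>x\<in>S. wscale (hc (c x)) (el (- 1) g \<phi> x))"
    using assms(1,2) unfolding J_def by blast
  define S' where "S' = {x\<in>S. c x \<noteq> 0}"
  have fS': "finite S'" using S(1) by (simp add: S'_def)
  have S'D: "is_pp (fst x)" "lev (fst x) - int (snd x) \<ge> 2" "c x \<noteq> 0" if "x \<in> S'" for x
    using S(2) that by (auto simp: S'_def)
  have TS: "T g \<phi> = (\<Sum>x\<in>S'. wscale (hc (c x)) (el (- 1) g \<phi> x))" for \<phi>
    unfolding S(3) by (rule sum.mono_neutral_right) (use S(1) in \<open>auto simp: S'_def hc_simps\<close>)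
  have "S' = {}"
  proof (rule ccontr)
    assume ne: "S' \<noteq> {}"
    define n where "n = Min ((\<lambda>x. lev (fst x)) ` S')"
    have "n \<in> (\<lambda>x. lev (fst x)) ` S'" unfolding n_def using fS' ne by (intro Min_in) auto
    then obtain x1 where x1: "x1 \<in> S'" "lev (fst x1) = n" by auto
    define m where "m = fst x1"
    have n: "lev m = n" using x1 by (simp add: m_def)
    have min: "n \<le> lev (fst x)" if "x \<in> S'" for x unfolding n_def using fS' that by (intro Min_le) auto
    define M where "M = fst ` S'"
    define Am where "Am m' = {x. x \<in> S' \<and> fst x = m'}" for m'
    define f where "f \<phi> m' = (\<Sum>x\<in>Am m'. hc (c x) * elc (- 1) g \<phi> (lev m') (snd x))" for \<phi> m'
    have fM: "finite M" and mM: "m \<in> M" using fS' x1 by (auto simp: M_def m_def)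
    have TM: "T g \<phi> = (\<Sum>m'\<in>M. single m' (f \<phi> m'))" for \<phi>
    proof -
      have "T g \<phi> = (\<Sum>m'\<in>M. \<Sum>x\<in>Am m'. wscale (hc (c x)) (el (- 1) g \<phi> x))"
        unfolding TS M_def Am_def by (rule sum.image_gen[OF fS'])
      also have "\<dots> = (\<Sum>m'\<in>M. single m' (f \<phi> m'))"
      proof (rule sum.cong[OF refl])
        fix m'
        have "wscale (hc (c x)) (el (- 1) g \<phi> x) = single m' (hc (c x) * elc (- 1) g \<phi> (lev m') (snd x))" if "x \<in> Am m'" for x
          using that el_elc[of "- 1" g \<phi> m' "snd x"] by (cases x) (auto simp: Am_def single_W)
        then have "(\<Sum>x\<in>Am m'. wscale (hc (c x)) (el (- 1) g \<phi> x)) =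
           (\<Sum>x\<in>Am m'. single m' (hc (c x) * elc (- 1) g \<phi> (lev m') (snd x)))" by (intro sum.cong) auto
        also have "\<dots> = single m' (f \<phi> m')"
          unfolding f_def by (rule poly_mapping_eqI) (simp add: lookup_sum' lookup_single')
        finally show "(\<Sum>x\<in>Am m'. wscale (hc (c x)) (el (- 1) g \<phi> x)) = single m' (f \<phi> m')" .
      qed
      finally show ?thesis .
    qed
    have vanish: "(\<Sum>x\<in>Am m. hc (c x) * (of_int (n - 1 - int (snd x)) *\<^sub>R elc 0 g \<phi> n (snd x))) = 0" for \<phi>
    proof -
      have X0: "lookup (A0_rest g m') m = 0" if mM': "m' \<in> M" for m'
      proof (rule ccontr)
        assume "lookup (A0_rest g m') m \<noteq> 0"
        moreover obtain x where "x \<in> S'" "m' = fst x" using mM' unfolding M_def by blast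
        moreover from this have "is_pp m'" "n \<le> lev m'" using S'D(1)[of x] min[of x] by auto
        moreover from this have "homog (lev m' + 1) (A0_rest g m')" using homog_A0_rest[OF g(1)] by blast
        ultimately have "lev m = lev m' + 1" "n \<le> lev m'" unfolding homog_def by blast+
        then show False using n by linarith
      qed
      have Y0: "lookup (bb0_rest g m') m = 0" if mM': "m' \<in> M" for m'
      proof (rule ccontr)
        assume "lookup (bb0_rest g m') m \<noteq> 0"
        moreover obtain x where "x \<in> S'" "m' = fst x" using mM' unfolding M_def by blast
        moreover from this have "n \<le> lev m'" using min[of x] by auto
        ultimately have "lev m = lev m' + 2" "n \<le> lev m'" using homog_bb0_rest[OF g(1), of m'] unfolding homog_def by blast+
        then show False using n by linarith
      qed
      have "lookup (At g 0 (T g \<phi>)) m = U g 2 * dt g (f \<phi> m) + (2 * of_int n) *\<^sub>R (U g 1 * f \<phi> m)"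
        unfolding TM lookup_At0_sum[OF g(1) fM] using mM X0 Y0 n by simp
      also have "\<dots> = (\<Sum>x\<in>Am m. hc (c x) * (U g 2 * dt g (elc (- 1) g \<phi> n (snd x)) +
          (2 * of_int n) *\<^sub>R (U g 1 * elc (- 1) g \<phi> n (snd x))))"
        unfolding f_def n linear_sum[OF linear_dt] dt_hc sum_distrib_left scaleR_right.sum sum.distrib[symmetric]
        by (intro sum.cong refl) (simp add: scaleR_hc algebra_simps)
      also have "\<dots> = (\<Sum>x\<in>Am m. hc (c x) * elc 0 g \<phi> n (Suc (snd x))) +
          (\<Sum>x\<in>Am m. hc (c x) * (of_int (n - 1 - int (snd x)) *\<^sub>R elc 0 g \<phi> n (snd x)))"
        unfolding elc_0_dt[OF assms(2)] distrib_left sum.distrib ..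
      finally have 1: "lookup (At g 0 (T g \<phi>)) m = (\<Sum>x\<in>Am m. hc (c x) * elc 0 g \<phi> n (Suc (snd x))) +
          (\<Sum>x\<in>Am m. hc (c x) * (of_int (n - 1 - int (snd x)) *\<^sub>R elc 0 g \<phi> n (snd x)))" .
      have "lookup ((1 / gam g) *\<^sub>R T g (hD \<phi>)) m = (1 / gam g) *\<^sub>R f (hD \<phi>) m"
        unfolding TM using mM fM by (simp add: lookup_sum' lookup_single')
      also have "\<dots> = (\<Sum>x\<in>Am m. hc (c x) * elc 0 g \<phi> n (Suc (snd x)))"
        unfolding f_def n scaleR_right.sum elc_hD[OF g(1)]
        using g(1) by (intro sum.cong refl) (simp add: mult_scaleR_hol)
      finally show ?thesis using 1 assms(3)[of \<phi>] by simp
    qed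
    define K where "K = snd ` Am m"
    have fA: "finite (Am m)" using fS' by (simp add: Am_def)
    have "x1 \<in> Am m" using x1 by (simp add: Am_def m_def)
    then have "Max K \<in> K" using fA unfolding K_def by (intro Max_in) auto
    then obtain x0 where x0: "x0 \<in> Am m" "snd x0 = Max K" by (auto simp: K_def)
    define k0 where "k0 = snd x0"
    have k0: "snd x \<le> k0" if "x \<in> Am m" for x unfolding k0_def x0 using that fA by (auto simp: K_def)
    have other: "snd x < k0" if "x \<in> Am m" "x \<noteq> x0" for x
    proof -
      have "fst x = fst x0" using that x0 by (simp add: Am_def)
      then have "snd x \<noteq> snd x0" using that(2) by (simp add: prod_eq_iff)
      then show ?thesis using k0[OF that(1)] by (simp add: k0_def)
    qed
    \<comment> \<open>a test function whose jets of order below \<open>k0\<close> vanish at \<open>z0\<close> isolates the jet of highest order\<close>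
    define z0 where "z0 = mob g \<i>"
    have z0: "Im z0 > 0" using Im_mob[OF g(2)] by (simp add: z0_def)
    define \<phi>0 where "\<phi>0 = hol_of (\<lambda>z. (z - z0) ^ k0)"
    have hol: "(\<lambda>z. a * (z - z0) ^ j) holomorphic_on UH" for a j by (intro holomorphic_intros)
    have ev: "hv ((hD ^^ k) \<phi>0) z0 = (if k = k0 then fact k0 else 0)" if "k \<le> k0" for k
      unfolding \<phi>0_def hD_pow_power[OF that] using that z0 by (subst hv_hol_of[OF hol]) auto
    have hve: "hv (elc 0 g \<phi>0 n k) \<i> = of_real (gam g powi (n - int k)) * (den g \<i> powi (0 - n - int k) *
        hv ((hD ^^ k) \<phi>0) z0)" for k
      unfolding elc_def by (simp add: hv_U g hv_hcomp z0_def)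
    have "0 = hv (\<Sum>x\<in>Am m. hc (c x) * (of_int (n - 1 - int (snd x)) *\<^sub>R elc 0 g \<phi>0 n (snd x))) \<i>"
      unfolding vanish by simp
    also have "\<dots> = (\<Sum>x\<in>Am m. c x * (of_int (n - 1 - int (snd x)) * hv (elc 0 g \<phi>0 n (snd x)) \<i>))"
      by (simp add: hv_sum)
    also have "\<dots> = (\<Sum>x\<in>Am m. if x = x0 then c x0 * (of_int (n - 1 - int k0) * hv (elc 0 g \<phi>0 n k0) \<i>) else 0)"
    proof (rule sum.cong[OF refl])
      fix x assume x: "x \<in> Am m"
      show "c x * (of_int (n - 1 - int (snd x)) * hv (elc 0 g \<phi>0 n (snd x)) \<i>) =
         (if x = x0 then c x0 * (of_int (n - 1 - int k0) * hv (elc 0 g \<phi>0 n k0) \<i>) else 0)"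
      proof (cases "x = x0")
        case True
        then show ?thesis by (simp add: k0_def)
      next
        case False
        have "hv ((hD ^^ snd x) \<phi>0) z0 = 0" using ev[of "snd x"] other[OF x False] by simp
        then show ?thesis using False by (simp add: hve)
      qed
    qed
    also have "\<dots> = c x0 * (of_int (n - 1 - int k0) * hv (elc 0 g \<phi>0 n k0) \<i>)" using fA x0 by simp
    finally have z: "c x0 * (of_int (n - 1 - int k0) * hv (elc 0 g \<phi>0 n k0) \<i>) = 0" by simp
    have x0S: "x0 \<in> S'" "fst x0 = m" using x0 by (auto simp: Am_def)
    have "c x0 \<noteq> 0" "n - 1 - int k0 \<noteq> 0" using S'D(2,3)[OF x0S(1)] x0S(2) n by (auto simp: k0_def)
    moreover have "hv (elc 0 g \<phi>0 n k0) \<i> \<noteq> 0"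
      unfolding hve using ev[of k0] g den_nz[OF g(1), of \<i>] by simp
    ultimately show False using z by (simp only: mult_eq_0_iff of_int_eq_0_iff) blast
  qed
  then show ?thesis unfolding TS by simp
qed

lemma J_hc: "J d r T \<Longrightarrow> J d r (\<lambda>g \<phi>. T g (hc z * \<phi>))"
proof -
  assume "J d r T"
  then obtain S c where S: "finite S" "\<forall>(m, k)\<in>S. is_pp m \<and> lev m - int k \<ge> r"
     "\<And>g \<phi>. good g \<Longrightarrow> T g \<phi> = (\<Sum>x\<in>S. wscale (hc (c x)) (el d g \<phi> x))"
    unfolding J_def by blast
  have e: "el d g (hc z * \<phi>) x = wscale (hc z) (el d g \<phi> x)" if "good g" for g \<phi> x
    using goodD[OF that] by (cases x) (simp add: el_def hD_pow_hc hcomp_simps single_W mult_scaleR_hol mult.left_commute)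
  have "J d r (\<lambda>g \<phi>. wscale (hc z) (T g \<phi>))" by (rule J_scale) fact
  then show ?thesis
  proof (rule J_cong)
    fix g \<phi> assume g: "good g"
    show "T g (hc z * \<phi>) = wscale (hc z) (T g \<phi>)"
      unfolding S(3)[OF g] e[OF g]
      unfolding linear_sum[OF linear_W(6)] wscale_wscale mult.commute[of "hc z"] ..
  qed
qed

lemma atil0_pow_single: "(atil g 0 ^^ k) (single m f) = single m ((1 / gam g) ^ k *\<^sub>R (hD ^^ k) f)"
  by (induction k) (simp_all add: atil_def aW_def single_W scaleR_single)

text \<open>Start from weight lev m - 2, where \<open>el\<close> of order 0 is \<gamma>^(lev m)
  (\<gamma>\<tau>+\<delta>)^(-2) \<phi>(g\<tau>), and apply the rescaled \<open>a_0\<close> k times: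
  the weight drops to -1 and one factor \<gamma> remains.\<close>

lemma JL_single_pow:
  assumes "is_pp m" "lev m = int k + 1"
  shows "JL m k (- 1) (\<lambda>g \<phi>. gam g *\<^sub>R single m ((hD ^^ k) (U g (- 2) * hcomp g \<phi>)))"
proof -
  have "JL m j (lev m - 2 - int j) (\<lambda>g \<phi>. (atil g 0 ^^ j) (el (lev m - 2) g \<phi> (m, 0)))" for j
  proof (induction j)
    case 0
    show ?case using JL_el[OF assms(1), of 0 "lev m - 2"] by simp
  next
    case (Suc j)
    from JL_a0[OF Suc] show ?case by (simp add: diff_diff_eq add.commute)
  qed
  from this[of k] have "JL m k (- 1) (\<lambda>g \<phi>. (atil g 0 ^^ k) (el (lev m - 2) g \<phi> (m, 0)))"
    using assms(2) by simp
  then show ?thesis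
  proof (rule JL_cong)
    fix g \<phi> assume g: "good g"
    have "(1 / gam g) ^ k * gam g powi lev m = gam g"
      using goodD[OF g] unfolding assms(2) by (simp add: power_int_add power_divide)
    moreover have "el (lev m - 2) g \<phi> (m, 0) = single m ((gam g powi lev m) *\<^sub>R (U g (- 2) * hcomp g \<phi>))"
      by (simp add: el_def)
    ultimately show "gam g *\<^sub>R single m ((hD ^^ k) (U g (- 2) * hcomp g \<phi>)) = (atil g 0 ^^ k) (el (lev m - 2) g \<phi> (m, 0))"
      by (simp add: atil0_pow_single linear_scale[OF linear_hD_pow] scaleR_single)
  qed
qed

context cdo_inv
begin

text \<open>The image of \<open>Xi \<phi>\<close> under g; the power of \<gamma> converts
  \<open>piT\<close> to the true action.\<close>

definition piXi :: "mat2 \<Rightarrow> hol \<Rightarrow> W" where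
  "piXi g \<phi> = (\<Sum>m\<in>S0. (gam g powi (- lev m)) *\<^sub>R piT g m (hc (cc m) * ps (kk m) \<phi>))"

definition Xi_defect :: "mat2 \<Rightarrow> hol \<Rightarrow> W" where
  "Xi_defect g \<phi> = piXi g \<phi> - Xi (U g (- 2) * hcomp g \<phi>)"

lemma At0_Xi_defect:
  assumes g: "good g"
  shows "At g 0 (Xi_defect g \<phi>) = (1 / gam g) *\<^sub>R Xi_defect g (hD \<phi>)"
proof -
  note g0 = goodD(1)[OF g]
  have 1: "At g 0 (piXi g \<phi>) = (1 / gam g) *\<^sub>R piXi g (hD \<phi>)"
    unfolding piXi_def linear_sum[OF linear_At[OF g0]] scaleR_right.sum
  proof (rule sum.cong[OF refl])
    fix m assume m: "m \<in> S0"
    have "hD (hc (cc m) * ps (kk m) \<phi>) = hc (cc m) * ps (kk m) (hD \<phi>)" by (simp add: hD_mult ps_hD)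
    then show "At g 0 ((gam g powi (- lev m)) *\<^sub>R piT g m (hc (cc m) * ps (kk m) \<phi>)) =
       (1 / gam g) *\<^sub>R (gam g powi (- lev m)) *\<^sub>R piT g m (hc (cc m) * ps (kk m) (hD \<phi>))"
      unfolding linear_scale[OF linear_At[OF g0]] At0_piT[OF g S0D(1)[OF m]]
      by (simp only: scaleR_scaleR mult.commute)
  qed
  have "U g 2 * (U g (- 2) * hcomp g \<phi>) = hcomp g \<phi>"
    using U_mult'[OF g0, of 2 "- 2" 0] by (simp add: U_0[OF g0])
  moreover have "dt g (hcomp g \<phi>) = (1 / gam g) *\<^sub>R (U g (- 2) * hcomp g (hD \<phi>))"
    unfolding dt_def hD_hcomp[OF goodD(2)[OF g] g0] ..
  ultimately have 2: "At g 0 (Xi (U g (- 2) * hcomp g \<phi>)) = (1 / gam g) *\<^sub>R Xi (U g (- 2) * hcomp g (hD \<phi>))"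
    unfolding At0_Xi[OF g] by (simp only: linear_scale[OF linear_Xi])
  show ?thesis unfolding Xi_defect_def linear_diff[OF linear_At[OF g0]] 1 2 by (simp only: scaleR_diff_right)
qed

text \<open>For each monomial both halves have the leading term
  \<open>el (- 1) g \<phi> (m, kk m)\<close>, with n - k = 1, so their difference starts at 2. The
  extra factor \<gamma> matches the powers of \<gamma>, because lev m = kk m + 1.\<close>

lemma J_Xi_defect: "J (- 1) 2 (\<lambda>g \<phi>. gam g *\<^sub>R Xi_defect g \<phi>)"
proof -
  define TT where "TT m g \<phi> = (gam g powi (- int (kk m))) *\<^sub>R piT g m ((hD ^^ kk m) \<phi>) -
     gam g *\<^sub>R single m ((hD ^^ kk m) (U g (- 2) * hcomp g \<phi>))" for m g \<phi>
  define zc where "zc m = cc m * ((- 1) ^ kk m / fact (kk m))" for m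
  have J1: "J (- 1) 2 (TT m)" if m: "m \<in> S0" for m
  proof -
    have lv: "lev m = int (kk m) + 1" using S0D(2)[OF m] by (simp add: kk_def)
    have "JL m (kk m) (int (kk m) - lev m) (\<lambda>g \<phi>. (gam g powi (- int (kk m))) *\<^sub>R piT g m ((hD ^^ kk m) \<phi>))"
      by (rule JL_piT[OF S0D(1)[OF m]])
    then have A: "J (- 1) 2 (\<lambda>g \<phi>. (gam g powi (- int (kk m))) *\<^sub>R piT g m ((hD ^^ kk m) \<phi>) - el (- 1) g \<phi> (m, kk m))"
      by (simp add: JL_def lv)
    have B: "J (- 1) 2 (\<lambda>g \<phi>. gam g *\<^sub>R single m ((hD ^^ kk m) (U g (- 2) * hcomp g \<phi>)) - el (- 1) g \<phi> (m, kk m))"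
      using JL_single_pow[OF S0D(1)[OF m] lv] by (simp add: JL_def lv)
    show ?thesis using J_diff[OF A B] unfolding TT_def by simp
  qed
  have "J (- 1) 2 (\<lambda>g \<phi>. \<Sum>m\<in>S0. TT m g (hc (zc m) * \<phi>))"
    by (rule J_sum, rule J_hc, rule J1)
  then show ?thesis
  proof (rule J_cong)
    fix g \<phi> assume g: "good g"
    note g0 = goodD(1)[OF g]
    have z: "hc (cc m) * ps (kk m) \<psi> = (hD ^^ kk m) (hc (zc m) * \<psi>)" for m \<psi>
      unfolding hD_pow_hc unfolding ps_def zc_def hc_simps(4) mult.assoc ..
    have "gam g *\<^sub>R Xi_defect g \<phi> = (\<Sum>m\<in>S0. gam g *\<^sub>R ((gam g powi (- lev m)) *\<^sub>R piT g m (hc (cc m) * ps (kk m) \<phi>)) -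
        gam g *\<^sub>R single m (hc (cc m) * ps (kk m) (U g (- 2) * hcomp g \<phi>)))"
      unfolding Xi_defect_def piXi_def Xi_def scaleR_diff_right scaleR_right.sum sum_subtractf ..
    also have "\<dots> = (\<Sum>m\<in>S0. TT m g (hc (zc m) * \<phi>))"
    proof (rule sum.cong[OF refl])
      fix m assume m: "m \<in> S0"
      have lv: "lev m = int (kk m) + 1" using S0D(2)[OF m] by (simp add: kk_def)
      have p: "gam g * gam g powi (- lev m) = gam g powi (- int (kk m))"
        using g0 power_int_add_1'[of "gam g" "- lev m"] by (simp add: lv)
      have h: "U g (- 2) * hcomp g (hc (zc m) * \<phi>) = hc (zc m) * (U g (- 2) * hcomp g \<phi>)"
        using goodD[OF g] by (simp add: hcomp_simps mult.left_commute)
      show "gam g *\<^sub>R ((gam g powi (- lev m)) *\<^sub>R piT g m (hc (cc m) * ps (kk m) \<phi>)) -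
        gam g *\<^sub>R single m (hc (cc m) * ps (kk m) (U g (- 2) * hcomp g \<phi>)) = TT m g (hc (zc m) * \<phi>)"
        unfolding TT_def z h scaleR_scaleR p ..
    qed
    finally show "gam g *\<^sub>R Xi_defect g \<phi> = (\<Sum>m\<in>S0. TT m g (hc (zc m) * \<phi>))" .
  qed
qed

text \<open>Equivariance of \<open>Xi\<close> for the weight 2 action on functions: the defect
  solves the equation of \<open>J_vanish\<close> and has no leading part.\<close>

lemma piXi_eq:
  assumes g: "good g"
  shows "piXi g \<phi> = Xi (U g (- 2) * hcomp g \<phi>)"
proof -
  note g0 = goodD(1)[OF g]
  have "gam g *\<^sub>R Xi_defect g \<phi> = 0"
  proof (rule J_vanish[OF J_Xi_defect g])
    fix \<phi>
    show "At g 0 (gam g *\<^sub>R Xi_defect g \<phi>) = (1 / gam g) *\<^sub>R gam g *\<^sub>R Xi_defect g (hD \<phi>)"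
      unfolding linear_scale[OF linear_At[OF g0]] At0_Xi_defect[OF g] by (simp only: scaleR_scaleR mult.commute)
  qed
  then show ?thesis using g0 by (simp add: Xi_defect_def)
qed

end

section \<open>Invariance\<close>

definition EisH :: hol where "EisH = hol_of Eis"

lemma hv_EisH_pow: "Im \<tau> > 0 \<Longrightarrow> hv ((hD ^^ k) EisH) \<tau> = (deriv ^^ k) Eis \<tau>"
proof (induction k arbitrary: \<tau>)
  case 0
  then show ?case by (simp add: EisH_def hv_hol_of[OF Eis_holomorphic])
next
  case (Suc k)
  have "((deriv ^^ k) Eis has_field_derivative hv (hD ((hD ^^ k) EisH)) \<tau>) (at \<tau>)"
    by (rule has_field_derivative_transform_within_open[OF hv_deriv[OF Suc.prems] open_UH])
       (use Suc in auto)
  then show ?case by (simp add: DERIV_imp_deriv)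
qed

lemma deriv_pow_periodic:
  assumes "\<And>z. f (z + c) = (f z :: complex)"
  shows "(deriv ^^ k) f (z + c) = (deriv ^^ k) f z"
proof (induction k arbitrary: z)
  case (Suc k)
  have "(\<lambda>x. (deriv ^^ k) f (x + c)) = (deriv ^^ k) f" using Suc by (intro ext)
  then have "((deriv ^^ k) f has_field_derivative D) (at (z + c)) \<longleftrightarrow> ((deriv ^^ k) f has_field_derivative D) (at z)" for D
    using DERIV_shift[of "(deriv ^^ k) f" D z c] by simp
  then show ?case by (simp add: deriv_def[of "(deriv ^^ k) f"])
qed (simp add: assms)

text \<open>The sign and the factorial cancel the coefficient of the k-th derivative of an inverse
  linear function.\<close>

lemma ps_U:
  assumes "gam g \<noteq> 0"
  shows "ps k (gam g *\<^sub>R U g (- 1)) = (gam g ^ Suc k) *\<^sub>R U g (- 1 - int k)"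
proof -
  have "(hD ^^ k) (U g (- 1)) = ((- 1) ^ k * fact k * gam g ^ k) *\<^sub>R U g (- 1 - int k)"
  proof (induction k)
    case (Suc k)
    have "hD (U g (- 1 - int k)) = (of_int (- 1 - int k) * gam g) *\<^sub>R U g (- 1 - int k - 1)"
      by (rule hD_U[OF assms])
    moreover have "- 1 - int k - 1 = - 1 - int (Suc k)" by simp
    moreover have "of_int (- 1 - int k) = - real (Suc k)" by simp
    ultimately have d: "hD (U g (- 1 - int k)) = (- real (Suc k) * gam g) *\<^sub>R U g (- 1 - int (Suc k))"
      by (simp only:)
    have "(hD ^^ Suc k) (U g (- 1)) = ((- 1) ^ k * fact k * gam g ^ k) *\<^sub>R hD (U g (- 1 - int k))"
      using Suc by simp
    then show ?case unfolding d by (simp add: algebra_simps)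
  qed simp
  then show ?thesis
    unfolding ps_def linear_scale[OF linear_hD_pow]
    by (intro hol_eqI) (simp add: power_mult_distrib[symmetric] flip: power_mult)
qed

lemma lev_pos_iff: "lev m \<ge> 1 \<longleftrightarrow> size (fst m) < size (snd m)"
  by (auto simp: lev_def)

section \<open>Identification of the constants and invariance of the element\<close>

context cdo_inv
begin

lemma piT_m0:
  assumes "good g"
  shows "piT g m0 1 = single m0 1 + Xi (gam g *\<^sub>R U g (- 1))"
proof -
  have "Xi (gam g *\<^sub>R U g (- 1)) = (\<Sum>m\<in>S0. single m (hc (cc m) * ((gam g powi lev m) *\<^sub>R U g (- lev m))))"
    unfolding Xi_def
  proof (intro sum.cong refl)
    fix m assume m: "m \<in> S0"
    have "lev m = int (Suc (kk m))" "- 1 - int (kk m) = - lev m" using S0D(2)[OF m] by (auto simp: kk_def)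
    moreover from this have "gam g powi lev m = gam g ^ Suc (kk m)" by (simp only: power_int_of_nat)
    ultimately show "single m (hc (cc m) * ps (kk m) (gam g *\<^sub>R U g (- 1))) =
       single m (hc (cc m) * ((gam g powi lev m) *\<^sub>R U g (- lev m)))"
      unfolding ps_U[OF goodD(1)[OF assms]] by (simp only:)
  qed
  then show ?thesis using rep[OF assms] by (simp add: S0_def)
qed

lemma lookup_piT_m0:
  assumes "good g" "Im \<tau> > 0"
  shows "hv (lookup (piT g m0 1) m) \<tau> = (if m = m0 then 1 else 0) +
    (if is_pp m \<and> size (fst m) < size (snd m)
     then cc m * of_real (gam g) ^ (size (snd m) - size (fst m)) / den g \<tau> ^ (size (snd m) - size (fst m)) else 0)"
proof (cases "cc m = 0")
  case True
  then show ?thesis using assms by (simp add: piT_m0 lookup_add lookup_single' lookup_Xi hc_simps)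
next
  case False
  define k where "k = size (snd m) - size (fst m)"
  have m: "is_pp m" "size (fst m) < size (snd m)" using ccD[OF False] lev_pos_iff by auto
  have k: "k = Suc (kk m)" using m by (auto simp: k_def kk_def lev_def)
  have "den g \<tau> powi (- 1 - int (kk m)) = 1 / den g \<tau> ^ k"
  proof -
    have "- 1 - int (kk m) = - int k" using k by simp
    then show ?thesis by (simp only: power_int_minus power_int_of_nat) (simp add: divide_inverse)
  qed
  then have "hv (ps (kk m) (gam g *\<^sub>R U g (- 1))) \<tau> = of_real (gam g) ^ k / den g \<tau> ^ k"
    unfolding ps_U[OF goodD(1)[OF assms(1)]] k[symmetric] using assms goodD[OF assms(1)] by (simp add: hv_U)
  then show ?thesis using assms m unfolding k_def[symmetric]
    by (simp add: piT_m0 lookup_add lookup_single' lookup_Xi)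
qed

lemma mono_state_eq: "mono_state (fst m0) (snd m0) m \<tau> = (if m = m0 then 1 else 0)"
  by (simp add: mono_state_def)

text \<open>For \<gamma> = 0 each correction term contains a positive power of 0, so the statement
  reduces to invariance of the monomial.\<close>

lemma pi_act_mono_state:
  assumes "sl2R g" "Im \<tau> > 0"
  shows "pi_act g (mono_state (fst m0) (snd m0)) m \<tau> = mono_state (fst m0) (snd m0) m \<tau> +
    (if is_pp m \<and> size (fst m) < size (snd m)
     then cc m * (of_real (gam g)) ^ (size (snd m) - size (fst m))
          / (of_real (gam g) * \<tau> + of_real (del g)) ^ (size (snd m) - size (fst m)) else 0)"
proof -
  let ?s = "mono_state (fst m0) (snd m0)"
  have supp: "{m. ?s m \<noteq> (\<lambda>_. 0)} \<subseteq> {m0}" by (auto simp: mono_state_eq fun_eq_iff)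
  show ?thesis
  proof (cases "gam g = 0")
    case False
    then have g: "good g" using assms by (simp add: good_def)
    have "pi_act g ?s m \<tau> = hv (lookup (\<Sum>m\<in>{m0}. (gam g powi (- lev m)) *\<^sub>R piT g m 1) m) \<tau>"
      by (rule pi_act_W[OF g _ supp]) (use pp0 assms in \<open>auto simp: mono_state_eq\<close>)
    then show ?thesis using lookup_piT_m0[OF g assms(2), of m] by (simp add: lev0 mono_state_eq den_def)
  next
    case True
    have pp: "is_pp m" if "?s m \<noteq> (\<lambda>_. 0)" for m using supp that pp0 by auto
    have "pi_act g ?s m \<tau> = ((of_real (del g))\<^sup>2) ^ size (fst m) * (of_real (fst g / del g) ^ size (snd m) * ?s m (mob g \<tau>))"
      by (rule pi_act_gam0[OF True assms(1) finite_subset[OF supp] pp]) simp_all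
    also have "\<dots> = ?s m \<tau>"
    proof (cases "m = m0")
      case True
      \<comment> \<open>With p parts of each kind the monomial is scaled by \<delta>^(2p)
        (\<alpha>/\<delta>)^p = (\<alpha>\<delta>)^p; this is where p(\<lambda>) = p(\<mu>) makes
        the scalar 1.\<close>
      have d: "fst g * del g = 1" using assms(1) \<open>gam g = 0\<close> by (simp add: sl2R_def gam_def del_def case_prod_unfold)
      then have d0: "del g \<noteq> 0" by auto
      have sz: "size (snd m0) = size (fst m0)" using lev0 by (simp add: lev_def)
      have "(del g)\<^sup>2 * (fst g / del g) = 1" using d d0 by (simp add: power2_eq_square mult.commute)
      then have "((del g)\<^sup>2) ^ size (fst m0) * (fst g / del g) ^ size (fst m0) = 1"
        by (simp only: power_mult_distrib[symmetric] power_one)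
      then have "complex_of_real (((del g)\<^sup>2) ^ size (fst m0) * (fst g / del g) ^ size (fst m0)) = 1" by simp
      then have "((of_real (del g))\<^sup>2) ^ size (fst m0) * of_real (fst g / del g) ^ size (fst m0) = (1 :: complex)"
        by (simp only: of_real_mult of_real_power)
      then show ?thesis using True by (simp only: mono_state_eq sz refl if_True mult_1_right)
    qed (simp add: mono_state_eq)
    finally show ?thesis using True by simp
  qed
qed

lemma c0_eq: "c0 (fst m0) (snd m0) = cc"
  unfolding c0_def
proof (rule the_equality)
  have "\<not> (is_pp m \<and> size (fst m) < size (snd m)) \<Longrightarrow> cc m = 0" for m using ccD[of m] lev_pos_iff[of m] by blast
  then show "(\<forall>m. \<not> (is_pp m \<and> size (fst m) < size (snd m)) \<longrightarrow> cc m = 0) \<and>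
     (\<forall>g. sl2R g \<longrightarrow> (\<forall>m \<tau>. Im \<tau> > 0 \<longrightarrow>
        pi_act g (mono_state (fst m0) (snd m0)) m \<tau> =
          mono_state (fst m0) (snd m0) m \<tau> +
          (if is_pp m \<and> size (fst m) < size (snd m)
           then cc m * (of_real (gam g)) ^ (size (snd m) - size (fst m))
                / (of_real (gam g) * \<tau> + of_real (del g)) ^ (size (snd m) - size (fst m))
           else 0)))"
    using pi_act_mono_state by blast
next
  fix c
  assume c: "(\<forall>m. \<not> (is_pp m \<and> size (fst m) < size (snd m)) \<longrightarrow> c m = 0) \<and>
     (\<forall>g. sl2R g \<longrightarrow> (\<forall>m \<tau>. Im \<tau> > 0 \<longrightarrow>
        pi_act g (mono_state (fst m0) (snd m0)) m \<tau> =
          mono_state (fst m0) (snd m0) m \<tau> +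
          (if is_pp m \<and> size (fst m) < size (snd m)
           then c m * (of_real (gam g)) ^ (size (snd m) - size (fst m))
                / (of_real (gam g) * \<tau> + of_real (del g)) ^ (size (snd m) - size (fst m))
           else 0)))"
  \<comment> \<open>One element with \<gamma> = 1 and \<delta> = 0, evaluated at the point i,
    already determines all constants, since the factor 1/i^n is nonzero.\<close>
  define g :: mat2 where "g = (0, - 1, 1, 0)"
  have g: "sl2R g" "gam g = 1" "del g = 0" by (auto simp: g_def sl2R_def gam_def del_def)
  show "c = cc"
  proof
    fix m
    show "c m = cc m"
    proof (cases "is_pp m \<and> size (fst m) < size (snd m)")
      case False
      then show ?thesis using c ccD[of m] lev_pos_iff[of m] by metis
    next
      case True
      have i: "Im \<i> > 0" by simp
      have "pi_act g (mono_state (fst m0) (snd m0)) m \<i> = mono_state (fst m0) (snd m0) m \<i> +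
           (if is_pp m \<and> size (fst m) < size (snd m)
           then c m * (of_real (gam g)) ^ (size (snd m) - size (fst m))
                / (of_real (gam g) * \<i> + of_real (del g)) ^ (size (snd m) - size (fst m)) else 0)"
        using c g(1) i by blast
      with pi_act_mono_state[OF g(1) i, of m] True show ?thesis by (simp add: g)
    qed
  qed
qed

lemma inv_elem_hv:
  assumes "Im \<tau> > 0"
  shows "inv_elem (fst m0) (snd m0) m \<tau> = hv (lookup (single m0 1 + Xi EisH) m) \<tau>"
proof (cases "cc m = 0")
  case True
  then show ?thesis using assms
    by (simp add: inv_elem_def c0_eq mono_state_eq lookup_add lookup_single' lookup_Xi hc_simps Let_def)
next
  case False
  have m: "is_pp m" "size (fst m) < size (snd m)" using ccD[OF False] lev_pos_iff by auto
  have "size (snd m) - size (fst m) - 1 = kk m" using m by (auto simp: kk_def lev_def)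
  then show ?thesis using assms m
    by (simp add: inv_elem_def c0_eq mono_state_eq lookup_add lookup_single' lookup_Xi Let_def ps_def
        hv_EisH_pow del: diff_diff_left)
qed

lemma inv_elem_supp: "{m. inv_elem (fst m0) (snd m0) m \<noteq> (\<lambda>_. 0)} \<subseteq> insert m0 S0"
proof
  fix m assume m: "m \<in> {m. inv_elem (fst m0) (snd m0) m \<noteq> (\<lambda>_. 0)}"
  show "m \<in> insert m0 S0"
  proof (rule ccontr)
    assume "m \<notin> insert m0 S0"
    then have "m \<noteq> m0" "cc m = 0" using cc_notin by auto
    then have "inv_elem (fst m0) (snd m0) m = (\<lambda>_. 0)"
      by (auto simp: inv_elem_def c0_eq mono_state_eq Let_def fun_eq_iff)
    then show False using m by simp
  qed
qed

lemma pp_insert: "m \<in> insert m0 S0 \<Longrightarrow> is_pp m" using pp0 S0D(1) by blast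

lemma pi_act_inv_elem:
  assumes g: "good g" and E: "hcomp g EisH = U g 2 * EisH - gam g *\<^sub>R U g 1" and t: "Im \<tau> > 0"
  shows "pi_act g (inv_elem (fst m0) (snd m0)) m \<tau> = inv_elem (fst m0) (snd m0) m \<tau>"
proof -
  note g0 = goodD(1)[OF g]
  let ?s = "inv_elem (fst m0) (snd m0)"
  define f where "f m = (if m = m0 then 1 else hc (cc m) * ps (kk m) EisH)" for m
  have cc0: "cc m0 = 0" using m0_notin cc_notin by blast
  have "pi_act g ?s m \<tau> = hv (lookup (\<Sum>m\<in>insert m0 S0. (gam g powi (- lev m)) *\<^sub>R piT g m (f m)) m) \<tau>"
  proof (rule pi_act_W[OF g _ inv_elem_supp pp_insert _ t])
    show "finite (insert m0 S0)" using fS0 by simp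
    show "?s m \<tau> = hv (f m) \<tau>" if "Im \<tau> > 0" for m \<tau>
      using that unfolding inv_elem_hv[OF that] f_def
      by (simp add: lookup_add lookup_single' lookup_Xi cc0 hc_simps)
  qed
  also have "(\<Sum>m\<in>insert m0 S0. (gam g powi (- lev m)) *\<^sub>R piT g m (f m)) = piT g m0 1 + piXi g EisH"
  proof -
    have "(\<Sum>m\<in>S0. (gam g powi (- lev m)) *\<^sub>R piT g m (f m)) = piXi g EisH"
      unfolding piXi_def by (intro sum.cong refl) (use m0_notin in \<open>auto simp: f_def\<close>)
    then show ?thesis using fS0 m0_notin by (simp add: f_def lev0)
  qed
  also have "piXi g EisH = Xi (EisH - gam g *\<^sub>R U g (- 1))"
  proof -
    have "U g (- 2) * hcomp g EisH = EisH - gam g *\<^sub>R U g (- 1)"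
      unfolding E right_diff_distrib mult_scaleR_hol U_mult[OF g0, of "- 2" 1 "- 1", simplified]
        U_mult'[OF g0, of "- 2" 2 0, simplified] by (simp add: U_0[OF g0])
    then show ?thesis unfolding piXi_eq[OF g] by simp
  qed
  \<comment> \<open>The correction from the leading monomial and the anomaly of E are the same value
    of \<open>Xi\<close> with opposite signs.\<close>
  also have "piT g m0 1 + Xi (EisH - gam g *\<^sub>R U g (- 1)) = single m0 1 + Xi EisH"
    unfolding piT_m0[OF g] linear_diff[OF linear_Xi] by simp
  finally show ?thesis unfolding inv_elem_hv[OF t] .
qed

text \<open>With \<alpha> = \<delta> and \<alpha>\<delta> = 1 all scalars on monomials are 1, so
  only the integer translation of \<tau> remains, and E and its derivatives are periodic.\<close>

lemma pi_act_inv_elem_gam0: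
  assumes "sl2R g" "gam g = 0" "fst g = del g" "mob g \<tau> = \<tau> + of_int b"
  shows "pi_act g (inv_elem (fst m0) (snd m0)) m \<tau> = inv_elem (fst m0) (snd m0) m \<tau>"
proof -
  let ?s = "inv_elem (fst m0) (snd m0)"
  have pp: "is_pp m" if "?s m \<noteq> (\<lambda>_. 0)" for m using pp_insert inv_elem_supp that by blast
  have fin: "finite {m. ?s m \<noteq> (\<lambda>_. 0)}" using finite_subset[OF inv_elem_supp] fS0 by simp
  have d: "(del g)\<^sup>2 = 1" using assms(1-3) by (simp add: sl2R_def gam_def del_def case_prod_unfold power2_eq_square)
  then have d0: "del g \<noteq> 0" by auto
  have d2: "(complex_of_real (del g))\<^sup>2 = 1" using d by (metis of_real_1 of_real_power)
  have per: "(deriv ^^ k) Eis (\<tau> + of_int b) = (deriv ^^ k) Eis \<tau>" for k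
    by (rule deriv_pow_periodic) (simp add: Eis_def E2_periodic)
  have "pi_act g ?s m \<tau> = ?s m (mob g \<tau>)"
    using pi_act_gam0[OF assms(2,1) fin pp, of m \<tau>] d0 by (simp add: assms(3) d2)
  also have "\<dots> = ?s m \<tau>" unfolding assms(4) by (simp add: inv_elem_def mono_state_eq per Let_def)
  finally show ?thesis .
qed

end

theorem theorem4p3:
  fixes l0 u0 :: "nat multiset"
  assumes "\<forall>k\<in>#l0. k > 0" and "\<forall>k\<in>#u0. k > 0" and "size l0 = size u0"
  shows "\<forall>\<alpha> \<beta> \<gamma> \<delta> :: int. \<alpha> * \<delta> - \<beta> * \<gamma> = 1 \<longrightarrow>
           (\<forall>m \<tau>. Im \<tau> > 0 \<longrightarrow>
              pi_act (of_int \<alpha>, of_int \<beta>, of_int \<gamma>, of_int \<delta>) (inv_elem l0 u0) m \<tau>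
              = inv_elem l0 u0 m \<tau>)"
proof (intro allI impI)
  fix \<alpha> \<beta> \<gamma> \<delta> :: int and m :: mono and \<tau> :: complex
  assume det: "\<alpha> * \<delta> - \<beta> * \<gamma> = 1" and t: "Im \<tau> > 0"
  define m0 where "m0 = (l0, u0)"
  have pp0: "is_pp m0" and lev0: "lev m0 = 0" using assms by (auto simp: m0_def is_pp_def lev_def)
  obtain cc where cc: "finite {m. cc m \<noteq> 0}" "\<And>m. cc m \<noteq> 0 \<Longrightarrow> is_pp m \<and> lev m \<ge> 1"
    "\<And>g. good g \<Longrightarrow> piT g m0 1 = single m0 1 +
       (\<Sum>m\<in>{m. cc m \<noteq> 0}. single m (hc (cc m) * ((gam g powi lev m) *\<^sub>R U g (- lev m))))"
    using cc_exists[OF pp0 lev0] by blast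
  interpret cdo_inv m0 cc by unfold_locales (use pp0 lev0 cc in auto)
  define g :: mat2 where "g = (of_int \<alpha>, of_int \<beta>, of_int \<gamma>, of_int \<delta>)"
  have gg: "gam g = of_int \<gamma>" "del g = of_int \<delta>" "fst g = of_int \<alpha>" "fst (snd g) = of_int \<beta>"
    by (auto simp: g_def gam_def del_def)
  have "real_of_int (\<alpha> * \<delta> - \<beta> * \<gamma>) = 1" using det by simp
  then have sl: "sl2R g" by (simp add: g_def sl2R_def)
  have "pi_act g (inv_elem (fst m0) (snd m0)) m \<tau> = inv_elem (fst m0) (snd m0) m \<tau>"
  proof (cases "\<gamma> = 0")
    case False
    then have g: "good g" using sl by (simp add: good_def gg)
    have "hcomp g EisH = U g 2 * EisH - gam g *\<^sub>R U g 1"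
    proof (rule hol_eqI)
      fix z :: complex assume z: "Im z > 0"
      have hE: "hv EisH w = Eis w" if "Im w > 0" for w using hv_EisH_pow[OF that, of 0] by simp
      have "hv (hcomp g EisH) z = Eis ((of_int \<alpha> * z + of_int \<beta>) / (of_int \<gamma> * z + of_int \<delta>))"
        unfolding hv_hcomp[OF sl z] hE[OF Im_mob[OF sl z]] by (simp add: mob_den den_def gg)
      also have "\<dots> = hv (U g 2 * EisH - gam g *\<^sub>R U g 1) z"
        unfolding Eis_transform[OF det z] using z goodD[OF g] by (simp add: hE hv_U den_def gg)
      finally show "hv (hcomp g EisH) z = hv (U g 2 * EisH - gam g *\<^sub>R U g 1) z" .
    qed
    from pi_act_inv_elem[OF g this t] show ?thesis .
  next
    case True
    then have "\<alpha> * \<delta> = 1" using det by simp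
    then consider "\<alpha> = 1" "\<delta> = 1" | "\<alpha> = - 1" "\<delta> = - 1" by (auto simp: zmult_eq_1_iff)
    \<comment> \<open>For \<alpha> = \<delta> = -1 the quotient (-\<tau>+\<beta>)/(-1) reverses the
      sign of the shift.\<close>
    then have "fst g = del g" "mob g \<tau> = \<tau> + of_int (if \<delta> = 1 then \<beta> else - \<beta>)"
      using True by (cases; simp add: gg mob_den den_def)+
    from pi_act_inv_elem_gam0[OF sl _ this] True show ?thesis by (simp add: gg)
  qed
  then show "pi_act (of_int \<alpha>, of_int \<beta>, of_int \<gamma>, of_int \<delta>) (inv_elem l0 u0) m \<tau> = inv_elem l0 u0 m \<tau>"
    by (simp add: g_def m0_def)
qed

end
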